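(* Let $n\ge1$ and let $\alpha,\beta\in\mathbb C^n$ satisfy $\Re\alpha_j+\Re\beta_j>-1$ and $\alpha_j,\beta_j\notin\{-1,-2,\ldots\}$ for all $1\le j\le n$. Let $1<p\le\infty$ and assume that a separately $(\alpha,\beta)$-harmonic function $u$ on $\mathbb D^n$ satisfies $$\sup_{0\le r<1}\|u_r\|_{L^p(\mathbb T^n)}<\infty,\qquad\text{where } u_r(\zeta)=u(r\zeta),\ \zeta\in\mathbb T^n.$$ Then there exists a unique function $\psi\in L^p(\mathbb T^n)$ such that $u=P_{\alpha,\beta}[\psi]$.
   Context: $\mathbb D$ is the open unit disc and $\mathbb T$ the unit circle; $m_n$ is the normalized Haar measure on $\mathbb T^n$, and $L^p(\mathbb T^n)$ is taken with respect to $m_n$. For $1\le j\le n$, $$L_{\alpha_j,\beta_j}=(1-|z_j|^2)\frac{\partial^2}{\partial z_j\partial\overline{z_j}}+\alpha_jz_j\frac{\partial}{\partial z_j}+\beta_j\overline{z_j}\frac{\partial}{\partial\overline{z_j}}-\alpha_j\beta_j .$$ A function $u\in C^2(\mathbb D^n)$ (complex valued) is separately $(\alpha,\beta)$-harmonic if $L_{\alpha_j,\beta_j}u=0$ on $\mathbb D^n$ for all $1\le j\le n$. The $(\alpha,\beta)$-Poisson kernel is, for $z\in\mathbb D^n$, $\zeta\in\mathbb T^n$ (principal branches of powers), $$P_{\alpha,\beta}(z,\zeta)=\prod_{j=1}^n c_{\alpha_j,\beta_j}\frac{(1-|z_j|^2)^{\alpha_j+\beta_j+1}}{(1-z_j\overline{\zeta_j})^{\alpha_j+1}(1-\overline{z_j}\zeta_j)^{\beta_j+1}},\qquad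 c_{a,b}=\frac{\Gamma(a+1)\Gamma(b+1)}{\Gamma(a+b+1)},$$ and $P_{\alpha,\beta}[f](z)=\int_{\mathbb T^n}P_{\alpha,\beta}(z,\zeta)f(\zeta)\,dm_n(\zeta)$, $z\in\mathbb D^n$, for $f\in L^1(\mathbb T^n)$. *)

theory Defs
  imports "HOL-Analysis.Analysis" "HOL-Probability.Essential_Supremum"
begin

definition polydisc :: "(complex ^ 'n) set" where
  "polydisc = {z. \<forall>j. norm (z $ j) < 1}"

definition torus :: "(complex ^ 'n) set" where
  "torus = {\<zeta>. \<forall>j. norm (\<zeta> $ j) = 1}"

text \<open>
  Normalized Haar measure on the torus: the image of the uniform distribution on
  \<open>[0, 2\<pi>]\<^sup>n\<close> under \<open>\<theta> \<mapsto> (exp (i \<theta>\<^sub>j))\<^sub>j\<close>, i.e.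
  \<open>d\<theta>\<^sub>1 \<dots> d\<theta>\<^sub>n / (2\<pi>)\<^sup>n\<close>, on the Borel sets of the torus.
\<close>
definition torus_measure :: "(complex ^ 'n) measure" where
  "torus_measure =
     distr (uniform_measure lborel (cbox 0 (\<chi> j. 2 * pi)) :: (real ^ 'n) measure)
       (restrict_space borel torus) (\<lambda>\<theta>. \<chi> j. cis (\<theta> $ j))"

lemma torus_param_measurable:
  "(\<lambda>\<theta>::real ^ 'n. \<chi> j. cis (\<theta> $ j)) \<in> lborel \<rightarrow>\<^sub>M restrict_space borel torus"
proof (rule measurable_restrict_space2)
  show "(\<lambda>\<theta>::real ^ 'n. \<chi> j. cis (\<theta> $ j)) \<in> space lborel \<rightarrow> torus"
    by (auto simp: torus_def)
  have "continuous_on UNIV (\<lambda>\<theta>::real ^ 'n. \<chi> j. cis (\<theta> $ j))"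
    unfolding cis_conv_exp by (intro continuous_intros)
  then show "(\<lambda>\<theta>::real ^ 'n. \<chi> j. cis (\<theta> $ j)) \<in> lborel \<rightarrow>\<^sub>M borel"
    by (simp add: borel_measurable_continuous_onI)
qed

lemma emeasure_torus_measure_space:
  "emeasure (torus_measure :: (complex ^ 'n) measure) (space torus_measure) = 1"
proof -
  let ?Q = "cbox 0 (\<chi> j. 2 * pi) :: (real ^ 'n) set"
  have ne: "emeasure lborel ?Q \<noteq> 0"
  proof -
    have pos: "((\<chi> j. 2 * pi) - 0 :: real ^ 'n) \<bullet> b > 0" if "b \<in> Basis" for b
      using that by (auto simp: Basis_vec_def inner_axis)
    then have "(\<Prod>b\<in>Basis. ((\<chi> j. 2 * pi) - 0 :: real ^ 'n) \<bullet> b) > 0"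
      by (intro prod_pos) auto
    moreover have "\<forall>b\<in>Basis. (0 :: real ^ 'n) \<bullet> b \<le> (\<chi> j. 2 * pi) \<bullet> b"
      using pos by (auto intro: less_imp_le)
    ultimately show ?thesis
      by (simp add: emeasure_lborel_cbox_eq ennreal_eq_0_iff)
  qed
  have fin: "emeasure lborel ?Q \<noteq> \<infinity>"
    by (subst emeasure_lborel_cbox_eq) auto
  have "emeasure (uniform_measure lborel ?Q) UNIV = 1"
    using ne fin by (simp add: ennreal_divide_self top.not_eq_extremum)
  moreover have "(\<lambda>\<theta>::real ^ 'n. \<chi> j. cis (\<theta> $ j)) -` torus = UNIV"
    by (auto simp: torus_def)
  moreover have "torus \<in> sets (restrict_space borel (torus :: (complex ^ 'n) set))"
    using sets.top[of "restrict_space borel (torus :: (complex ^ 'n) set)"]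
    by (simp add: space_restrict_space)
  moreover have "(\<lambda>\<theta>. \<chi> j. cis (\<theta> $ j))
      \<in> uniform_measure lborel ?Q \<rightarrow>\<^sub>M restrict_space borel torus"
    using torus_param_measurable
      measurable_cong_sets[of "uniform_measure lborel ?Q" lborel, OF sets_uniform_measure refl]
    by blast
  ultimately show ?thesis
    unfolding torus_measure_def by (subst emeasure_distr) (auto simp: space_restrict_space)
qed

subsection \<open>Lebesgue spaces for exponents up to infinity\<close>

definition Lp_norm :: "'a measure \<Rightarrow> ennreal \<Rightarrow> ('a \<Rightarrow> complex) \<Rightarrow> ennreal" where
  "Lp_norm M p f =
     (if p = \<infinity> then esssup M (\<lambda>x. ennreal (norm (f x)))
      else let I = (\<integral>\<^sup>+ x. ennreal (norm (f x) powr enn2real p) \<partial>M)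
           in if I = \<infinity> then \<infinity> else ennreal (enn2real I powr (1 / enn2real p)))"

definition Lp_space :: "'a measure \<Rightarrow> ennreal \<Rightarrow> ('a \<Rightarrow> complex) set" where
  "Lp_space M p = {f \<in> borel_measurable M. Lp_norm M p f < \<infinity>}"

subsection \<open>Separately \<open>(\<alpha>,\<beta>)\<close>-harmonic functions\<close>

text \<open>Both notions below use real (Frechet) derivatives and are meant for open \<open>S\<close>.\<close>

definition C1_on ::
  "('a::real_normed_vector \<Rightarrow> 'b::real_normed_vector) \<Rightarrow> 'a set \<Rightarrow> bool" where
  "C1_on f S \<longleftrightarrow> (\<forall>x\<in>S. f differentiable (at x)) \<and>
     (\<forall>v. continuous_on S (\<lambda>x. frechet_derivative f (at x) v))"

definition C2_on ::
  "('a::real_normed_vector \<Rightarrow> 'b::real_normed_vector) \<Rightarrow> 'a set \<Rightarrow> bool" where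
  "C2_on f S \<longleftrightarrow> C1_on f S \<and> (\<forall>v. C1_on (\<lambda>x. frechet_derivative f (at x) v) S)"

text \<open>
  Wirtinger derivatives \<open>\<partial>/\<partial>z\<^sub>j = (\<partial>/\<partial>x\<^sub>j - i \<partial>/\<partial>y\<^sub>j) / 2\<close> and
  \<open>\<partial>/\<partial>cnj z\<^sub>j = (\<partial>/\<partial>x\<^sub>j + i \<partial>/\<partial>y\<^sub>j) / 2\<close>, where \<open>z\<^sub>j = x\<^sub>j + i y\<^sub>j\<close>.
\<close>
definition dz :: "'n \<Rightarrow> (complex ^ 'n \<Rightarrow> complex) \<Rightarrow> complex ^ 'n \<Rightarrow> complex" where
  "dz j u z = (frechet_derivative u (at z) (axis j 1)
                 - \<i> * frechet_derivative u (at z) (axis j \<i>)) / 2"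

definition dzbar :: "'n \<Rightarrow> (complex ^ 'n \<Rightarrow> complex) \<Rightarrow> complex ^ 'n \<Rightarrow> complex" where
  "dzbar j u z = (frechet_derivative u (at z) (axis j 1)
                    + \<i> * frechet_derivative u (at z) (axis j \<i>)) / 2"

definition L_op ::
  "complex \<Rightarrow> complex \<Rightarrow> 'n \<Rightarrow> (complex ^ 'n \<Rightarrow> complex) \<Rightarrow> complex ^ 'n \<Rightarrow> complex" where
  "L_op a b j u z =
     of_real (1 - (norm (z $ j))\<^sup>2) * dz j (dzbar j u) z
       + a * (z $ j) * dz j u z + b * cnj (z $ j) * dzbar j u z - a * b * u z"

definition separately_harmonic ::
  "complex ^ 'n \<Rightarrow> complex ^ 'n \<Rightarrow> (complex ^ 'n \<Rightarrow> complex) \<Rightarrow> bool" where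
  "separately_harmonic \<alpha> \<beta> u \<longleftrightarrow>
     C2_on u polydisc \<and> (\<forall>j. \<forall>z\<in>polydisc. L_op (\<alpha> $ j) (\<beta> $ j) j u z = 0)"

subsection \<open>The \<open>(\<alpha>,\<beta>)\<close>-Poisson integral\<close>

definition c_const :: "complex \<Rightarrow> complex \<Rightarrow> complex" where
  "c_const a b = Gamma (a + 1) * Gamma (b + 1) / Gamma (a + b + 1)"

definition poisson_kernel ::
  "complex ^ 'n \<Rightarrow> complex ^ 'n \<Rightarrow> complex ^ 'n \<Rightarrow> complex ^ 'n \<Rightarrow> complex" where
  "poisson_kernel \<alpha> \<beta> z \<zeta> =
     (\<Prod>j\<in>UNIV. c_const (\<alpha> $ j) (\<beta> $ j) *
        (of_real (1 - (norm (z $ j))\<^sup>2) powr (\<alpha> $ j + \<beta> $ j + 1) /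
          ((1 - z $ j * cnj (\<zeta> $ j)) powr (\<alpha> $ j + 1) *
           (1 - cnj (z $ j) * \<zeta> $ j) powr (\<beta> $ j + 1))))"

definition poisson_integral ::
  "complex ^ 'n \<Rightarrow> complex ^ 'n \<Rightarrow> (complex ^ 'n \<Rightarrow> complex) \<Rightarrow> complex ^ 'n \<Rightarrow> complex" where
  "poisson_integral \<alpha> \<beta> f z = (LINT \<zeta>|torus_measure. poisson_kernel \<alpha> \<beta> z \<zeta> * f \<zeta>)"

end

theory Submission
  imports Defs "HOL-Probability.Probability_Measure"
begin

text \<open>
  Why the theorem is true. Write \<open>z = (\<rho>\<^sub>j \<zeta>\<^sub>j)\<^sub>j\<close> with radii \<open>0 \<le> \<rho>\<^sub>j < 1\<close> and \<open>\<zeta>\<close> in the torus, and expand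
  \<open>u(\<rho>\<zeta>)\<close> in a Fourier series in \<open>\<zeta>\<close>. In each variable the equation \<open>L u = 0\<close> turns a Fourier mode into
  a solution of a linear second-order equation in \<open>\<rho>\<^sub>j\<close> which is singular at \<open>0\<close>, and the solutions that stay
  regular at \<open>0\<close> form a line: the weighted Wronskian of two of them is constant and tends to \<open>0\<close> at \<open>0\<close>
  (\<open>polar_harmonic_modes_proportional\<close>). The one-variable Poisson kernel \<open>P(z,1)\<close> solves the same equation
  (\<open>polar_harmonic_polar_kernel\<close>), so its modes \<open>\<Phi>\<^sub>k\<close> (the constant \<open>radial_factor\<close>) span these lines. Hence
  the Fourier coefficients of \<open>u(\<rho>\<zeta>)\<close> are \<open>C\<^sub>m \<Prod>\<^sub>j \<Phi>\<^bsub>m\<^sub>j\<^esub>(\<rho>\<^sub>j)\<close> with constants \<open>C\<^sub>m\<close> (\<open>fcoef_product\<close>), while those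
  of \<open>P[\<psi>](\<rho>\<zeta>)\<close> are the coefficients of \<open>\<psi>\<close> times the same product (\<open>fcoef_poisson_integral\<close>). So
  \<open>u = P[\<psi>]\<close> holds exactly when \<open>\<psi>\<close> has Fourier coefficients \<open>C\<^sub>m\<close>. Since the product is not identically
  zero and an integrable function is determined by its Fourier coefficients, \<open>\<psi>\<close> is unique.

  Existence uses the boundary values \<open>\<Phi>\<^sub>k(r) \<longlonglongrightarrow> 1\<close> as \<open>r \<rightarrow> 1\<close> (\<open>mode_polar_kernel_tendsto\<close>): they say that the Fourier
  coefficients of \<open>u\<^sub>r\<close> tend to \<open>C\<^sub>m\<close>. The functions \<open>\<Phi>\<^sub>k\<close> are, up to elementary factors, power series
  whose coefficients are asymptotic to those of a binomial series, and an Abelian comparison gives the limit; the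
  normalising constant \<open>c\<close> of the kernel is made for this. It remains to produce \<open>\<psi>\<close> in \<open>L\<^sup>p\<close> from the
  bounded family \<open>u\<^sub>r\<close>. Instead of weak compactness, the proof minimises the strictly convex functional
  \<open>\<integral> sqrt (1 + |g|\<^sup>2)\<close> over shrinking midpoint-convex subsets of a ball of \<open>L\<^sup>p\<close>, cut out by the condition that
  more and more Fourier coefficients are close to \<open>C\<^sub>m\<close>. Because \<open>p > 1\<close>, almost-minimisers converge in
  \<open>L\<^sup>1\<close> and, along a subsequence, almost everywhere (\<open>midpoint_convex_L1_limit\<close>); the limit is \<open>\<psi>\<close>.
\<close>

section \<open>Strong limits from strict convexity\<close>

text \<open>
  The function \<open>sqrt (1 + |v|\<^sup>2)\<close> is the length of the vector \<open>(1, v)\<close>. The gap in the triangle inequality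
  for \<open>(1, z)\<close> and \<open>(1, w)\<close> is controlled from below by the area that they span, which is at least \<open>|z - w|\<close>.
\<close>
lemma sqrt_one_plus_square_midpoint_gap:
  fixes z w :: complex
  defines "h \<equiv> \<lambda>v::complex. sqrt (1 + (norm v)\<^sup>2)"
  shows "(norm (z - w))\<^sup>2 / (h z + h w) ^ 3 \<le> (h z + h w) / 2 - h ((z + w) / 2)"
proof -
  define A B C P d where "A = h z" and "B = h w" and "C = 2 * h ((z + w) / 2)"
    and "P = 1 + z \<bullet> w" and "d = (norm (z - w))\<^sup>2"
  have A1: "A \<ge> 1" and B1: "B \<ge> 1" by (auto simp: A_def B_def h_def)
  have A2: "A\<^sup>2 = 1 + (norm z)\<^sup>2" and B2: "B\<^sup>2 = 1 + (norm w)\<^sup>2"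
    by (auto simp: A_def B_def h_def add_nonneg_nonneg)
  have C2: "C\<^sup>2 = 4 + (norm (z + w))\<^sup>2"
    by (simp add: C_def h_def power_mult_distrib norm_divide power_divide add_nonneg_nonneg)
  have nzw: "(norm (z + w))\<^sup>2 = (norm z)\<^sup>2 + 2 * (z \<bullet> w) + (norm w)\<^sup>2"
    by (simp add: power2_norm_eq_inner inner_simps inner_commute)
  have d: "d = (norm z)\<^sup>2 - 2 * (z \<bullet> w) + (norm w)\<^sup>2"
    by (simp add: d_def power2_norm_eq_inner inner_simps inner_commute)
  have cs: "(z \<bullet> w)\<^sup>2 \<le> (norm z)\<^sup>2 * (norm w)\<^sup>2"
    using Cauchy_Schwarz_ineq[of z w] by (simp add: power2_norm_eq_inner)
  have AB: "d \<le> (A * B)\<^sup>2 - P\<^sup>2"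
    using cs unfolding power_mult_distrib A2 B2 d P_def
    by (simp add: power2_eq_square algebra_simps)
  have d0: "d \<ge> 0" by (simp add: d_def)
  have AB1: "A * B \<ge> 1" using A1 B1 mult_mono[of 1 A 1 B] by simp
  have "P \<le> A * B"
    by (rule power2_le_imp_le) (use AB d0 AB1 in auto)
  have 1: "d \<le> (A * B - P) * (2 * (A * B))"
  proof -
    have "d \<le> (A * B - P) * (A * B + P)" using AB by (simp add: power2_eq_square algebra_simps)
    also have "\<dots> \<le> (A * B - P) * (2 * (A * B))"
      using \<open>P \<le> A * B\<close> by (intro mult_left_mono) auto
    finally show ?thesis .
  qed
  have S: "(A + B)\<^sup>2 - C\<^sup>2 = 2 * (A * B - P)"
    unfolding C2 nzw power2_sum A2 B2 P_def by simp
  have CS: "C \<le> A + B"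
    by (rule power2_le_imp_le) (use S \<open>P \<le> A * B\<close> A1 B1 in auto)
  have "4 * (A * B) \<le> (A + B)\<^sup>2"
    using zero_le_power2[of "A - B"] by (simp add: power2_eq_square algebra_simps)
  then have "(A * B - P) * (2 * (A * B)) \<le> (A * B - P) * ((A + B)\<^sup>2 / 2)"
    using \<open>P \<le> A * B\<close> by (intro mult_left_mono) auto
  with 1 have "d \<le> ((A + B)\<^sup>2 - C\<^sup>2) / 4 * (A + B)\<^sup>2" unfolding S by (simp add: algebra_simps)
  also have "\<dots> = (A + B - C) / 4 * (A + B + C) * (A + B)\<^sup>2"
    by (simp add: power2_eq_square algebra_simps)
  also have "\<dots> \<le> (A + B - C) / 4 * (2 * (A + B)) * (A + B)\<^sup>2"
    using CS by (intro mult_right_mono mult_left_mono) auto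
  also have "\<dots> = ((A + B) / 2 - C / 2) * (A + B) ^ 3"
    by (simp add: power2_eq_square power3_eq_cube field_simps)
  finally have "d / (A + B) ^ 3 \<le> (A + B) / 2 - C / 2"
    using A1 B1 by (subst pos_divide_le_eq) auto
  then show ?thesis by (simp add: d_def A_def B_def C_def)
qed

text \<open>
  A pointwise substitute for Hoelder's inequality. Where the first term does not suffice, \<open>S\<close> is bounded by a
  constant depending on \<open>\<eta>\<close> (this uses \<open>q > 1\<close>) and \<open>d\<close> is bounded below by \<open>\<eta>\<close>.
\<close>
lemma le_powr_plus_quadratic:
  fixes q \<eta> :: real
  assumes "1 < q" "0 < \<eta>"
  obtains K where "K \<ge> 0" "\<And>d S. 0 \<le> d \<Longrightarrow> d \<le> S \<Longrightarrow> 1 \<le> S \<Longrightarrow> d \<le> \<eta> * S powr q + K * (d\<^sup>2 / S ^ 3)"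
proof
  \<comment> \<open>The solution of \<open>\<eta> R\<^sup>q = R\<close>.\<close>
  define R where "R = (1 / \<eta>) powr (1 / (q - 1))"
  have R: "R > 0" using assms by (simp add: R_def)
  show "R ^ 3 / \<eta> \<ge> 0" using R assms by simp
  fix d S :: real assume *: "0 \<le> d" "d \<le> S" "1 \<le> S"
  show "d \<le> \<eta> * S powr q + R ^ 3 / \<eta> * (d\<^sup>2 / S ^ 3)"
  proof (cases "d \<le> \<eta> * S powr q")
    case True
    then show ?thesis using * R assms by (intro add_increasing2) auto
  next
    case False
    then have "\<eta> * S powr q < S" using * by simp
    moreover have "S powr q = S powr (q - 1) * S" using * by (simp add: powr_diff)
    ultimately have "S powr (q - 1) < 1 / \<eta>" using * assms by (simp add: field_simps)
    then have "(S powr (q - 1)) powr (1 / (q - 1)) \<le> R"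
      unfolding R_def using assms * by (intro powr_mono2) auto
    then have SR: "S \<le> R" using assms * by (simp add: powr_powr)
    have "S powr q \<ge> 1" using * assms by (simp add: ge_one_powr_ge_zero)
    then have "\<eta> * 1 \<le> \<eta> * S powr q" using assms by (intro mult_left_mono) auto
    then have "\<eta> \<le> d" using False by simp
    have "d * (\<eta> * S ^ 3) \<le> d * (d * R ^ 3)"
      using * \<open>\<eta> \<le> d\<close> SR assms by (intro mult_left_mono mult_mono power_mono) auto
    then have "d \<le> R ^ 3 / \<eta> * (d\<^sup>2 / S ^ 3)"
      using * assms by (simp add: field_simps power2_eq_square)
    then show ?thesis using assms by (intro add_increasing) auto
  qed
qed

lemma sum_powr_le:
  fixes x y q :: real assumes "x \<ge> 0" "y \<ge> 0" "q > 0"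
  shows "(x + y) powr q \<le> 2 powr q * (x powr q + y powr q)"
proof -
  have "(x + y) powr q \<le> (2 * max x y) powr q"
    using assms by (intro powr_mono2) auto
  also have "\<dots> = 2 powr q * (max x y) powr q" using assms by (simp add: powr_mult)
  also have "\<dots> \<le> 2 powr q * (x powr q + y powr q)"
    by (intro mult_left_mono) (auto simp: max_def)
  finally show ?thesis .
qed

lemma le_one_plus_powr: fixes x q :: real assumes "x \<ge> 0" "q \<ge> 1" shows "x \<le> 1 + x powr q"
proof (cases "x \<le> 1")
  case False
  then have "x powr 1 \<le> x powr q" using assms by (intro powr_mono) auto
  then show ?thesis using False by simp
qed (simp add: add_increasing2)

text \<open>
  Take almost-minimisers of \<open>J g = \<integral> sqrt (1 + |g|\<^sup>2)\<close> on the sets \<open>S n\<close>. The infima increase to a finite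
  limit, and the midpoint of the \<open>n\<close>-th and a later almost-minimiser still lies in \<open>S n\<close>, so the convexity gap
  between them is small. The gap dominates \<open>\<integral> d\<^sup>2 / S\<^sup>3\<close> with \<open>d\<close> the distance of the two functions, and the
  bound on the \<open>q\<close>-th moments upgrades this to smallness of \<open>\<integral> d\<close>. Completeness of \<open>L\<^sup>1\<close> finishes the proof.
\<close>
lemma (in prob_space) midpoint_convex_L1_limit:
  fixes S :: "nat \<Rightarrow> ('a \<Rightarrow> complex) set" and q B :: real
  assumes q: "1 < q"
    and meas: "\<And>n g. g \<in> S n \<Longrightarrow> g \<in> borel_measurable M"
    and int: "\<And>n g. g \<in> S n \<Longrightarrow> integrable M (\<lambda>x. norm (g x) powr q)"
    and bd: "\<And>n g. g \<in> S n \<Longrightarrow> (\<integral>x. norm (g x) powr q \<partial>M) \<le> B"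
    and ne: "\<And>n. S n \<noteq> {}" and dec: "decseq S"
    and mid: "\<And>n f g. f \<in> S n \<Longrightarrow> g \<in> S n \<Longrightarrow> (\<lambda>x. (f x + g x) / 2) \<in> S n"
  obtains g \<psi> where "\<And>n. g n \<in> S n" "integrable M \<psi>"
    "AE x in M. (\<lambda>n. g n x) \<longlonglongrightarrow> \<psi> x" "(\<lambda>n. \<integral>x. norm (g n x - \<psi> x) \<partial>M) \<longlonglongrightarrow> 0"
proof -
  define h where "h = (\<lambda>v::complex. sqrt (1 + (norm v)\<^sup>2))"
  define J where "J g = (\<integral>x. h (g x) \<partial>M)" for g
  have h1: "1 \<le> h v" for v by (simp add: h_def)
  have hn: "norm v \<le> h v" for v by (simp add: h_def real_le_rsqrt)
  have hle: "h v \<le> 1 + norm v" for v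
    unfolding h_def by (rule real_le_lsqrt) (auto simp: power2_eq_square algebra_simps)
  have hle2: "h v \<le> 2 + norm v powr q" for v
    using hle[of v] le_one_plus_powr[of "norm v" q] q by simp
  have hm: "(\<lambda>x. h (g x)) \<in> borel_measurable M" if "g \<in> borel_measurable M" for g
    using that unfolding h_def by measurable
  have ih: "integrable M (\<lambda>x. h (g x))" if "g \<in> S n" for g n
    by (rule Bochner_Integration.integrable_bound[where f = "\<lambda>x. 2 + norm (g x) powr q"])
       (use that hm[OF meas] hle2 h1 int[OF that] in \<open>auto intro!: AE_I2 simp: abs_of_nonneg order_trans[OF zero_le_one]\<close>)
  have ig: "integrable M g" if "g \<in> S n" for g n
    by (rule Bochner_Integration.integrable_bound[OF ih[OF that]])
       (use that meas hn h1 in \<open>auto intro!: AE_I2 simp: order_trans[OF _ abs_ge_self]\<close>)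
  have J1: "1 \<le> J g" if "g \<in> S n" for g n
    unfolding J_def using integral_mono[OF _ ih[OF that], of "\<lambda>_. 1"] h1 prob_space by simp
  have J2: "J g \<le> 2 + B" if "g \<in> S n" for g n
  proof -
    have "J g \<le> (\<integral>x. 2 + norm (g x) powr q \<partial>M)"
      unfolding J_def by (intro integral_mono ih[OF that] hle2) (use int[OF that] in auto)
    also have "\<dots> \<le> 2 + B" using int[OF that] bd[OF that] prob_space by simp
    finally show ?thesis .
  qed
  define j where "j n = (INF g\<in>S n. J g)" for n
  have bb: "bdd_below (J ` S n)" for n using J1 by (auto intro!: bdd_belowI2)
  have j_le: "j n \<le> J g" if "g \<in> S n" for g n
    unfolding j_def by (rule cINF_lower[OF bb that])
  have "\<exists>g. g \<in> S n \<and> J g < j n + 1 / (real n + 1)" for n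
  proof -
    have "Inf (J ` S n) < j n + 1 / (real n + 1)" by (simp add: j_def)
    then show ?thesis using cInf_lessD[of "J ` S n"] ne[of n] by blast
  qed
  then obtain g0 where g0: "\<And>n. g0 n \<in> S n" "\<And>n. J (g0 n) < j n + 1 / (real n + 1)" by metis
  have sub: "S m \<subseteq> S n" if "n \<le> m" for n m using dec that by (auto simp: decseq_def)
  have jinc: "incseq j"
    unfolding incseq_def j_def using sub ne bb by (auto intro!: cINF_superset_mono)
  have "j n \<le> 2 + B" for n using j_le[OF g0(1)] J2[OF g0(1)] order_trans by blast
  then obtain L where jL: "j \<longlonglongrightarrow> L" and jleL: "\<And>n. j n \<le> L"
    using incseq_convergent[OF jinc] by blast
  \<comment> \<open>An upper bound for the convexity gap between the \<open>n\<close>-th and any later almost-minimiser.\<close>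
  define \<delta> where "\<delta> n = (L - j n) / 2 + 1 / (real n + 1)" for n
  have "(\<lambda>n. 1 / (real n + 1)) \<longlonglongrightarrow> 0"
    using LIMSEQ_inverse_real_of_nat by (simp add: inverse_eq_divide add.commute)
  then have "\<delta> \<longlonglongrightarrow> (L - L) / 2 + 0"
    unfolding \<delta>_def by (intro tendsto_intros jL) auto
  then have \<delta>0: "\<delta> \<longlonglongrightarrow> 0" by simp
  define D where "D f g = (\<integral>x. (norm (f x - g x))\<^sup>2 / (h (f x) + h (g x)) ^ 3 \<partial>M)" for f g
  have iD: "integrable M (\<lambda>x. (norm (f x - g x))\<^sup>2 / (h (f x) + h (g x)) ^ 3)"
    if "f \<in> S n" "g \<in> S n" for f g n
  proof (rule Bochner_Integration.integrable_bound[where f = "\<lambda>x. (h (f x) + h (g x)) / 2"])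
    show "integrable M (\<lambda>x. (h (f x) + h (g x)) / 2)" using ih that by auto
    show "(\<lambda>x. (norm (f x - g x))\<^sup>2 / (h (f x) + h (g x)) ^ 3) \<in> borel_measurable M"
      using hm meas that by measurable
    have "(norm (f x - g x))\<^sup>2 / (h (f x) + h (g x)) ^ 3 \<le> (h (f x) + h (g x)) / 2" for x
      using sqrt_one_plus_square_midpoint_gap[of "f x" "g x"] h1[of "(f x + g x) / 2"] unfolding h_def by linarith
    then show "AE x in M. norm ((norm (f x - g x))\<^sup>2 / (h (f x) + h (g x)) ^ 3) \<le> norm ((h (f x) + h (g x)) / 2)"
      by (intro AE_I2) (smt (verit, best) h1 real_norm_def zero_le_divide_iff zero_le_power zero_le_power2)
  qed
  have Dgap: "D f g \<le> (J f + J g) / 2 - J (\<lambda>x. (f x + g x) / 2)" if "f \<in> S n" "g \<in> S n" for f g n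
  proof -
    have "D f g \<le> (\<integral>x. (h (f x) + h (g x)) / 2 - h ((f x + g x) / 2) \<partial>M)"
      unfolding D_def
      by (intro integral_mono iD[OF that] Bochner_Integration.integrable_diff)
         (use ih[OF that(1)] ih[OF that(2)] ih[OF mid[OF that]] sqrt_one_plus_square_midpoint_gap in \<open>auto simp: h_def\<close>)
    then show ?thesis unfolding J_def using ih that ih[OF mid[OF that]] by simp
  qed
  have Dn: "D (g0 n) (g0 k) \<le> \<delta> n" if "n \<le> k" for n k
  proof -
    have k: "g0 k \<in> S n" using g0(1)[of k] sub[OF that] by auto
    have "1 / (real k + 1) \<le> 1 / (real n + 1)" using that by (intro divide_left_mono) auto
    moreover have "D \<le> (L - jn) / 2 + en" if "D \<le> (Jn + Jk) / 2 - Jm" "jn \<le> Jm"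
        "Jn < jn + en" "Jk < jk + ek" "jk \<le> L" "ek \<le> en" for D Jn Jk Jm jn jk ek en :: real
      using that by (simp add: field_simps)
    ultimately show ?thesis
      using Dgap[OF g0(1)[of n] k] j_le[OF mid[OF g0(1)[of n] k]] g0(2)[of n] g0(2)[of k] jleL[of k]
      unfolding \<delta>_def by blast
  qed
  \<comment> \<open>A common bound for the \<open>q\<close>-th moments of \<open>h f + h g\<close>.\<close>
  define W where "W = 4 powr q * (2 + 2 * B)"
  have "0 \<le> (\<integral>x. norm (g0 0 x) powr q \<partial>M)" by (intro integral_nonneg_AE) auto
  then have B0: "B \<ge> 0" using bd[OF g0(1)[of 0]] by linarith
  have W0: "W > 0" using B0 by (simp add: W_def)
  have S_powr: "(h z + h w) powr q \<le> 4 powr q * (2 + norm z powr q + norm w powr q)" for z w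
  proof -
    have a: "h v powr q \<le> 2 powr q * (1 + norm v powr q)" for v
      using powr_mono2[of q "h v" "1 + norm v"] hle[of v] h1[of v] sum_powr_le[of 1 "norm v" q] q by simp
    have "(h z + h w) powr q \<le> 2 powr q * (h z powr q + h w powr q)"
      by (intro sum_powr_le) (use h1 q order_trans[OF zero_le_one] in auto)
    also have "\<dots> \<le> 2 powr q * (2 powr q * (1 + norm z powr q) + 2 powr q * (1 + norm w powr q))"
      by (intro mult_left_mono add_mono a) auto
    also have "\<dots> = (2 * 2) powr q * (2 + norm z powr q + norm w powr q)"
      unfolding powr_mult by (simp add: algebra_simps)
    finally show ?thesis by simp
  qed
  have d_le: "norm (z - w) \<le> h z + h w" for z w
    using norm_triangle_ineq4[of z w] hn[of z] hn[of w] by linarith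
  have L1c: "\<exists>N. \<forall>n\<ge>N. \<forall>k\<ge>n. (\<integral>x. norm (g0 n x - g0 k x) \<partial>M) < e" if e: "e > 0" for e
  proof -
    have "e / (2 * W) > 0" using e W0 by simp
    then obtain K where K: "K \<ge> 0" "\<And>d S. 0 \<le> d \<Longrightarrow> d \<le> S \<Longrightarrow> 1 \<le> S \<Longrightarrow>
        d \<le> e / (2 * W) * S powr q + K * (d\<^sup>2 / S ^ 3)"
      using le_powr_plus_quadratic[OF q] by metis
    have "(\<lambda>n. K * \<delta> n) \<longlonglongrightarrow> K * 0" by (intro tendsto_intros \<delta>0)
    then have "eventually (\<lambda>n. K * \<delta> n < e / 2) sequentially"
      using e by (intro order_tendstoD) auto
    then obtain N where N: "\<And>n. n \<ge> N \<Longrightarrow> K * \<delta> n < e / 2" by (auto simp: eventually_sequentially)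
    have "(\<integral>x. norm (g0 n x - g0 k x) \<partial>M) < e" if "n \<ge> N" "k \<ge> n" for n k
    proof -
      have k: "g0 k \<in> S n" using g0(1)[of k] sub[OF that(2)] by auto
      note n = g0(1)[of n]
      let ?U = "\<lambda>x. 4 powr q * (2 + norm (g0 n x) powr q + norm (g0 k x) powr q)"
      have iU: "integrable M ?U" using int[OF n] int[OF k] by auto
      have "(\<integral>x. norm (g0 n x - g0 k x) \<partial>M) \<le>
        (\<integral>x. e / (2 * W) * ?U x + K * ((norm (g0 n x - g0 k x))\<^sup>2 / (h (g0 n x) + h (g0 k x)) ^ 3) \<partial>M)"
      proof (intro integral_mono)
        show "integrable M (\<lambda>x. norm (g0 n x - g0 k x))" using ig[OF n] ig[OF k] by auto
        show "integrable M (\<lambda>x. e / (2 * W) * ?U x + K * ((norm (g0 n x - g0 k x))\<^sup>2 / (h (g0 n x) + h (g0 k x)) ^ 3))"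
          by (intro Bochner_Integration.integrable_add integrable_mult_right iU iD[OF n k])
        fix x
        have "norm (g0 n x - g0 k x) \<le> e / (2 * W) * (h (g0 n x) + h (g0 k x)) powr q
           + K * ((norm (g0 n x - g0 k x))\<^sup>2 / (h (g0 n x) + h (g0 k x)) ^ 3)"
          using h1[of "g0 n x"] h1[of "g0 k x"] by (intro K(2) d_le) auto
        also have "\<dots> \<le> e / (2 * W) * ?U x + K * ((norm (g0 n x - g0 k x))\<^sup>2 / (h (g0 n x) + h (g0 k x)) ^ 3)"
          using e W0 by (intro add_right_mono mult_left_mono S_powr) auto
        finally show "norm (g0 n x - g0 k x) \<le> \<dots>" .
      qed
      also have "\<dots> = e / (2 * W) * (\<integral>x. ?U x \<partial>M) + K * D (g0 n) (g0 k)"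
        unfolding D_def
        by (subst Bochner_Integration.integral_add[OF integrable_mult_right[OF iU] integrable_mult_right[OF iD[OF n k]]])
           (simp only: integral_mult_right_zero)
      also have "(\<integral>x. ?U x \<partial>M) \<le> W"
        unfolding W_def using int[OF n] int[OF k] bd[OF n] bd[OF k] prob_space by simp
      then have "e / (2 * W) * (\<integral>x. ?U x \<partial>M) \<le> e / 2"
        using mult_left_mono[of "\<integral>x. ?U x \<partial>M" W "e / (2 * W)"] e W0 by simp
      then have "e / (2 * W) * (\<integral>x. ?U x \<partial>M) + K * D (g0 n) (g0 k) \<le> e / 2 + K * \<delta> n"
        using mult_left_mono[OF Dn[OF that(2)] K(1)] by linarith
      also have "\<dots> < e" using N[OF that(1)] by simp
      finally show ?thesis .
    qed
    then show ?thesis by blast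
  qed
  have L1c': "\<exists>N. \<forall>i\<ge>N. \<forall>k\<ge>N. (\<integral>x. norm (g0 i x - g0 k x) \<partial>M) < e" if e: "e > 0" for e
  proof -
    obtain N where N: "\<forall>n\<ge>N. \<forall>k\<ge>n. (\<integral>x. norm (g0 n x - g0 k x) \<partial>M) < e" using L1c[OF e] by auto
    have "(\<integral>x. norm (g0 i x - g0 k x) \<partial>M) < e" if "i \<ge> N" "k \<ge> N" for i k
      using N that by (cases "i \<le> k") (auto simp: norm_minus_commute[of "g0 i _"])
    then show ?thesis by blast
  qed
  obtain r where r: "strict_mono r" "AE x in M. Cauchy (\<lambda>i. g0 (r i) x)"
    using cauchy_L1_AE_cauchy_subseq[OF ig[OF g0(1)] L1c'] by blast
  define g where "g n = g0 (r n)" for n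
  have rn: "n \<le> r n" for n using r(1) by (rule seq_suble)
  have gS: "g n \<in> S n" for n using g0(1)[of "r n"] sub[OF rn[of n]] by (auto simp: g_def)
  have gm[measurable]: "g n \<in> borel_measurable M" for n using meas[OF gS] .
  define \<psi> where "\<psi> x = lim (\<lambda>n. g n x)" for x
  have \<psi>m[measurable]: "\<psi> \<in> borel_measurable M" unfolding \<psi>_def by measurable
  have conv: "AE x in M. (\<lambda>n. g n x) \<longlonglongrightarrow> \<psi> x"
    using r(2) by eventually_elim (simp add: \<psi>_def g_def Cauchy_convergent_iff convergent_LIMSEQ_iff)
  have fat: "(\<integral>\<^sup>+x. ennreal (norm (g n x - \<psi> x)) \<partial>M) \<le> ennreal e"
    if N: "\<forall>i\<ge>N. \<forall>k\<ge>N. (\<integral>x. norm (g0 i x - g0 k x) \<partial>M) < e" "n \<ge> N" for n N e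
  proof -
    have "(\<integral>\<^sup>+x. ennreal (norm (g n x - \<psi> x)) \<partial>M) =
      (\<integral>\<^sup>+x. liminf (\<lambda>k. ennreal (norm (g n x - g k x))) \<partial>M)"
    proof (rule nn_integral_cong_AE)
      show "AE x in M. ennreal (norm (g n x - \<psi> x)) = liminf (\<lambda>k. ennreal (norm (g n x - g k x)))"
        using conv
      proof eventually_elim
        case (elim x)
        have "(\<lambda>k. ennreal (norm (g n x - g k x))) \<longlonglongrightarrow> ennreal (norm (g n x - \<psi> x))"
          by (intro tendsto_intros elim)
        then show ?case by (intro lim_imp_Liminf[symmetric]) auto
      qed
    qed
    also have "\<dots> \<le> liminf (\<lambda>k. \<integral>\<^sup>+x. ennreal (norm (g n x - g k x)) \<partial>M)"
      by (intro nn_integral_liminf) measurable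
    also have "\<dots> \<le> ennreal e"
    proof (rule order_trans[OF Liminf_le_Limsup])
      show "limsup (\<lambda>k. \<integral>\<^sup>+x. ennreal (norm (g n x - g k x)) \<partial>M) \<le> ennreal e"
      proof (rule Limsup_bounded)
        show "\<forall>\<^sub>F k in sequentially. (\<integral>\<^sup>+x. ennreal (norm (g n x - g k x)) \<partial>M) \<le> ennreal e"
          using eventually_ge_at_top[of N]
        proof eventually_elim
          case (elim k)
          have "(\<integral>\<^sup>+x. ennreal (norm (g n x - g k x)) \<partial>M) = ennreal (\<integral>x. norm (g n x - g k x) \<partial>M)"
            using ig[OF gS[of n]] ig[OF gS[of k]] by (intro nn_integral_eq_integral) auto
          also have "\<dots> \<le> ennreal e"
            using N(1)[rule_format, of "r n" "r k"] N(2) elim rn[of n] rn[of k] by (intro ennreal_leI) (simp add: g_def)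
          finally show ?case .
        qed
      qed
    qed auto
    finally show ?thesis .
  qed
  have idiff: "integrable M (\<lambda>x. g n x - \<psi> x)" if "\<forall>i\<ge>N. \<forall>k\<ge>N. (\<integral>x. norm (g0 i x - g0 k x) \<partial>M) < e" "n \<ge> N" for n N e
    using fat[OF that] by (intro integrableI_bounded) (auto simp: top.extremum_unique less_top intro: le_less_trans)
  have i\<psi>: "integrable M \<psi>"
  proof -
    obtain N where "\<forall>i\<ge>N. \<forall>k\<ge>N. (\<integral>x. norm (g0 i x - g0 k x) \<partial>M) < 1" using L1c'[of 1] by auto
    from Bochner_Integration.integrable_diff[OF ig[OF gS] idiff[OF this order_refl]]
    have "integrable M (\<lambda>x. g N x - (g N x - \<psi> x))" .
    moreover have "(\<lambda>x. g N x - (g N x - \<psi> x)) = \<psi>" by auto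
    ultimately show ?thesis by (simp only:)
  qed
  have lim0: "(\<lambda>n. \<integral>x. norm (g n x - \<psi> x) \<partial>M) \<longlonglongrightarrow> 0"
  proof (rule LIMSEQ_I)
    fix e :: real assume e: "e > 0"
    obtain N where N: "\<forall>i\<ge>N. \<forall>k\<ge>N. (\<integral>x. norm (g0 i x - g0 k x) \<partial>M) < e / 2" using L1c'[of "e / 2"] e by auto
    have "norm ((\<integral>x. norm (g n x - \<psi> x) \<partial>M) - 0) < e" if "n \<ge> N" for n
    proof -
      have "ennreal (\<integral>x. norm (g n x - \<psi> x) \<partial>M) \<le> ennreal (e / 2)"
        using fat[OF N that] i\<psi> ig[OF gS] by (subst nn_integral_eq_integral[symmetric]) auto
      then have "(\<integral>x. norm (g n x - \<psi> x) \<partial>M) \<le> e / 2" using e by (subst (asm) ennreal_le_iff) auto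
      moreover have "0 \<le> (\<integral>x. norm (g n x - \<psi> x) \<partial>M)" by (intro integral_nonneg_AE) auto
      ultimately show ?thesis using e by simp
    qed
    then show "\<exists>no. \<forall>n\<ge>no. norm ((\<integral>x. norm (g n x - \<psi> x) \<partial>M) - 0) < e" by blast
  qed
  show ?thesis using that[OF gS i\<psi> conv lim0] .
qed

section \<open>The torus as a product of circles\<close>

definition angle :: "real measure" where
  "angle = uniform_measure lborel {0..2 * pi}"

lemma sets_angle [measurable_cong]: "sets angle = sets borel"
  by (simp add: angle_def)

lemma space_angle [simp]: "space angle = UNIV"
  by (simp add: angle_def)

lemma emeasure_angle: "A \<in> sets borel \<Longrightarrow> emeasure angle A = emeasure lborel ({0..2 * pi} \<inter> A) / ennreal (2 * pi)"
  by (simp add: angle_def emeasure_uniform_measure)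

interpretation angle: prob_space angle
  unfolding angle_def by (intro prob_space_uniform_measure) auto

interpretation angle_prod: product_prob_space "\<lambda>_. angle" UNIV
  by unfold_locales

lemma integral_angle:
  fixes g :: "real \<Rightarrow> complex"
  assumes "continuous_on UNIV g"
  shows "integrable angle g" "integral\<^sup>L angle g = integral {0..2 * pi} g / (2 * pi)"
proof -
  have gm[measurable]: "g \<in> borel_measurable borel" using assms by (rule borel_measurable_continuous_onI)
  have si: "set_integrable lborel {0..2 * pi} g"
    unfolding set_integrable_def by (intro borel_integrable_compact continuous_on_subset[OF assms]) auto
  have eq: "angle = density lborel (\<lambda>x. ennreal (indicator {0..2 * pi} x / (2 * pi)))"
    unfolding angle_def uniform_measure_def
    using divide_ennreal[of 1 "2 * pi"] by (intro density_cong) (auto simp: indicator_def)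
  have c: "(indicator {0..2 * pi} x / (2 * pi)) *\<^sub>R g x = (1 / (2 * pi)) *\<^sub>R (indicator {0..2 * pi} x *\<^sub>R g x)" for x
    by simp
  have nn: "AE x in lborel. 0 \<le> indicat_real {0..2 * pi} x / (2 * pi)" by simp
  have "integrable lborel (\<lambda>x. (1 / (2 * pi)) *\<^sub>R (indicat_real {0..2 * pi} x *\<^sub>R g x))"
    using si unfolding set_integrable_def by (rule integrable_scaleR_right)
  then show "integrable angle g"
    unfolding eq by (subst integrable_density[OF _ _ nn]) (simp_all only: c, measurable)
  have "integral\<^sup>L angle g = (LINT x|lborel. (indicat_real {0..2 * pi} x / (2 * pi)) *\<^sub>R g x)"
    unfolding eq by (subst integral_density[OF _ _ nn]) (simp_all, measurable)
  also have "\<dots> = (1 / (2 * pi)) *\<^sub>R (LINT x:{0..2 * pi}|lborel. g x)"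
    unfolding c set_lebesgue_integral_def by (rule integral_scaleR_right)
  also have "(LINT x:{0..2 * pi}|lborel. g x) = integral {0..2 * pi} g"
    by (rule set_borel_integral_eq_integral(2)[OF si])
  finally show "integral\<^sup>L angle g = integral {0..2 * pi} g / (2 * pi)" by (simp add: scaleR_conv_of_real)
qed

lemma vec_lambda_measurable:
  "(\<lambda>x. \<chi> j. x j) \<in> PiM UNIV (\<lambda>_::'n::finite. borel :: real measure) \<rightarrow>\<^sub>M (borel :: (real ^ 'n) measure)"
proof (rule borel_measurable_euclidean_space[THEN iffD2], rule ballI)
  fix b :: "real ^ 'n" assume "b \<in> Basis"
  then obtain i where b: "b = axis i 1" by (auto simp: Basis_vec_def)
  show "(\<lambda>x. (\<chi> j. x j) \<bullet> b) \<in> borel_measurable (PiM UNIV (\<lambda>_::'n. borel :: real measure))"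
    unfolding b by (simp add: inner_axis)
qed

lemma lborel_vec_box:
  fixes B :: "'n::finite \<Rightarrow> real set"
  assumes B: "\<And>j. B j \<in> sets borel"
  shows "emeasure lborel {\<theta> :: real ^ 'n. \<forall>j. \<theta> $ j \<in> B j} = (\<Prod>j\<in>UNIV. emeasure lborel (B j))"
proof -
  interpret P: product_sigma_finite "\<lambda>_::'n. lborel :: real measure" by unfold_locales
  have sP: "sets (PiM UNIV (\<lambda>_::'n. lborel :: real measure)) = sets (PiM UNIV (\<lambda>_. borel))"
    by (intro sets_PiM_cong) auto
  have m: "(\<lambda>x. \<chi> j. x j) \<in> PiM UNIV (\<lambda>_::'n. lborel :: real measure) \<rightarrow>\<^sub>M (borel :: (real ^ 'n) measure)"
    using vec_lambda_measurable measurable_cong_sets[OF sP refl] by blast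
  have eq: "lborel = distr (PiM UNIV (\<lambda>_::'n. lborel :: real measure)) (borel :: (real ^ 'n) measure) (\<lambda>x. \<chi> j. x j)"
  proof (rule lborel_eqI)
    fix l u :: "real ^ 'n" assume lu: "\<And>b. b \<in> Basis \<Longrightarrow> l \<bullet> b \<le> u \<bullet> b"
    have lu': "l $ j \<le> u $ j" for j using lu[of "axis j 1"] by (auto simp: inner_axis Basis_vec_def)
    have "(\<lambda>x. \<chi> j. x j) -` box l u \<inter> space (PiM UNIV (\<lambda>_::'n. lborel :: real measure)) = PiE UNIV (\<lambda>j. box (l $ j) (u $ j))"
      by (auto simp: space_PiM mem_box_cart box_real PiE_def Pi_def)
    then have "emeasure (distr (PiM UNIV (\<lambda>_::'n. lborel :: real measure)) borel (\<lambda>x. \<chi> j. x j)) (box l u)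
      = (\<Prod>j\<in>UNIV. emeasure lborel (box (l $ j) (u $ j)))"
      by (subst emeasure_distr[OF m]) (auto simp: P.emeasure_PiM)
    also have "\<dots> = (\<Prod>j\<in>UNIV. ennreal (u $ j - l $ j))" using lu' by (auto simp: box_real intro!: prod.cong)
    also have "\<dots> = ennreal (\<Prod>j\<in>UNIV. u $ j - l $ j)" using lu' by (intro prod_ennreal) auto
    also have "(\<Prod>j\<in>UNIV. u $ j - l $ j) = (\<Prod>b\<in>Basis. (u - l) \<bullet> b)"
    proof -
      have BB: "Basis = (\<lambda>j::'n. axis j (1::real)) ` UNIV" by (auto simp: Basis_vec_def)
      have "inj (\<lambda>j::'n. axis j (1::real))" by (auto simp: inj_def axis_eq_axis)
      then have "(\<Prod>b\<in>Basis. (u - l) \<bullet> b) = (\<Prod>j\<in>UNIV. (u - l) \<bullet> axis j 1)"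
        by (subst BB, subst prod.reindex) (simp_all add: comp_def)
      then show ?thesis by (simp add: inner_axis)
    qed
    finally show "emeasure (distr (PiM UNIV (\<lambda>_::'n. lborel :: real measure)) borel (\<lambda>x. \<chi> j. x j)) (box l u) = (\<Prod>b\<in>Basis. (u - l) \<bullet> b)" .
  qed auto
  have Bm: "{\<theta> :: real ^ 'n. \<forall>j. \<theta> $ j \<in> B j} \<in> sets borel"
  proof -
    have "(\<lambda>\<theta> :: real ^ 'n. \<theta> $ j) \<in> borel_measurable borel" for j
      by (intro borel_measurable_continuous_onI continuous_intros)
    then have "{\<theta> :: real ^ 'n. \<theta> $ j \<in> B j} \<in> sets borel" for j
      using measurable_sets[of "\<lambda>\<theta> :: real ^ 'n. \<theta> $ j" borel borel "B j"] B by (simp add: vimage_def)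
    then have "(\<Inter>j. {\<theta> :: real ^ 'n. \<theta> $ j \<in> B j}) \<in> sets borel" by (intro sets.countable_INT') auto
    moreover have "(\<Inter>j. {\<theta> :: real ^ 'n. \<theta> $ j \<in> B j}) = {\<theta>. \<forall>j. \<theta> $ j \<in> B j}" by auto
    ultimately show ?thesis by simp
  qed
  have "(\<lambda>x. \<chi> j. x j) -` {\<theta> :: real ^ 'n. \<forall>j. \<theta> $ j \<in> B j} \<inter> space (PiM UNIV (\<lambda>_::'n. lborel :: real measure)) = PiE UNIV B"
    by (auto simp: space_PiM PiE_def Pi_def)
  then show ?thesis
    by (subst eq, subst emeasure_distr[OF m Bm]) (use B in \<open>auto simp: P.emeasure_PiM\<close>)
qed

text \<open>
  Both sides give a product set \<open>\<Prod>\<^sub>j A\<^sub>j\<close> the mass \<open>\<Prod>\<^sub>j |[0, 2\<pi>] \<inter> A\<^sub>j| / (2\<pi>)\<close>. This brings the Fubini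
  theorems for finite product measures to the torus.
\<close>
lemma PiM_angle:
  "distr (uniform_measure lborel (cbox 0 (\<chi> j. 2 * pi)) :: (real ^ 'n) measure) (PiM UNIV (\<lambda>_::'n::finite. angle)) (\<lambda>\<theta> j. \<theta> $ j)
     = PiM UNIV (\<lambda>_::'n. angle)" (is "distr ?Q ?P ?f = _")
proof (rule product_sigma_finite.PiM_eqI)
  show "product_sigma_finite (\<lambda>_::'n. angle)" by unfold_locales
  have nth: "(\<lambda>\<theta> :: real ^ 'n. \<theta> $ j) \<in> borel_measurable borel" for j
    by (intro borel_measurable_continuous_onI continuous_intros)
  have m: "?f \<in> ?Q \<rightarrow>\<^sub>M ?P"
    by (rule measurable_PiM_single') (use nth in \<open>auto simp: space_uniform_measure cong: measurable_cong_sets\<close>)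
  fix A :: "'n \<Rightarrow> real set" assume "\<And>i. i \<in> UNIV \<Longrightarrow> A i \<in> sets angle"
  then have A: "A i \<in> sets borel" for i by (simp add: sets_angle)
  have "emeasure (distr ?Q ?P ?f) (PiE UNIV A) = emeasure ?Q {\<theta>. \<forall>j. \<theta> $ j \<in> A j}"
  proof (subst emeasure_distr[OF m])
    show "PiE UNIV A \<in> sets ?P" using A by (intro sets_PiM_I_finite) (auto simp: sets_angle)
    have "?f -` PiE UNIV A \<inter> space ?Q = {\<theta>. \<forall>j. \<theta> $ j \<in> A j}" by auto
    then show "emeasure ?Q (?f -` PiE UNIV A \<inter> space ?Q) = emeasure ?Q {\<theta>. \<forall>j. \<theta> $ j \<in> A j}" by simp
  qed
  also have "\<dots> = emeasure lborel (cbox 0 (\<chi> j. 2 * pi) \<inter> {\<theta>::real^'n. \<forall>j. \<theta> $ j \<in> A j}) / emeasure lborel (cbox 0 (\<chi> j. 2 * pi) :: (real ^ 'n) set)"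
  proof (rule emeasure_uniform_measure)
    have "?f -` PiE UNIV A \<inter> space ?Q \<in> sets ?Q"
      using A by (intro measurable_sets[OF m] sets_PiM_I_finite) (auto simp: sets_angle)
    moreover have "?f -` PiE UNIV A \<inter> space ?Q = {\<theta>. \<forall>j. \<theta> $ j \<in> A j}" by auto
    ultimately show "{\<theta>::real^'n. \<forall>j. \<theta> $ j \<in> A j} \<in> sets lborel" by simp
  qed auto
  also have "cbox 0 (\<chi> j. 2 * pi) \<inter> {\<theta>::real^'n. \<forall>j. \<theta> $ j \<in> A j} = {\<theta>. \<forall>j. \<theta> $ j \<in> {0..2 * pi} \<inter> A j}"
    by (auto simp: mem_box_cart)
  also have "emeasure lborel {\<theta>::real^'n. \<forall>j. \<theta> $ j \<in> {0..2 * pi} \<inter> A j} = (\<Prod>j\<in>UNIV. emeasure lborel ({0..2 * pi} \<inter> A j))"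
    using A by (intro lborel_vec_box) auto
  also have "emeasure lborel (cbox 0 (\<chi> j. 2 * pi) :: (real ^ 'n) set) = (\<Prod>j\<in>(UNIV::'n set). ennreal (2 * pi))"
  proof -
    have eq: "(cbox 0 (\<chi> j. 2 * pi) :: (real ^ 'n) set) = {\<theta>. \<forall>j. \<theta> $ j \<in> {0..2 * pi}}"
      by (auto simp: mem_box_cart)
    have "emeasure lborel (cbox 0 (\<chi> j. 2 * pi) :: (real ^ 'n) set) = (\<Prod>j\<in>(UNIV::'n set). emeasure lborel {0..2 * pi})"
      unfolding eq by (rule lborel_vec_box) simp
    then show ?thesis by simp
  qed
  also have "(\<Prod>j\<in>UNIV. emeasure lborel ({0..2 * pi} \<inter> A j)) / (\<Prod>j\<in>(UNIV::'n set). ennreal (2 * pi)) = (\<Prod>j\<in>UNIV. emeasure angle (A j))"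
  proof -
    have "(\<Prod>j\<in>I. emeasure lborel ({0..2 * pi} \<inter> A j)) / (\<Prod>j\<in>I. ennreal (2 * pi)) = (\<Prod>j\<in>I. emeasure angle (A j))"
      if "finite I" for I :: "'n set"
      using that
    proof induction
      case (insert i I)
      have top: "(\<Prod>j\<in>I. ennreal (2 * pi)) \<noteq> 0" "(\<Prod>j\<in>I. ennreal (2 * pi)) \<noteq> top"
        by (simp_all add: prod_ennreal ennreal_eq_0_iff not_le prod_pos del: prod_constant)
      have div: "a * b / (c * d) = (a / c) * (b / d)" if "c \<noteq> 0" "c \<noteq> top" "d \<noteq> 0" "d \<noteq> top" for a b c d :: ennreal
      proof -
        have "inverse (c * d) = inverse c * inverse d" using that by (intro ennreal_inverse_mult) (auto simp: less_top)
        then show ?thesis by (simp add: divide_ennreal_def mult_ac)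
      qed
      have "(\<Prod>j\<in>insert i I. emeasure lborel ({0..2 * pi} \<inter> A j)) / (\<Prod>j\<in>insert i I. ennreal (2 * pi))
        = (emeasure lborel ({0..2 * pi} \<inter> A i) * (\<Prod>j\<in>I. emeasure lborel ({0..2 * pi} \<inter> A j)))
           / (ennreal (2 * pi) * (\<Prod>j\<in>I. ennreal (2 * pi)))"
        by (simp only: prod.insert[OF insert.hyps])
      also have "\<dots> = (emeasure lborel ({0..2 * pi} \<inter> A i) / ennreal (2 * pi)) *
           ((\<Prod>j\<in>I. emeasure lborel ({0..2 * pi} \<inter> A j)) / (\<Prod>j\<in>I. ennreal (2 * pi)))"
        by (rule div) (use top in simp_all)
      also have "\<dots> = (\<Prod>j\<in>insert i I. emeasure angle (A j))"
        by (simp only: insert.IH prod.insert[OF insert.hyps] emeasure_angle[OF A])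
      finally show ?case .
    qed simp
    then show ?thesis by simp
  qed
  finally show "emeasure (distr ?Q ?P ?f) (PiE UNIV A) = (\<Prod>j\<in>UNIV. emeasure angle (A j))" .
qed auto

definition etorus :: "('n \<Rightarrow> real) \<Rightarrow> complex ^ 'n" where
  "etorus x = (\<chi> j. cis (x j))"

lemma torus_measure_eq:
  "(torus_measure :: (complex ^ 'n) measure) = distr (PiM UNIV (\<lambda>_::'n::finite. angle)) (restrict_space borel torus) etorus"
  and etorus_measurable: "etorus \<in> PiM UNIV (\<lambda>_::'n::finite. angle) \<rightarrow>\<^sub>M restrict_space borel torus"
proof -
  have sP: "sets (PiM UNIV (\<lambda>_::'n. angle)) = sets (PiM UNIV (\<lambda>_::'n. borel))"
    by (intro sets_PiM_cong) (auto simp: sets_angle)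
  have "(\<lambda>\<theta>. \<chi> j. cis (\<theta> $ j)) \<circ> (\<lambda>x. \<chi> j. x j) \<in> PiM UNIV (\<lambda>_::'n. borel) \<rightarrow>\<^sub>M restrict_space borel torus"
    by (rule measurable_comp[OF vec_lambda_measurable]) (use torus_param_measurable measurable_lborel1 in auto)
  moreover have "(\<lambda>\<theta>. \<chi> j. cis (\<theta> $ j)) \<circ> (\<lambda>x. \<chi> j. x j) = (etorus :: ('n \<Rightarrow> real) \<Rightarrow> _)"
    by (auto simp: etorus_def)
  ultimately show m: "etorus \<in> PiM UNIV (\<lambda>_::'n. angle) \<rightarrow>\<^sub>M restrict_space borel torus"
    using measurable_cong_sets[OF sP refl] by auto
  have nth: "(\<lambda>\<theta> :: real ^ 'n. \<theta> $ j) \<in> borel_measurable borel" for j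
    by (intro borel_measurable_continuous_onI continuous_intros)
  have f: "(\<lambda>\<theta> j. \<theta> $ j) \<in> (uniform_measure lborel (cbox 0 (\<chi> j. 2 * pi)) :: (real ^ 'n) measure) \<rightarrow>\<^sub>M PiM UNIV (\<lambda>_::'n. angle)"
    by (rule measurable_PiM_single') (use nth in \<open>auto simp: space_uniform_measure cong: measurable_cong_sets\<close>)
  show "(torus_measure :: (complex ^ 'n) measure) = distr (PiM UNIV (\<lambda>_::'n. angle)) (restrict_space borel torus) etorus"
    unfolding torus_measure_def
    by (subst PiM_angle[symmetric], subst distr_distr[OF m f]) (simp add: comp_def etorus_def)
qed

lemma space_torus_measure [simp]: "space torus_measure = torus"
  by (simp add: torus_measure_def space_restrict_space)

lemma sets_torus_measure [measurable_cong]: "sets torus_measure = sets (restrict_space borel torus)"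
  by (simp add: torus_measure_def)

interpretation torus: prob_space "torus_measure :: (complex ^ 'n) measure"
  by (rule prob_spaceI) (rule emeasure_torus_measure_space)

lemma etorus_torus [simp]: "etorus x \<in> torus"
  by (simp add: etorus_def torus_def)

lemma etorus_nth [simp]: "etorus x $ j = cis (x j)"
  by (simp add: etorus_def)

lemma compact_torus: "compact (torus :: (complex ^ 'n) set)"
proof -
  have "bounded (torus :: (complex ^ 'n) set)"
  proof (rule boundedI)
    fix \<zeta> :: "complex ^ 'n" assume "\<zeta> \<in> torus"
    then show "norm \<zeta> \<le> (\<Sum>j\<in>(UNIV::'n set). 1)"
      using L2_set_le_sum[of UNIV "\<lambda>j. norm (\<zeta> $ j)"] by (simp add: norm_vec_def torus_def)
  qed
  moreover have "torus = (\<Inter>j. {\<zeta> :: complex ^ 'n. norm (\<zeta> $ j) = 1})" by (auto simp: torus_def)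
  moreover have "closed (\<Inter>j. {\<zeta> :: complex ^ 'n. norm (\<zeta> $ j) = 1})"
    by (intro closed_INT ballI closed_Collect_eq continuous_intros)
  ultimately show ?thesis by (simp only: compact_eq_bounded_closed)
qed

lemma torus_continuous_measurable:
  fixes G :: "complex ^ 'n \<Rightarrow> 'b::{real_normed_vector, second_countable_topology}"
  shows "continuous_on torus G \<Longrightarrow> G \<in> borel_measurable torus_measure"
  using borel_measurable_continuous_on_restrict measurable_cong_sets[OF sets_torus_measure refl] by blast

lemma torus_continuous_bounded:
  fixes G :: "complex ^ 'n \<Rightarrow> 'b::real_normed_vector"
  assumes "continuous_on torus G"
  obtains B where "B \<ge> 0" "\<And>\<zeta>. \<zeta> \<in> torus \<Longrightarrow> norm (G \<zeta>) \<le> B"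
proof -
  have "bounded (G ` torus)" by (intro compact_imp_bounded compact_continuous_image assms compact_torus)
  then obtain B where "\<forall>y\<in>G ` torus. norm y \<le> B" by (auto simp: bounded_iff)
  then show ?thesis by (intro that[of "max 0 B"]) (auto simp: le_max_iff_disj)
qed

lemma torus_continuous_integrable_mult:
  fixes G f :: "complex ^ 'n \<Rightarrow> complex"
  assumes "continuous_on torus G" "integrable torus_measure f"
  shows "integrable torus_measure (\<lambda>\<zeta>. f \<zeta> * G \<zeta>)"
proof -
  obtain B where B: "\<And>\<zeta>. \<zeta> \<in> torus \<Longrightarrow> norm (G \<zeta>) \<le> B" using torus_continuous_bounded[OF assms(1)] by blast
  have [measurable]: "G \<in> borel_measurable torus_measure" by (rule torus_continuous_measurable[OF assms(1)])
  show ?thesis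
  proof (rule Bochner_Integration.integrable_bound[where f = "\<lambda>\<zeta>. B * norm (f \<zeta>)"])
    show "integrable torus_measure (\<lambda>\<zeta>. B * norm (f \<zeta>))" using assms(2) by simp
    show "(\<lambda>\<zeta>. f \<zeta> * G \<zeta>) \<in> borel_measurable torus_measure"
      using assms(2) by (intro borel_measurable_times) auto
    show "AE \<zeta> in torus_measure. norm (f \<zeta> * G \<zeta>) \<le> norm (B * norm (f \<zeta>))"
    proof (rule AE_I2)
      fix \<zeta> :: "complex ^ 'n" assume "\<zeta> \<in> space torus_measure"
      then have "norm (f \<zeta>) * norm (G \<zeta>) \<le> norm (f \<zeta>) * B" using B by (intro mult_left_mono) auto
      also have "\<dots> \<le> norm (B * norm (f \<zeta>))" by (simp add: mult.commute)
      finally show "norm (f \<zeta> * G \<zeta>) \<le> norm (B * norm (f \<zeta>))" by (simp add: norm_mult)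
    qed
  qed
qed

lemma torus_continuous_integrable:
  fixes G :: "complex ^ 'n \<Rightarrow> complex"
  shows "continuous_on torus G \<Longrightarrow> integrable torus_measure G"
  using torus_continuous_integrable_mult[of G "\<lambda>_. 1"] by simp

lemma torus_integral:
  fixes G :: "complex ^ 'n \<Rightarrow> complex"
  assumes "G \<in> borel_measurable torus_measure"
  shows "integral\<^sup>L torus_measure G = (LINT x|PiM UNIV (\<lambda>_. angle). G (etorus x))"
    and "integrable torus_measure G \<longleftrightarrow> integrable (PiM UNIV (\<lambda>_. angle)) (\<lambda>x. G (etorus x))"
proof -
  have "G \<in> borel_measurable (restrict_space borel torus)" using assms measurable_cong_sets[OF sets_torus_measure refl] by blast
  then show "integral\<^sup>L torus_measure G = (LINT x|PiM UNIV (\<lambda>_. angle). G (etorus x))"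
    "integrable torus_measure G \<longleftrightarrow> integrable (PiM UNIV (\<lambda>_. angle)) (\<lambda>x. G (etorus x))"
    unfolding torus_measure_eq by (rule integral_distr[OF etorus_measurable] integrable_distr_eq[OF etorus_measurable])+
qed

text \<open>
  Integration over one angle first. Only this coordinate changes when a radius \<open>\<rho>\<^sub>j\<close> is varied.
\<close>
lemma torus_integral_coordinate:
  fixes G :: "complex ^ 'n \<Rightarrow> complex"
  assumes G: "continuous_on torus G"
  shows "integral\<^sup>L torus_measure G =
    (LINT x|PiM (UNIV - {j}) (\<lambda>_. angle). LINT t|angle. G (etorus (x(j := t))))"
proof -
  have j: "insert j (UNIV - {j}) = UNIV" by auto
  have "integrable (PiM (insert j (UNIV - {j})) (\<lambda>_. angle)) (\<lambda>x. G (etorus x))"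
    unfolding j using torus_continuous_integrable[OF G] torus_integral(2)[OF torus_continuous_measurable[OF G]] by simp
  then show ?thesis
    using angle_prod.product_integral_insert[of "UNIV - {j}" j "\<lambda>x. G (etorus x)"]
    unfolding torus_integral(1)[OF torus_continuous_measurable[OF G]] j by simp
qed

lemma torus_integral_prod:
  fixes g :: "'n::finite \<Rightarrow> complex \<Rightarrow> complex"
  assumes g: "\<And>j. continuous_on (sphere 0 1) (g j)"
  shows "(LINT \<zeta>|torus_measure. (\<Prod>j\<in>UNIV. g j (\<zeta> $ j))) = (\<Prod>j\<in>UNIV. LINT t|angle. g j (cis t))"
    and "continuous_on torus (\<lambda>\<zeta>. \<Prod>j\<in>UNIV. g j (\<zeta> $ j))"
proof -
  show c: "continuous_on torus (\<lambda>\<zeta>. \<Prod>j\<in>UNIV. g j (\<zeta> $ j))"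
    by (intro continuous_on_prod continuous_on_compose2[OF g] continuous_intros) (auto simp: torus_def)
  have "continuous_on UNIV (\<lambda>t. g j (cis t))" for j
    by (intro continuous_on_compose2[OF g] continuous_intros) auto
  then show "(LINT \<zeta>|torus_measure. (\<Prod>j\<in>UNIV. g j (\<zeta> $ j))) = (\<Prod>j\<in>UNIV. LINT t|angle. g j (cis t))"
    unfolding torus_integral(1)[OF torus_continuous_measurable[OF c]] etorus_nth
    by (intro angle_prod.product_integral_prod integral_angle(1)) auto
qed

section \<open>Uniqueness of Fourier coefficients on the torus\<close>

definition chr :: "('n::finite \<Rightarrow> int) \<Rightarrow> complex ^ 'n \<Rightarrow> complex" where
  "chr m \<zeta> = (\<Prod>j\<in>UNIV. (\<zeta> $ j) powi m j)"

lemma torus_nonzero: "\<zeta> \<in> torus \<Longrightarrow> \<zeta> $ j \<noteq> 0"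
  by (auto simp: torus_def dest: spec[of _ j])

lemma norm_chr: "\<zeta> \<in> torus \<Longrightarrow> norm (chr m \<zeta>) = 1"
  by (simp add: chr_def prod_norm[symmetric] norm_power_int torus_def)

lemma continuous_on_chr: "continuous_on torus (chr m)"
  unfolding chr_def
  by (intro continuous_intros) (auto simp: torus_nonzero)

lemma chr_add: "\<zeta> \<in> torus \<Longrightarrow> chr (\<lambda>j. m j + l j) \<zeta> = chr m \<zeta> * chr l \<zeta>"
  by (simp add: chr_def power_int_add torus_nonzero prod.distrib)

text \<open>
  Trigonometric polynomials. Membership depends on the values on the torus alone: conjugates of coordinates are
  inverses there, and only there.
\<close>
inductive_set trig :: "(complex ^ 'n \<Rightarrow> complex) set" where
  trig_chr: "chr m \<in> trig"
| trig_add: "f \<in> trig \<Longrightarrow> g \<in> trig \<Longrightarrow> (\<lambda>\<zeta>. f \<zeta> + g \<zeta>) \<in> trig"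
| trig_cmult: "f \<in> trig \<Longrightarrow> (\<lambda>\<zeta>. c * f \<zeta>) \<in> trig"
| trig_cong: "f \<in> trig \<Longrightarrow> (\<And>\<zeta>. \<zeta> \<in> torus \<Longrightarrow> f \<zeta> = g \<zeta>) \<Longrightarrow> g \<in> trig"

lemma trig_const: "(\<lambda>_. c) \<in> trig"
  by (rule trig_cong[OF trig_cmult[OF trig_chr[of "\<lambda>_. 0"], of c]]) (simp add: chr_def)

lemma trig_mult:
  assumes "f \<in> trig" "g \<in> trig"
  shows "(\<lambda>\<zeta>. f \<zeta> * g \<zeta>) \<in> trig"
  using assms(1)
proof induction
  case (trig_chr m)
  show ?case using assms(2)
  proof induction
    case (trig_chr l)
    show ?case by (rule trig_cong[OF trig.trig_chr[of "\<lambda>j. m j + l j"]]) (rule chr_add)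
  next
    case (trig_add f g)
    show ?case by (rule trig_cong[OF trig.trig_add[OF trig_add.IH]]) (simp add: algebra_simps)
  next
    case (trig_cmult f c)
    show ?case by (rule trig_cong[OF trig.trig_cmult[OF trig_cmult.IH, of c]]) (simp add: algebra_simps)
  next
    case (trig_cong f g)
    show ?case by (rule trig.trig_cong[OF trig_cong.IH]) (simp add: trig_cong)
  qed
next
  case (trig_add f g)
  show ?case by (rule trig_cong[OF trig.trig_add[OF trig_add.IH]]) (simp add: algebra_simps)
next
  case (trig_cmult f c)
  show ?case by (rule trig_cong[OF trig.trig_cmult[OF trig_cmult.IH, of c]]) (simp add: algebra_simps)
next
  case (trig_cong f g)
  show ?case by (rule trig.trig_cong[OF trig_cong.IH]) (simp add: trig_cong)
qed

lemma trig_sum: "finite I \<Longrightarrow> (\<And>i. i \<in> I \<Longrightarrow> f i \<in> trig) \<Longrightarrow> (\<lambda>\<zeta>. \<Sum>i\<in>I. f i \<zeta>) \<in> trig"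
  by (induction I rule: finite_induct) (auto intro: trig_const trig_add)

lemma trig_coordinate:
  fixes j :: "'n::finite"
  shows "(\<lambda>\<zeta>. \<zeta> $ j) \<in> trig" "(\<lambda>\<zeta>. cnj (\<zeta> $ j)) \<in> trig"
proof -
  have *: "chr (\<lambda>i. if i = j then k else 0) \<zeta> = \<zeta> $ j powi k" for k and \<zeta> :: "complex ^ 'n"
  proof -
    have "chr (\<lambda>i. if i = j then k else 0) \<zeta> = (\<Prod>i\<in>UNIV. if i = j then \<zeta> $ j powi k else 1)"
      unfolding chr_def by (intro prod.cong) auto
    then show ?thesis by simp
  qed
  show "(\<lambda>\<zeta>. \<zeta> $ j) \<in> trig" by (rule trig_cong[OF trig_chr[of "\<lambda>i. if i = j then 1 else 0"]]) (simp add: *)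
  show "(\<lambda>\<zeta>. cnj (\<zeta> $ j)) \<in> trig"
  proof (rule trig_cong[OF trig_chr[of "\<lambda>i. if i = j then -1 else 0"]])
    fix \<zeta> :: "complex ^ 'n" assume "\<zeta> \<in> torus"
    then have "norm (\<zeta> $ j) = 1" by (simp add: torus_def)
    then have "cnj (\<zeta> $ j) = inverse (\<zeta> $ j)"
      using complex_norm_square[of "\<zeta> $ j"] by (intro inverse_unique[symmetric]) simp
    then show "chr (\<lambda>i. if i = j then -1 else 0) \<zeta> = cnj (\<zeta> $ j)" by (simp add: * power_int_minus)
  qed
qed

lemma trig_linear:
  fixes f :: "complex ^ 'n \<Rightarrow> real"
  assumes "bounded_linear f"
  shows "(\<lambda>\<zeta>. of_real (f \<zeta>)) \<in> trig"
proof -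
  interpret bounded_linear f by fact
  have eq: "f \<zeta> = (\<Sum>j\<in>UNIV. Re (\<zeta> $ j) * f (axis j 1) + Im (\<zeta> $ j) * f (axis j \<i>))" for \<zeta>
  proof -
    have "\<zeta> = (\<Sum>j\<in>UNIV. Re (\<zeta> $ j) *\<^sub>R axis j 1 + Im (\<zeta> $ j) *\<^sub>R axis j \<i>)"
    proof (rule vec_eq_iff[THEN iffD2], rule allI)
      fix i
      have "(\<Sum>j\<in>UNIV. Re (\<zeta> $ j) *\<^sub>R axis j 1 + Im (\<zeta> $ j) *\<^sub>R axis j \<i>) $ i
        = (\<Sum>j\<in>UNIV. if j = i then Re (\<zeta> $ i) *\<^sub>R 1 + Im (\<zeta> $ i) *\<^sub>R \<i> else 0)"
        unfolding sum_component by (intro sum.cong) (auto simp: axis_def)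
      then show "\<zeta> $ i = (\<Sum>j\<in>UNIV. Re (\<zeta> $ j) *\<^sub>R axis j 1 + Im (\<zeta> $ j) *\<^sub>R axis j \<i>) $ i"
        by (simp add: complex_eq_iff)
    qed
    then have "f \<zeta> = f (\<Sum>j\<in>UNIV. Re (\<zeta> $ j) *\<^sub>R axis j 1 + Im (\<zeta> $ j) *\<^sub>R axis j \<i>)"
      by (rule arg_cong[where f = f])
    also have "\<dots> = (\<Sum>j\<in>UNIV. Re (\<zeta> $ j) * f (axis j 1) + Im (\<zeta> $ j) * f (axis j \<i>))"
      by (simp add: sum add scaleR)
    finally show ?thesis .
  qed
  have re: "(\<lambda>\<zeta>. of_real (Re (\<zeta> $ j))) \<in> trig" for j :: 'n
    by (rule trig_cong[OF trig_cmult[OF trig_add[OF trig_coordinate[of j]], of "1/2"]])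
       (simp add: complex_eq_iff)
  have im: "(\<lambda>\<zeta>. of_real (Im (\<zeta> $ j))) \<in> trig" for j :: 'n
    by (rule trig_cong[OF trig_cmult[OF trig_add[OF trig_coordinate(1)[of j] trig_cmult[OF trig_coordinate(2)[of j], of "-1"]], of "-\<i>/2"]])
       (simp add: complex_eq_iff)
  have T: "(\<lambda>\<zeta>. \<Sum>j\<in>UNIV. of_real (f (axis j 1)) * of_real (Re (\<zeta> $ j)) + of_real (f (axis j \<i>)) * of_real (Im (\<zeta> $ j))) \<in> trig"
    by (intro trig_sum trig_add trig_cmult re im) auto
  have eqf: "(\<lambda>\<zeta>. complex_of_real (f \<zeta>)) = (\<lambda>\<zeta>. \<Sum>j\<in>UNIV. of_real (f (axis j 1)) * of_real (Re (\<zeta> $ j)) + of_real (f (axis j \<i>)) * of_real (Im (\<zeta> $ j)))"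
    by (rule ext, subst eq) (simp add: mult.commute)
  show ?thesis by (subst eqf) (rule T)
qed

lemma trig_real_polynomial:
  fixes f :: "complex ^ 'n \<Rightarrow> real"
  assumes "real_polynomial_function f"
  shows "(\<lambda>\<zeta>. of_real (f \<zeta>)) \<in> trig"
  using assms
proof induction
  case (linear f) then show ?case by (rule trig_linear)
next
  case (const c) show ?case by (rule trig_const)
next
  case (add f g)
  from trig_add[OF add.IH] show ?case by simp
next
  case (mult f g)
  from trig_mult[OF mult.IH] show ?case by simp
qed

lemma trig_annihilated:
  assumes f: "integrable torus_measure f" and z: "\<And>m. (LINT \<zeta>|torus_measure. f \<zeta> * chr m \<zeta>) = 0"
    and g: "g \<in> trig"
  shows "continuous_on torus g \<and> (LINT \<zeta>|torus_measure. f \<zeta> * g \<zeta>) = 0"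
  using g
proof induction
  case (trig_chr m)
  then show ?case using z continuous_on_chr by auto
next
  case (trig_add g h)
  then have "integrable torus_measure (\<lambda>\<zeta>. f \<zeta> * g \<zeta>)" "integrable torus_measure (\<lambda>\<zeta>. f \<zeta> * h \<zeta>)"
    by (auto intro: torus_continuous_integrable_mult[OF _ f])
  with trig_add show ?case by (auto intro!: continuous_intros simp: distrib_left)
next
  case (trig_cmult g c)
  then show ?case by (auto intro!: continuous_intros simp: mult.left_commute)
next
  case (trig_cong g h)
  then have "(LINT \<zeta>|torus_measure. f \<zeta> * g \<zeta>) = (LINT \<zeta>|torus_measure. f \<zeta> * h \<zeta>)"
    by (intro Bochner_Integration.integral_cong) auto
  then show ?case using trig_cong continuous_on_cong[OF refl, of torus g h] by auto
qed

text \<open>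
  On the torus every polynomial in the real and imaginary parts of the coordinates is a trigonometric polynomial,
  so the Stone-Weierstrass theorem makes these uniformly dense.
\<close>
lemma continuous_annihilated:
  fixes G :: "complex ^ 'n \<Rightarrow> real"
  assumes f: "integrable torus_measure f" and z: "\<And>m. (LINT \<zeta>|torus_measure. f \<zeta> * chr m \<zeta>) = 0"
    and G: "continuous_on torus G"
  shows "(LINT \<zeta>|torus_measure. f \<zeta> * of_real (G \<zeta>)) = 0"
proof -
  define I where "I = (LINT \<zeta>|torus_measure. norm (f \<zeta>))"
  have cG: "continuous_on torus (\<lambda>\<zeta>. complex_of_real (G \<zeta>))" by (intro continuous_intros G)
  have "norm (LINT \<zeta>|torus_measure. f \<zeta> * of_real (G \<zeta>)) \<le> e * I" if e: "e > 0" for e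
  proof -
    obtain p where p: "real_polynomial_function p" "\<And>\<zeta>. \<zeta> \<in> torus \<Longrightarrow> \<bar>G \<zeta> - p \<zeta>\<bar> < e"
      using Stone_Weierstrass_real_polynomial_function[OF compact_torus G e] by blast
    note t = trig_annihilated[OF f z trig_real_polynomial[OF p(1)]]
    have "(LINT \<zeta>|torus_measure. f \<zeta> * of_real (G \<zeta>))
      = (LINT \<zeta>|torus_measure. f \<zeta> * of_real (G \<zeta>)) - (LINT \<zeta>|torus_measure. f \<zeta> * of_real (p \<zeta>))"
      using t by simp
    also have "\<dots> = (LINT \<zeta>|torus_measure. f \<zeta> * of_real (G \<zeta>) - f \<zeta> * of_real (p \<zeta>))"
      using torus_continuous_integrable_mult[OF cG f] torus_continuous_integrable_mult[OF conjunct1[OF t] f] by simp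
    finally have eq: "(LINT \<zeta>|torus_measure. f \<zeta> * of_real (G \<zeta>)) = \<dots>" .
    have "norm (LINT \<zeta>|torus_measure. f \<zeta> * of_real (G \<zeta>)) \<le> (LINT \<zeta>|torus_measure. e * norm (f \<zeta>))"
      unfolding eq
    proof (rule Bochner_Integration.integral_norm_bound_integral)
      show "integrable torus_measure (\<lambda>\<zeta>. f \<zeta> * of_real (G \<zeta>) - f \<zeta> * of_real (p \<zeta>))"
        using torus_continuous_integrable_mult[OF cG f] torus_continuous_integrable_mult[OF conjunct1[OF t] f] by simp
      show "integrable torus_measure (\<lambda>\<zeta>. e * norm (f \<zeta>))" using f by simp
      fix \<zeta> :: "complex ^ 'n" assume "\<zeta> \<in> space torus_measure"
      then have "\<bar>G \<zeta> - p \<zeta>\<bar> \<le> e" using p(2)[of \<zeta>] by simp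
      then have "norm (f \<zeta>) * \<bar>G \<zeta> - p \<zeta>\<bar> \<le> norm (f \<zeta>) * e" by (intro mult_left_mono) auto
      moreover have "f \<zeta> * of_real (G \<zeta>) - f \<zeta> * of_real (p \<zeta>) = f \<zeta> * of_real (G \<zeta> - p \<zeta>)" by (simp add: algebra_simps)
      ultimately show "norm (f \<zeta> * of_real (G \<zeta>) - f \<zeta> * of_real (p \<zeta>)) \<le> e * norm (f \<zeta>)"
        by (simp only: norm_mult norm_of_real) (simp add: mult.commute)
    qed
    also have "\<dots> = e * I" by (simp add: I_def)
    finally show ?thesis .
  qed
  then have *: "norm (LINT \<zeta>|torus_measure. f \<zeta> * of_real (G \<zeta>)) \<le> e * I" if "e > 0" for e using that by blast
  have "((\<lambda>e. e * I) \<longlongrightarrow> 0 * I) (at_right 0)" by (intro tendsto_intros)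
  then have "norm (LINT \<zeta>|torus_measure. f \<zeta> * of_real (G \<zeta>)) \<le> 0 * I"
    by (rule tendsto_lowerbound) (use * in \<open>auto simp: eventually_at_filter\<close>)
  then show ?thesis by simp
qed

text \<open>
  Indicators of closed sets are bounded limits of continuous functions, so \<open>f\<close> integrates to zero over closed
  sets, hence over all Borel sets.
\<close>
theorem torus_fourier_unique:
  fixes f :: "complex ^ 'n \<Rightarrow> complex"
  assumes f: "integrable torus_measure f" and z: "\<And>m. (LINT \<zeta>|torus_measure. f \<zeta> * chr m \<zeta>) = 0"
  shows "AE \<zeta> in torus_measure. f \<zeta> = 0"
proof (rule torus.density_zero[OF f])
  have sint: "set_integrable torus_measure A f" if "A \<in> sets torus_measure" for A
    unfolding set_integrable_def using f that by (rule integrable_mult_indicator[rotated])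
  have bsets: "B \<inter> torus \<in> sets torus_measure" if "B \<in> sets borel" for B :: "(complex ^ 'n) set"
    using that by (auto simp: sets_torus_measure sets_restrict_space)
  have closed: "(LINT \<zeta>:(C \<inter> torus)|torus_measure. f \<zeta>) = 0" if C: "closed C" for C
  proof (cases "C = {}")
    case False
    \<comment> \<open>Continuous functions decreasing to the indicator of \<open>C\<close>.\<close>
    define G where "G n \<zeta> = max 0 (1 - real n * infdist \<zeta> C)" for n \<zeta>
    have cG: "continuous_on torus (G n)" for n unfolding G_def by (intro continuous_intros)
    have "(\<lambda>n. LINT \<zeta>|torus_measure. f \<zeta> * of_real (G n \<zeta>)) \<longlonglongrightarrow> (LINT \<zeta>|torus_measure. indicator (C \<inter> torus) \<zeta> *\<^sub>R f \<zeta>)"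
    proof (rule integral_dominated_convergence[where w = "\<lambda>\<zeta>. norm (f \<zeta>)"])
      show "(\<lambda>\<zeta>. indicat_real (C \<inter> torus) \<zeta> *\<^sub>R f \<zeta>) \<in> borel_measurable torus_measure"
        using sint[OF bsets[of C]] C by (auto simp: set_integrable_def borel_closed)
      show "(\<lambda>\<zeta>. f \<zeta> * of_real (G n \<zeta>)) \<in> borel_measurable torus_measure" for n
        using torus_continuous_integrable_mult[OF _ f, of "\<lambda>\<zeta>. of_real (G n \<zeta>)"] cG[of n] by (auto intro!: borel_measurable_integrable continuous_intros)
      show "AE \<zeta> in torus_measure. norm (f \<zeta> * of_real (G n \<zeta>)) \<le> norm (f \<zeta>)" for n
        by (rule AE_I2) (auto simp: G_def norm_mult max_def infdist_nonneg intro!: mult_left_le)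
      show "AE \<zeta> in torus_measure. (\<lambda>n. f \<zeta> * of_real (G n \<zeta>)) \<longlonglongrightarrow> indicator (C \<inter> torus) \<zeta> *\<^sub>R f \<zeta>"
      proof (rule AE_I2)
        fix \<zeta> :: "complex ^ 'n" assume "\<zeta> \<in> space torus_measure"
        then have t: "\<zeta> \<in> torus" by simp
        show "(\<lambda>n. f \<zeta> * of_real (G n \<zeta>)) \<longlonglongrightarrow> indicator (C \<inter> torus) \<zeta> *\<^sub>R f \<zeta>"
        proof (cases "\<zeta> \<in> C")
          case True
          then have "G n \<zeta> = 1" for n by (simp add: G_def)
          then show ?thesis using True t by simp
        next
          case nC: False
          then have d: "infdist \<zeta> C > 0" using C False by (metis in_closed_iff_infdist_zero infdist_nonneg less_eq_real_def)
          obtain N where N: "1 < real N * infdist \<zeta> C" using reals_Archimedean3[OF d] by blast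
          have "G n \<zeta> = 0" if "n \<ge> N" for n
          proof -
            have "real N * infdist \<zeta> C \<le> real n * infdist \<zeta> C" using that d by (intro mult_right_mono) auto
            then show ?thesis using N by (simp add: G_def)
          qed
          then have "eventually (\<lambda>n. f \<zeta> * of_real (G n \<zeta>) = 0) sequentially"
            by (intro eventually_sequentiallyI[of N]) simp
          then show ?thesis using nC by (simp add: tendsto_eventually)
        qed
      qed
    qed (use f in auto)
    then show ?thesis
      using continuous_annihilated[OF f z cG] by (simp add: set_lebesgue_integral_def LIMSEQ_const_iff)
  qed (simp add: set_lebesgue_integral_def)
  have borel: "(LINT \<zeta>:(B \<inter> torus)|torus_measure. f \<zeta>) = 0" if "B \<in> sets borel" for B
  proof -
    have B: "B \<in> sigma_sets UNIV (Collect closed)" using that unfolding borel_eq_closed by simp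
    have bor: "A \<in> sets borel" if "A \<in> sigma_sets UNIV (Collect closed)" for A :: "(complex ^ 'n) set"
      using that unfolding borel_eq_closed by simp
    show ?thesis
    proof (rule sigma_sets_induct_disjoint[OF _ _ B, where P = "\<lambda>B. (LINT \<zeta>:(B \<inter> torus)|torus_measure. f \<zeta>) = 0"])
      show "Int_stable (Collect closed :: (complex ^ 'n) set set)" by (auto simp: Int_stable_def)
    next
      fix A :: "(complex ^ 'n) set" assume A: "A \<in> sigma_sets UNIV (Collect closed)" "(LINT \<zeta>:(A \<inter> torus)|torus_measure. f \<zeta>) = 0"
      have "torus = (A \<inter> torus) \<union> ((UNIV - A) \<inter> torus)" by auto
      then have "(LINT \<zeta>:torus|torus_measure. f \<zeta>) = (LINT \<zeta>:(A \<inter> torus) \<union> ((UNIV - A) \<inter> torus)|torus_measure. f \<zeta>)" by simp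
      also have "\<dots> = (LINT \<zeta>:(A \<inter> torus)|torus_measure. f \<zeta>) + (LINT \<zeta>:((UNIV - A) \<inter> torus)|torus_measure. f \<zeta>)"
        by (intro set_integral_Un sint bsets) (use bor[OF A(1)] in auto)
      finally show "(LINT \<zeta>:((UNIV - A) \<inter> torus)|torus_measure. f \<zeta>) = 0"
        using A(2) closed[of UNIV] by simp
    next
      fix A :: "nat \<Rightarrow> (complex ^ 'n) set"
      assume d: "disjoint_family A" and s: "range A \<subseteq> sigma_sets UNIV (Collect closed)"
        and A: "\<And>i. (LINT \<zeta>:(A i \<inter> torus)|torus_measure. f \<zeta>) = 0"
      have Ai: "A i \<in> sets borel" for i using s bor by auto
      have int: "(LINT \<zeta>:(\<Union>i. A i \<inter> torus)|torus_measure. f \<zeta>) = (\<Sum>i. LINT \<zeta>:(A i \<inter> torus)|torus_measure. f \<zeta>)"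
      proof (rule lebesgue_integral_countable_add)
        show "(A i \<inter> torus) \<inter> (A j \<inter> torus) = {}" if "i \<noteq> j" for i j using d that by (auto simp: disjoint_family_on_def)
        show "set_integrable torus_measure (\<Union>i. A i \<inter> torus) f"
          by (intro sint sets.countable_UN') (use bsets[OF Ai] in auto)
      qed (use bsets[OF Ai] in auto)
      have "\<Union> (range A) \<inter> torus = (\<Union>i. A i \<inter> torus)" by auto
      then have "(LINT \<zeta>:(\<Union> (range A) \<inter> torus)|torus_measure. f \<zeta>) = (\<Sum>i. LINT \<zeta>:(A i \<inter> torus)|torus_measure. f \<zeta>)"
        using int by (rule ssubst)
      also have "\<dots> = 0" unfolding A by simp
      finally show "(LINT \<zeta>:(\<Union> (range A) \<inter> torus)|torus_measure. f \<zeta>) = 0" .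
    qed (use closed in \<open>auto simp: set_lebesgue_integral_def\<close>)
  qed
  fix A :: "(complex ^ 'n) set" assume "A \<in> sets torus_measure"
  then obtain B where "B \<in> sets borel" "A = B \<inter> torus"
    by (auto simp: sets_torus_measure sets_restrict_space)
  then show "(LINT \<zeta>:A|torus_measure. f \<zeta>) = 0" using borel by simp
qed

lemma cis_Arg2pi: "norm z = 1 \<Longrightarrow> cis (Arg2pi z) = z"
  using Arg2pi[of z] by (simp add: cis_conv_exp mult.commute is_Arg_def)

text \<open>
  The torus measure charges every neighbourhood of every point: a small box of angles has positive product measure.
\<close>
lemma torus_continuous_AE_zero:
  fixes d :: "complex ^ 'n \<Rightarrow> complex"
  assumes d: "continuous_on torus d" and ae: "AE \<zeta> in torus_measure. d \<zeta> = 0" and \<zeta>: "\<zeta> \<in> torus"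
  shows "d \<zeta> = 0"
proof (rule ccontr)
  assume nz: "d \<zeta> \<noteq> 0"
  define n where "n = CARD('n)"
  define t where "t j = Arg2pi (\<zeta> $ j)" for j
  have t: "cis (t j) = \<zeta> $ j" "0 \<le> t j" "t j < 2 * pi" for j
    using \<zeta> Arg2pi_ge_0 Arg2pi_lt_2pi by (auto simp: t_def torus_def cis_Arg2pi)
  obtain \<delta> where \<delta>: "\<delta> > 0" "\<And>\<xi>. \<xi> \<in> torus \<Longrightarrow> dist \<xi> \<zeta> < \<delta> \<Longrightarrow> dist (d \<xi>) (d \<zeta>) < norm (d \<zeta>)"
    using d \<zeta> nz unfolding continuous_on_iff by (metis zero_less_norm_iff)
  have "\<exists>\<eta>>0. t j + \<eta> \<le> 2 * pi \<and> (\<forall>x. t j \<le> x \<longrightarrow> x \<le> t j + \<eta> \<longrightarrow> norm (cis x - \<zeta> $ j) < \<delta> / (real n + 1))" for j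
  proof -
    have "isCont cis (t j)" using continuous_on_cis[OF continuous_on_id, of UNIV] by (simp add: continuous_on_eq_continuous_at)
    moreover have "\<delta> / (real n + 1) > 0" using \<delta> by simp
    ultimately obtain s where s: "s > 0" "\<And>x. dist x (t j) < s \<Longrightarrow> dist (cis x) (cis (t j)) < \<delta> / (real n + 1)"
      unfolding continuous_at_eps_delta by blast
    show ?thesis
      by (rule exI[of _ "min (s / 2) (2 * pi - t j)"]) (use s t in \<open>auto simp: dist_norm\<close>)
  qed
  then obtain \<eta> where \<eta>: "\<And>j. \<eta> j > 0" "\<And>j. t j + \<eta> j \<le> 2 * pi"
    "\<And>j x. t j \<le> x \<Longrightarrow> x \<le> t j + \<eta> j \<Longrightarrow> norm (cis x - \<zeta> $ j) < \<delta> / (real n + 1)" by metis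
  define S where "S = PiE UNIV (\<lambda>j. {t j..t j + \<eta> j})"
  have Sm: "S \<in> sets (PiM UNIV (\<lambda>_::'n. angle))" unfolding S_def by (intro sets_PiM_I_finite) (auto simp: sets_angle)
  have "emeasure (PiM UNIV (\<lambda>_::'n. angle)) S = (\<Prod>j\<in>UNIV. emeasure angle {t j..t j + \<eta> j})"
    unfolding S_def by (rule angle_prod.emeasure_PiM) (auto simp: sets_angle)
  also have "\<dots> \<noteq> 0"
  proof -
    have "emeasure angle {t j..t j + \<eta> j} \<noteq> 0" for j
    proof -
      have "{0..2 * pi} \<inter> {t j..t j + \<eta> j} = {t j..t j + \<eta> j}" using t(2)[of j] \<eta>(2)[of j] by auto
      then show ?thesis using \<eta>(1)[of j] by (simp add: emeasure_angle divide_ennreal)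
    qed
    then show ?thesis by (simp add: prod_zero_iff)
  qed
  finally have S0: "emeasure (PiM UNIV (\<lambda>_::'n. angle)) S \<noteq> 0" .
  have "AE x in PiM UNIV (\<lambda>_::'n. angle). d (etorus x) = 0"
  proof (rule AE_distrD[OF etorus_measurable])
    show "AE \<zeta> in distr (PiM UNIV (\<lambda>_::'n. angle)) (restrict_space borel torus) etorus. d \<zeta> = 0"
      using ae unfolding torus_measure_eq .
  qed
  moreover have "d (etorus x) \<noteq> 0" if x: "x \<in> S" for x
  proof -
    have "dist (etorus x) \<zeta> \<le> (\<Sum>j\<in>UNIV. norm (cis (x j) - \<zeta> $ j))"
      using L2_set_le_sum[of UNIV "\<lambda>j. norm ((etorus x - \<zeta>) $ j)"] by (simp add: dist_norm norm_vec_def)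
    also have "\<dots> \<le> (\<Sum>j\<in>(UNIV::'n set). \<delta> / (real n + 1))"
    proof (rule sum_mono)
      fix j
      have "x j \<in> {t j..t j + \<eta> j}" using x by (auto simp: S_def PiE_def Pi_def)
      then show "norm (cis (x j) - \<zeta> $ j) \<le> \<delta> / (real n + 1)" using \<eta>(3)[of j "x j"] by simp
    qed
    also have "\<dots> < \<delta>" using \<delta> by (simp add: n_def field_simps)
    finally show ?thesis using \<delta>(2)[of "etorus x"] by auto
  qed
  ultimately have "AE x in PiM UNIV (\<lambda>_::'n. angle). x \<notin> S" by (auto elim: eventually_mono)
  then have "emeasure (PiM UNIV (\<lambda>_::'n. angle)) S = 0"
    using Sm by (subst (asm) AE_iff_measurable[OF Sm]) (auto simp: space_PiM)
  with S0 show False by simp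
qed

section \<open>The radial equation of an angular mode\<close>

text \<open>
  The displayed equation is \<open>|z|\<^sup>2 L F = 0\<close> at \<open>z = r e\<^bsup>it\<^esup>\<close>, written in polar coordinates, with \<open>z \<partial>\<^sub>z\<close>
  equal to \<open>(r \<partial>\<^sub>r - i \<partial>\<^sub>t) / 2\<close>. Radii range over \<open>(-1, 1)\<close>, which only doubles the description of the disc,
  so that the regularity of \<open>F\<close> at the origin appears as differentiability at the interior point \<open>r = 0\<close>.
\<close>
definition polar_harmonic :: "complex \<Rightarrow> complex \<Rightarrow> (real \<Rightarrow> real \<Rightarrow> complex) \<Rightarrow> bool" where
  "polar_harmonic a b F \<longleftrightarrow> (\<exists>Fr Frr Ft Ftt.
     (\<forall>G\<in>{F, Fr, Frr, Ft, Ftt}. continuous_on ({-1<..<1} \<times> UNIV) (\<lambda>(r, t). G r t)) \<and>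
     (\<forall>r\<in>{-1<..<1}. \<forall>t.
        ((\<lambda>r. F r t) has_vector_derivative Fr r t) (at r) \<and>
        ((\<lambda>r. Fr r t) has_vector_derivative Frr r t) (at r) \<and>
        ((\<lambda>t. F r t) has_vector_derivative Ft r t) (at t) \<and>
        ((\<lambda>t. Ft r t) has_vector_derivative Ftt r t) (at t) \<and>
        F r (t + 2 * pi) = F r t \<and> Ft r (t + 2 * pi) = Ft r t \<and>
        (1 - of_real r ^ 2) / 4 * (of_real r ^ 2 * Frr r t + of_real r * Fr r t + Ftt r t)
          + of_real r ^ 2 * (a / 2 * (of_real r * Fr r t - \<i> * Ft r t)
             + b / 2 * (of_real r * Fr r t + \<i> * Ft r t) - a * b * F r t) = 0))"

text \<open>
  This is \<open>2\<pi>\<close> times the Fourier coefficient with index \<open>-k\<close>.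
\<close>
definition mode :: "int \<Rightarrow> (real \<Rightarrow> complex) \<Rightarrow> complex" where
  "mode k g = integral {0..2 * pi} (\<lambda>t. g t * cis (of_int k * t))"

lemma mode_derivative:
  fixes G G' :: "real \<Rightarrow> real \<Rightarrow> complex"
  assumes c: "continuous_on ({-1<..<1} \<times> UNIV) (\<lambda>(r, t). G' r t)"
    and c0: "continuous_on ({-1<..<1} \<times> UNIV) (\<lambda>(r, t). G r t)"
    and d: "\<And>r t. r \<in> {-1<..<1} \<Longrightarrow> ((\<lambda>r. G r t) has_vector_derivative G' r t) (at r)"
    and r: "r \<in> {-1<..<1}"
  shows "((\<lambda>r. mode k (G r)) has_vector_derivative mode k (G' r)) (at r)"
proof -
  have cont_cis: "continuous_on A (\<lambda>t. cis (of_int k * t))" for A :: "real set" by (intro continuous_intros)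
  have "((\<lambda>r. integral (cbox 0 (2 * pi)) (\<lambda>t. G r t * cis (of_int k * t))) has_vector_derivative
      integral (cbox 0 (2 * pi)) (\<lambda>t. G' r t * cis (of_int k * t))) (at r within {-1<..<1})"
  proof (rule leibniz_rule_vector_derivative)
    fix r t :: real assume "r \<in> {-1<..<1}"
    show "((\<lambda>r. G r t * cis (of_int k * t)) has_vector_derivative G' r t * cis (of_int k * t)) (at r within {-1<..<1})"
      by (rule has_vector_derivative_at_within, rule has_vector_derivative_mult_left, rule d) fact
  next
    fix r :: real assume r: "r \<in> {-1<..<1}"
    have "continuous_on (cbox 0 (2 * pi)) (\<lambda>t. (\<lambda>(r, t). G r t) (r, t))"
      by (rule continuous_on_compose2[OF c0, where f = "\<lambda>t. (r, t)"])
         (use r in \<open>auto intro: continuous_on_Pair continuous_on_const continuous_on_id\<close>)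
    then have "continuous_on (cbox 0 (2 * pi)) (G r)" by simp
    then show "(\<lambda>t. G r t * cis (of_int k * t)) integrable_on cbox 0 (2 * pi)"
      by (intro integrable_continuous continuous_on_mult cont_cis)
  next
    have "continuous_on ({-1<..<1} \<times> cbox 0 (2 * pi)) (\<lambda>(r, t). G' r t)"
      by (rule continuous_on_subset[OF c]) auto
    moreover have "continuous_on ({-1<..<1::real} \<times> cbox 0 (2 * pi)) (\<lambda>(r, t). cis (of_int k * t))"
      unfolding split_beta by (intro continuous_intros)
    ultimately have "continuous_on ({-1<..<1} \<times> cbox 0 (2 * pi)) (\<lambda>x. (\<lambda>(r, t). G' r t) x * (\<lambda>(r, t). cis (of_int k * t)) x)"
      by (rule continuous_on_mult)
    then show "continuous_on ({-1<..<1} \<times> cbox 0 (2 * pi)) (\<lambda>(r, t). G' r t * cis (of_int k * t))"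
      by (simp add: split_beta)
  qed (use r in \<open>auto simp: convex_real_interval\<close>)
  moreover have "at r within {-1<..<1} = at r" using r by (intro at_within_open) auto
  ultimately show ?thesis unfolding mode_def by simp
qed

lemma mode_by_parts:
  fixes g g' :: "real \<Rightarrow> complex"
  assumes d: "\<And>t. (g has_vector_derivative g' t) (at t)" and c: "continuous_on UNIV g'"
    and p: "g (2 * pi) = g 0"
  shows "mode k g' = - \<i> * of_int k * mode k g"
proof -
  have cg: "continuous_on UNIV g"
    by (intro continuous_at_imp_continuous_on ballI has_vector_derivative_continuous[OF d])
  have cis: "(cis has_vector_derivative \<i> * cis x) (at x)" for x
    unfolding cis_conv_exp by (auto intro!: derivative_eq_intros has_vector_derivative_real_field)
  have "((\<lambda>t. cis (of_int k * t)) has_vector_derivative of_int k *\<^sub>R (\<i> * cis (of_int k * t))) (at t)" for t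
  proof -
    have "((\<lambda>t. real_of_int k * t) has_vector_derivative real_of_int k) (at t)"
      by (auto intro!: derivative_eq_intros simp flip: has_real_derivative_iff_has_vector_derivative)
    from vector_diff_chain_at[OF this cis] show ?thesis by (simp add: comp_def)
  qed
  then have "((\<lambda>t. g t * cis (of_int k * t)) has_vector_derivative
      (g t * (of_int k *\<^sub>R (\<i> * cis (of_int k * t))) + g' t * cis (of_int k * t))) (at t within {0..2 * pi})" for t
    by (rule has_vector_derivative_at_within[OF has_vector_derivative_mult[OF d]])
  then have "((\<lambda>t. g t * (of_int k *\<^sub>R (\<i> * cis (of_int k * t))) + g' t * cis (of_int k * t)) has_integral
      (g (2 * pi) * cis (of_int k * (2 * pi)) - g 0 * cis (of_int k * 0))) {0..2 * pi}"
    by (intro fundamental_theorem_of_calculus) auto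
  moreover have "cis (of_int k * (2 * pi)) = 1"
    using cis_multiple_2pi[of "of_int k"] by (simp add: mult.commute mult.left_commute)
  ultimately have "((\<lambda>t. \<i> * of_int k * (g t * cis (of_int k * t)) + g' t * cis (of_int k * t)) has_integral 0) {0..2 * pi}"
    using p by (simp add: scaleR_conv_of_real mult_ac)
  moreover have "((\<lambda>t. \<i> * of_int k * (g t * cis (of_int k * t)) + g' t * cis (of_int k * t)) has_integral
      \<i> * of_int k * mode k g + mode k g') {0..2 * pi}"
    unfolding mode_def
    by (intro has_integral_add has_integral_mult_right integrable_integral integrable_continuous_interval continuous_intros
        continuous_on_subset[OF c] continuous_on_subset[OF cg]) auto
  ultimately have "\<i> * of_int k * mode k g + mode k g' = 0" by (rule has_integral_unique[symmetric])
  then show ?thesis by (simp add: add_eq_0_iff)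
qed

text \<open>
  Gronwall's argument for the energy \<open>|h|\<^sup>2 + |h'|\<^sup>2\<close> on the compact interval between \<open>\<rho>\<close> and \<open>s\<close>.
\<close>
lemma linear_ode_zero:
  fixes h h' h'' :: "real \<Rightarrow> complex" and p q :: "real \<Rightarrow> complex"
  assumes d: "\<And>r. r \<in> {0<..<1} \<Longrightarrow> (h has_vector_derivative h' r) (at r)"
    and d': "\<And>r. r \<in> {0<..<1} \<Longrightarrow> (h' has_vector_derivative h'' r) (at r)"
    and ode: "\<And>r. r \<in> {0<..<1} \<Longrightarrow> h'' r = - p r * h' r - q r * h r"
    and p: "continuous_on {0<..<1} p" and q: "continuous_on {0<..<1} q"
    and r0: "\<rho> \<in> {0<..<1}" "h \<rho> = 0" "h' \<rho> = 0" and s: "s \<in> {0<..<1}"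
  shows "h s = 0"
proof -
  define c e where "c = min \<rho> s" and "e = max \<rho> s"
  have ce: "{c..e} \<subseteq> {0<..<1}" using r0 s by (auto simp: c_def e_def)
  have "bounded (p ` {c..e})" "bounded (q ` {c..e})"
    by (intro compact_imp_bounded compact_continuous_image continuous_on_subset[OF p ce] continuous_on_subset[OF q ce] compact_Icc)+
  then obtain K1 K2 where "\<forall>x\<in>p ` {c..e}. norm x \<le> K1" "\<forall>x\<in>q ` {c..e}. norm x \<le> K2" by (auto simp: bounded_iff)
  then have K: "norm (p r) \<le> max K1 K2" "norm (q r) \<le> max K1 K2" if "r \<in> {c..e}" for r using that by (auto simp: le_max_iff_disj)
  define K where "K = max K1 K2"
  define L where "L = 1 + 3 * K"
  define E where "E r = (norm (h r))\<^sup>2 + (norm (h' r))\<^sup>2" for r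
  define E' where "E' r = 2 * (h r \<bullet> h' r) + 2 * (h' r \<bullet> h'' r)" for r
  have dE: "(E has_real_derivative E' r) (at r)" if "r \<in> {c..e}" for r
  proof -
    have r: "r \<in> {0<..<1}" using that ce by auto
    have "((\<lambda>r. h r \<bullet> h r + h' r \<bullet> h' r) has_vector_derivative
        ((h r \<bullet> h' r + h' r \<bullet> h r) + (h' r \<bullet> h'' r + h'' r \<bullet> h' r))) (at r)"
      by (intro has_vector_derivative_add bounded_bilinear.has_vector_derivative[OF bounded_bilinear_inner] d d' r)
    then show ?thesis
      unfolding E_def E'_def power2_norm_eq_inner
      by (simp add: has_real_derivative_iff_has_vector_derivative inner_commute)
  qed
  have E'L: "\<bar>E' r\<bar> \<le> L * E r" if "r \<in> {c..e}" for r
  proof -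
    define x y where "x = norm (h r)" and "y = norm (h' r)"
    have xy: "x \<ge> 0" "y \<ge> 0" "2 * (x * y) \<le> x\<^sup>2 + y\<^sup>2"
      using zero_le_power2[of "x - y"] by (auto simp: x_def y_def power2_eq_square algebra_simps)
    have K0: "K \<ge> 0" using K(1)[OF that] norm_ge_zero[of "p r"] unfolding K_def by linarith
    have "r \<in> {0<..<1}" using that ce by auto
    then have "norm (h'' r) \<le> norm (p r) * y + norm (q r) * x"
      using ode norm_triangle_ineq4[of "- p r * h' r" "q r * h r"] by (simp add: norm_mult x_def y_def)
    also have "\<dots> \<le> K * y + K * x"
      using K[OF that] xy by (intro add_mono mult_right_mono) (auto simp: K_def)
    finally have "y * norm (h'' r) \<le> y * (K * y + K * x)" using xy by (intro mult_left_mono)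
    moreover have "\<bar>h r \<bullet> h' r\<bar> \<le> x * y" "\<bar>h' r \<bullet> h'' r\<bar> \<le> y * norm (h'' r)"
      unfolding x_def y_def by (rule Cauchy_Schwarz_ineq2)+
    ultimately have "\<bar>E' r\<bar> \<le> 2 * (x * y) + 2 * (y * (K * y + K * x))" unfolding E'_def by linarith
    also have "\<dots> = 2 * (x * y) + 2 * K * y\<^sup>2 + K * (2 * (x * y))" by (simp add: power2_eq_square algebra_simps)
    also have "\<dots> \<le> (x\<^sup>2 + y\<^sup>2) + 2 * K * (x\<^sup>2 + y\<^sup>2) + K * (x\<^sup>2 + y\<^sup>2)"
      using xy K0 by (intro add_mono mult_left_mono) auto
    also have "\<dots> = L * E r" by (simp add: L_def E_def x_def y_def algebra_simps)
    finally show ?thesis .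
  qed
  have E0: "E \<rho> = 0" using r0 by (simp add: E_def)
  have "E s \<le> 0"
  proof (cases "\<rho> \<le> s")
    case True
    have "E s * exp (- L * s) \<le> E \<rho> * exp (- L * \<rho>)"
    proof (rule DERIV_nonpos_imp_nonincreasing[OF True])
      fix x assume x: "\<rho> \<le> x" "x \<le> s"
      then have xc: "x \<in> {c..e}" by (auto simp: c_def e_def)
      have "((\<lambda>r. E r * exp (- L * r)) has_real_derivative (E' x - L * E x) * exp (- L * x)) (at x)"
        by (auto intro!: derivative_eq_intros dE[OF xc] simp: algebra_simps)
      moreover have "(E' x - L * E x) * exp (- L * x) \<le> 0"
        using E'L[OF xc] by (intro mult_nonpos_nonneg) auto
      ultimately show "\<exists>y. ((\<lambda>r. E r * exp (- L * r)) has_real_derivative y) (at x) \<and> y \<le> 0" by blast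
    qed
    then show ?thesis using E0 by (simp add: mult_le_0_iff)
  next
    case False
    then have sr: "s \<le> \<rho>" by simp
    have "E s * exp (L * s) \<le> E \<rho> * exp (L * \<rho>)"
    proof (rule DERIV_nonneg_imp_nondecreasing[OF sr])
      fix x assume x: "s \<le> x" "x \<le> \<rho>"
      then have xc: "x \<in> {c..e}" by (auto simp: c_def e_def)
      have "((\<lambda>r. E r * exp (L * r)) has_real_derivative (E' x + L * E x) * exp (L * x)) (at x)"
        by (auto intro!: derivative_eq_intros dE[OF xc] simp: algebra_simps)
      moreover have "(E' x + L * E x) * exp (L * x) \<ge> 0"
        using E'L[OF xc] by (intro mult_nonneg_nonneg) auto
      ultimately show "\<exists>y. ((\<lambda>r. E r * exp (L * r)) has_real_derivative y) (at x) \<and> 0 \<le> y" by blast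
    qed
    then show ?thesis using E0 by (simp add: mult_le_0_iff)
  qed
  then show ?thesis by (simp add: E_def sum_power2_le_zero_iff)
qed

text \<open>
  \<open>P\<close> times the Wronskian of \<open>f\<close> and \<open>g\<close> has derivative zero and vanishes at \<open>0\<close>, so the Wronskian is zero.
  If \<open>g\<close> is nonzero at some point, then \<open>f\<close> minus a multiple of \<open>g\<close> has zero initial data there.
  The solutions may have other zeros, so the quotient \<open>f / g\<close> cannot be used directly.
\<close>
lemma linear_ode_proportional:
  fixes f f' f'' g g' g'' p q P :: "real \<Rightarrow> complex"
  assumes f: "\<And>r. r \<in> {-1<..<1} \<Longrightarrow> (f has_vector_derivative f' r) (at r)"
    and f': "\<And>r. r \<in> {-1<..<1} \<Longrightarrow> (f' has_vector_derivative f'' r) (at r)"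
    and f'': "\<And>r. r \<in> {0<..<1} \<Longrightarrow> f'' r = - p r * f' r - q r * f r"
    and g: "\<And>r. r \<in> {-1<..<1} \<Longrightarrow> (g has_vector_derivative g' r) (at r)"
    and g': "\<And>r. r \<in> {-1<..<1} \<Longrightarrow> (g' has_vector_derivative g'' r) (at r)"
    and g'': "\<And>r. r \<in> {0<..<1} \<Longrightarrow> g'' r = - p r * g' r - q r * g r"
    and p: "continuous_on {0<..<1} p" and q: "continuous_on {0<..<1} q"
    and P: "\<And>r. r \<in> {0<..<1} \<Longrightarrow> (P has_vector_derivative p r * P r) (at r)"
    and P0: "isCont P 0" "P 0 = 0" "\<And>r. r \<in> {0<..<1} \<Longrightarrow> P r \<noteq> 0"
    and rs: "0 \<le> r" "r < 1" "0 \<le> s" "s < 1"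
  shows "f r * g s = f s * g r"
proof -
  have cont: "isCont f x" "isCont g x" "isCont f' x" "isCont g' x" if "x \<in> {-1<..<1}" for x
    using f[OF that] f'[OF that] g[OF that] g'[OF that] by (auto intro: has_vector_derivative_continuous)
  define W where "W r = P r * (f r * g' r - g r * f' r)" for r
  have dW: "(W has_vector_derivative 0) (at r within {0<..<1})" if r: "r \<in> {0<..<1}" for r
  proof -
    have r': "r \<in> {-1<..<1}" using r by auto
    have "(W has_vector_derivative (P r * ((f r * g'' r + f' r * g' r) - (g r * f'' r + g' r * f' r))
        + p r * P r * (f r * g' r - g r * f' r))) (at r)"
      unfolding W_def
      by (intro has_vector_derivative_mult has_vector_derivative_diff P f g f' g' r r')
    also have "P r * ((f r * g'' r + f' r * g' r) - (g r * f'' r + g' r * f' r))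
        + p r * P r * (f r * g' r - g r * f' r) = 0"
      unfolding f''[OF r] g''[OF r] by (simp add: algebra_simps)
    finally show ?thesis by (rule has_vector_derivative_at_within)
  qed
  obtain w where w: "\<And>r. r \<in> {0<..<1} \<Longrightarrow> W r = w"
    using has_vector_derivative_zero_constant[OF _ dW] by auto
  have "isCont W 0" unfolding W_def by (intro continuous_intros P0 cont) auto
  then have "(W \<longlongrightarrow> 0) (at_right 0)"
    using P0(2) by (simp add: isCont_def W_def filterlim_at_split)
  moreover have "(W \<longlongrightarrow> w) (at_right 0)"
    by (rule tendsto_eventually) (use w in \<open>auto simp: eventually_at_right_less eventually_at_right[of 0 1] intro!: exI[of _ 1]\<close>)
  ultimately have "w = 0" by (intro tendsto_unique[OF trivial_limit_at_right_real])
  then have wr: "f r * g' r = g r * f' r" if "r \<in> {0<..<1}" for r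
    using w[OF that] P0(3)[OF that] by (simp add: W_def)
  have main: "f r * g s = f s * g r" if r: "r \<in> {0<..<1}" and s: "s \<in> {0<..<1}" for r s
  proof (cases "\<forall>x\<in>{0<..<1}. g x = 0")
    case False
    then obtain r0 where r0: "r0 \<in> {0<..<1}" "g r0 \<noteq> 0" by auto
    define C where "C = f r0 / g r0"
    have z: "f x - C * g x = 0" if x: "x \<in> {0<..<1}" for x
    proof (rule linear_ode_zero[where \<rho> = r0 and h = "\<lambda>x. f x - C * g x" and h' = "\<lambda>x. f' x - C * g' x"
        and h'' = "\<lambda>x. f'' x - C * g'' x" and p = p and q = q])
      show "f r0 - C * g r0 = 0" using r0 by (simp add: C_def)
      show "f' r0 - C * g' r0 = 0" using r0 wr[OF r0(1)] by (simp add: C_def field_simps)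
      fix y :: real assume y: "y \<in> {0<..<1}"
      then have y': "y \<in> {-1<..<1}" by auto
      show "((\<lambda>x. f x - C * g x) has_vector_derivative f' y - C * g' y) (at y)"
        by (intro has_vector_derivative_diff has_vector_derivative_mult_right f g y')
      show "((\<lambda>x. f' x - C * g' x) has_vector_derivative f'' y - C * g'' y) (at y)"
        by (intro has_vector_derivative_diff has_vector_derivative_mult_right f' g' y')
      show "f'' y - C * g'' y = - p y * (f' y - C * g' y) - q y * (f y - C * g y)"
        unfolding f''[OF y] g''[OF y] by (simp add: algebra_simps)
    qed (use p q r0 x in auto)
    then show ?thesis using z[OF r] z[OF s] by (simp add: algebra_simps)
  qed (use r s in auto)
  have at0: "eventually (\<lambda>x. x \<in> {0<..<1::real}) (at_right 0)"
    by (simp add: eventually_at_right[of 0 1]) (auto intro!: exI[of _ 1])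
  have lim: "(h \<longlongrightarrow> h 0) (at_right 0)" if "isCont h 0" for h :: "real \<Rightarrow> complex"
    using that by (simp add: isCont_def filterlim_at_split)
  have main0: "f 0 * g s = f s * g 0" if s: "s \<in> {0<..<1}" for s
  proof (rule tendsto_unique[OF trivial_limit_at_right_real])
    show "((\<lambda>x. f x * g s) \<longlongrightarrow> f 0 * g s) (at_right 0)" by (intro tendsto_intros lim cont) auto
    have "((\<lambda>x. f s * g x) \<longlongrightarrow> f s * g 0) (at_right 0)" by (intro tendsto_intros lim cont) auto
    then show "((\<lambda>x. f x * g s) \<longlongrightarrow> f s * g 0) (at_right 0)"
      by (rule Lim_transform_eventually) (use at0 in eventually_elim, use main s in auto)
  qed
  consider "r = 0" "s = 0" | "r = 0" "s \<in> {0<..<1}" | "s = 0" "r \<in> {0<..<1}" | "r \<in> {0<..<1}" "s \<in> {0<..<1}"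
    using rs by fastforce
  then show ?thesis using main main0 by cases auto
qed

lemma radial_ode_normal_form:
  fixes x y f2 f1 f0 K a b :: complex 
  assumes that: "y \<noteq> 0" "x \<noteq> 0" "y / 4 * (x ^ 2 * f2 + x * f1 - K\<^sup>2 * f0)
          + x ^ 2 * (a / 2 * (x * f1 - K * f0) + b / 2 * (x * f1 + K * f0) - a * b * f0) = 0"
  shows "f2 = - (1 / x + 2 * (a + b) * x / y) * f1 - (- K\<^sup>2 / x ^ 2 + 4 / y * ((b - a) * K / 2 - a * b)) * f0"
proof -
  define R where "R = - (1 / x + 2 * (a + b) * x / y) * f1 - (- K\<^sup>2 / x ^ 2 + 4 / y * ((b - a) * K / 2 - a * b)) * f0"
  have "y / 4 * x ^ 2 * R = - (y / 4) * (x * f1 - K\<^sup>2 * f0) - x ^ 2 * (a / 2 * (x * f1 - K * f0) + b / 2 * (x * f1 + K * f0) - a * b * f0)"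
    unfolding R_def using that(1,2) by (simp add: field_simps power2_eq_square)
  moreover have "y / 4 * x ^ 2 * f2 = - (y / 4) * (x * f1 - K\<^sup>2 * f0) - x ^ 2 * (a / 2 * (x * f1 - K * f0) + b / 2 * (x * f1 + K * f0) - a * b * f0)"
    using that(3) by (simp add: algebra_simps add_eq_0_iff)
  ultimately have "y / 4 * x ^ 2 * R = y / 4 * x ^ 2 * f2" by simp
  then show ?thesis unfolding R_def[symmetric] using that(1,2) by simp
qed

text \<open>
  The \<open>k\<close>-th mode of a polar-harmonic function solves \<open>f'' = - p f' - q f\<close> with \<open>p = 1/r + 2(a + b) r / (1 - r\<^sup>2)\<close>.
  The integrating factor of the Wronskian is \<open>r (1 - r\<^sup>2)\<^bsup>-(a + b)\<^esup>\<close>, which vanishes at \<open>0\<close>.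
\<close>
theorem polar_harmonic_modes_proportional:
  assumes F: "polar_harmonic a b F" and G: "polar_harmonic a b G"
    and rs: "0 \<le> r" "r < 1" "0 \<le> s" "s < 1"
  shows "mode k (F r) * mode k (G s) = mode k (F s) * mode k (G r)"
proof -
  define p where "p r = 1 / of_real r + 2 * (a + b) * of_real r / (1 - of_real r ^ 2)" for r :: real
  define q where "q r = - (of_int k)\<^sup>2 / of_real r ^ 2 + 4 / (1 - of_real r ^ 2) * ((b - a) * of_int k / 2 - a * b)" for r :: real
  define P where "P r = of_real r * exp (- (a + b) * of_real (ln (1 - r\<^sup>2)))" for r :: real
  have nz: "1 - complex_of_real r ^ 2 \<noteq> 0" "complex_of_real r \<noteq> 0" if "r \<in> {0<..<1}" for r
  proof -
    have "r\<^sup>2 < 1" using that by (simp add: power_less_one_iff abs_square_less_1)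
    then have "1 - r\<^sup>2 \<noteq> 0" by simp
    then show "1 - complex_of_real r ^ 2 \<noteq> 0" by (metis of_real_1 of_real_diff of_real_eq_0_iff of_real_power)
    show "complex_of_real r \<noteq> 0" using that by simp
  qed
  have *: "\<exists>f' f''. (\<forall>r\<in>{-1<..<1}. ((\<lambda>r. mode k (F r)) has_vector_derivative f' r) (at r)) \<and>
      (\<forall>r\<in>{-1<..<1}. (f' has_vector_derivative f'' r) (at r)) \<and>
      (\<forall>r\<in>{0<..<1}. f'' r = - p r * f' r - q r * mode k (F r))"
    if F: "polar_harmonic a b F" for F
  proof -
    from F obtain Fr Frr Ft Ftt where
      c: "\<forall>G\<in>{F, Fr, Frr, Ft, Ftt}. continuous_on ({-1<..<1} \<times> UNIV) (\<lambda>(r, t). G r t)"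
      and raw: "\<forall>r\<in>{-1<..<1}. \<forall>t.
        ((\<lambda>r. F r t) has_vector_derivative Fr r t) (at r) \<and>
        ((\<lambda>r. Fr r t) has_vector_derivative Frr r t) (at r) \<and>
        ((\<lambda>t. F r t) has_vector_derivative Ft r t) (at t) \<and>
        ((\<lambda>t. Ft r t) has_vector_derivative Ftt r t) (at t) \<and>
        F r (t + 2 * pi) = F r t \<and> Ft r (t + 2 * pi) = Ft r t \<and>
        (1 - of_real r ^ 2) / 4 * (of_real r ^ 2 * Frr r t + of_real r * Fr r t + Ftt r t)
          + of_real r ^ 2 * (a / 2 * (of_real r * Fr r t - \<i> * Ft r t)
             + b / 2 * (of_real r * Fr r t + \<i> * Ft r t) - a * b * F r t) = 0"
      unfolding polar_harmonic_def by (elim exE conjE)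
    note c = bspec[OF c]
    have d: "((\<lambda>r. F r t) has_vector_derivative Fr r t) (at r)"
        "((\<lambda>r. Fr r t) has_vector_derivative Frr r t) (at r)"
        "((\<lambda>t. F r t) has_vector_derivative Ft r t) (at t)"
        "((\<lambda>t. Ft r t) has_vector_derivative Ftt r t) (at t)"
      and per: "F r (t + 2 * pi) = F r t" "Ft r (t + 2 * pi) = Ft r t"
      and eq: "(1 - of_real r ^ 2) / 4 * (of_real r ^ 2 * Frr r t + of_real r * Fr r t + Ftt r t)
          + of_real r ^ 2 * (a / 2 * (of_real r * Fr r t - \<i> * Ft r t)
             + b / 2 * (of_real r * Fr r t + \<i> * Ft r t) - a * b * F r t) = 0"
      if "r \<in> {-1<..<1}" for r t
      using raw that by simp_all
    have c1: "continuous_on A (H r)" if "H \<in> {F, Fr, Frr, Ft, Ftt}" "r \<in> {-1<..<1}" for H r A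
    proof -
      have "continuous_on A (\<lambda>t. (\<lambda>(r, t). H r t) (r, t))"
        by (rule continuous_on_compose2[OF c[OF that(1)]]) (use that in \<open>auto intro!: continuous_intros\<close>)
      then show ?thesis by simp
    qed
    have D1: "((\<lambda>r. mode k (F r)) has_vector_derivative mode k (Fr r)) (at r)" if "r \<in> {-1<..<1}" for r
      by (rule mode_derivative) (use c d that in auto)
    have D2: "((\<lambda>r. mode k (Fr r)) has_vector_derivative mode k (Frr r)) (at r)" if "r \<in> {-1<..<1}" for r
      by (rule mode_derivative) (use c d that in auto)
    have ODE: "mode k (Frr r) = - p r * mode k (Fr r) - q r * mode k (F r)" if r: "r \<in> {0<..<1}" for r
    proof -
      have r': "r \<in> {-1<..<1}" using r by auto
      have T1: "mode k (Ft r) = - \<i> * of_int k * mode k (F r)"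
        by (rule mode_by_parts) (use d(3)[OF r'] c1[OF _ r'] per(1)[OF r', of 0] in auto)
      have T2: "mode k (Ftt r) = - \<i> * of_int k * mode k (Ft r)"
        by (rule mode_by_parts) (use d(4)[OF r'] c1[OF _ r'] per(2)[OF r', of 0] in auto)
      have "mode k (Ftt r) = (\<i> * \<i>) * ((of_int k)\<^sup>2 * mode k (F r))"
        unfolding T2 T1 by (simp add: power2_eq_square mult_ac)
      then have T2': "mode k (Ftt r) = - ((of_int k)\<^sup>2 * mode k (F r))" by simp
      have hi: "((\<lambda>t. H r t * cis (of_int k * t)) has_integral mode k (H r)) {0..2 * pi}" if "H \<in> {F, Fr, Frr, Ft, Ftt}" for H
        unfolding mode_def
        by (intro integrable_integral integrable_continuous_interval continuous_intros c1[OF that r'])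
      let ?x = "complex_of_real r"
      have "((\<lambda>t. (1 - ?x ^ 2) / 4 * (?x ^ 2 * (Frr r t * cis (of_int k * t)) + ?x * (Fr r t * cis (of_int k * t)) + (Ftt r t * cis (of_int k * t)))
          + ?x ^ 2 * (a / 2 * (?x * (Fr r t * cis (of_int k * t)) - \<i> * (Ft r t * cis (of_int k * t)))
             + b / 2 * (?x * (Fr r t * cis (of_int k * t)) + \<i> * (Ft r t * cis (of_int k * t))) - a * b * (F r t * cis (of_int k * t))))
         has_integral ((1 - ?x ^ 2) / 4 * (?x ^ 2 * mode k (Frr r) + ?x * mode k (Fr r) + mode k (Ftt r))
          + ?x ^ 2 * (a / 2 * (?x * mode k (Fr r) - \<i> * mode k (Ft r))
             + b / 2 * (?x * mode k (Fr r) + \<i> * mode k (Ft r)) - a * b * mode k (F r)))) {0..2 * pi}"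
        by (intro has_integral_add has_integral_diff has_integral_mult_right hi) auto
      moreover have "(1 - ?x ^ 2) / 4 * (?x ^ 2 * (Frr r t * cis (of_int k * t)) + ?x * (Fr r t * cis (of_int k * t)) + (Ftt r t * cis (of_int k * t)))
          + ?x ^ 2 * (a / 2 * (?x * (Fr r t * cis (of_int k * t)) - \<i> * (Ft r t * cis (of_int k * t)))
             + b / 2 * (?x * (Fr r t * cis (of_int k * t)) + \<i> * (Ft r t * cis (of_int k * t))) - a * b * (F r t * cis (of_int k * t))) = 0" for t
      proof -
        have "(1 - ?x ^ 2) / 4 * (?x ^ 2 * (Frr r t * w) + ?x * (Fr r t * w) + (Ftt r t * w))
          + ?x ^ 2 * (a / 2 * (?x * (Fr r t * w) - \<i> * (Ft r t * w))
             + b / 2 * (?x * (Fr r t * w) + \<i> * (Ft r t * w)) - a * b * (F r t * w)) =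
          w * ((1 - of_real r ^ 2) / 4 * (of_real r ^ 2 * Frr r t + of_real r * Fr r t + Ftt r t)
          + of_real r ^ 2 * (a / 2 * (of_real r * Fr r t - \<i> * Ft r t)
             + b / 2 * (of_real r * Fr r t + \<i> * Ft r t) - a * b * F r t))" for w
          by (simp add: algebra_simps)
        then show ?thesis unfolding eq[OF r'] by simp
      qed
      ultimately have "(1 - ?x ^ 2) / 4 * (?x ^ 2 * mode k (Frr r) + ?x * mode k (Fr r) + mode k (Ftt r))
          + ?x ^ 2 * (a / 2 * (?x * mode k (Fr r) - \<i> * mode k (Ft r))
             + b / 2 * (?x * mode k (Fr r) + \<i> * mode k (Ft r)) - a * b * mode k (F r)) = 0"
        by (simp add: has_integral_0_eq has_integral_unique)
      then have E: "(1 - ?x ^ 2) / 4 * (?x ^ 2 * mode k (Frr r) + ?x * mode k (Fr r) - (of_int k)\<^sup>2 * mode k (F r))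
          + ?x ^ 2 * (a / 2 * (?x * mode k (Fr r) - of_int k * mode k (F r))
             + b / 2 * (?x * mode k (Fr r) + of_int k * mode k (F r)) - a * b * mode k (F r)) = 0"
        unfolding T2' T1 by (simp add: power2_eq_square mult.assoc[symmetric])
      show ?thesis unfolding p_def q_def by (rule radial_ode_normal_form[OF nz[OF r] E])
    qed
    show ?thesis
      by (intro exI[of _ "\<lambda>r. mode k (Fr r)"] exI[of _ "\<lambda>r. mode k (Frr r)"] conjI ballI D1 D2 ODE)
  qed
  from *[OF F] obtain f' f'' where f: "\<And>r. r\<in>{-1<..<1} \<Longrightarrow> ((\<lambda>r. mode k (F r)) has_vector_derivative f' r) (at r)"
      "\<And>r. r\<in>{-1<..<1} \<Longrightarrow> (f' has_vector_derivative f'' r) (at r)"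
      "\<And>r. r\<in>{0<..<1} \<Longrightarrow> f'' r = - p r * f' r - q r * mode k (F r)" by blast
  from *[OF G] obtain g' g'' where g: "\<And>r. r\<in>{-1<..<1} \<Longrightarrow> ((\<lambda>r. mode k (G r)) has_vector_derivative g' r) (at r)"
      "\<And>r. r\<in>{-1<..<1} \<Longrightarrow> (g' has_vector_derivative g'' r) (at r)"
      "\<And>r. r\<in>{0<..<1} \<Longrightarrow> g'' r = - p r * g' r - q r * mode k (G r)" by blast
  show ?thesis
  proof (rule linear_ode_proportional[OF f g, where P = P])
    show "continuous_on {0<..<1} p" unfolding p_def by (intro continuous_intros) (use nz in auto)
    show "continuous_on {0<..<1} q" unfolding q_def by (intro continuous_intros) (use nz in auto)
    show "isCont P 0" unfolding P_def by (intro continuous_intros) auto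
    show "P 0 = 0" by (simp add: P_def)
    fix r :: real assume r: "r \<in> {0<..<1}"
    show "P r \<noteq> 0" using r by (simp add: P_def)
    have r2: "r\<^sup>2 < 1" using r by (simp add: abs_square_less_1)
    have "((\<lambda>r. ln (1 - r\<^sup>2)) has_real_derivative (- (2 * r) / (1 - r\<^sup>2))) (at r)"
      using r2 by (auto intro!: derivative_eq_intros)
    then have "((\<lambda>r. - (a + b) * of_real (ln (1 - r\<^sup>2))) has_vector_derivative - (a + b) * of_real (- (2 * r) / (1 - r\<^sup>2))) (at r)"
      by (intro has_vector_derivative_mult_right has_vector_derivative_of_real) (simp add: has_real_derivative_iff_has_vector_derivative)
    then have "(exp \<circ> (\<lambda>r. - (a + b) * of_real (ln (1 - r\<^sup>2))) has_vector_derivative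
        - (a + b) * of_real (- (2 * r) / (1 - r\<^sup>2)) * exp (- (a + b) * of_real (ln (1 - r\<^sup>2)))) (at r)"
      by (rule field_vector_diff_chain_at) (rule DERIV_exp)
    then have e: "((\<lambda>r. exp (- (a + b) * of_real (ln (1 - r\<^sup>2)))) has_vector_derivative
        - (a + b) * of_real (- (2 * r) / (1 - r\<^sup>2)) * exp (- (a + b) * of_real (ln (1 - r\<^sup>2)))) (at r)"
      by (simp add: comp_def)
    have "(complex_of_real has_vector_derivative of_real 1) (at r)"
      by (intro has_vector_derivative_of_real) (simp add: has_vector_derivative_id)
    from has_vector_derivative_mult[OF this e]
    show "(P has_vector_derivative p r * P r) (at r)"
      unfolding P_def by (rule has_vector_derivative_eq_rhs) (use nz[OF r] in \<open>simp add: p_def field_simps power2_eq_square\<close>)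
  qed (use rs in auto)
qed

section \<open>An Abelian theorem for coefficients of binomial type\<close>

text \<open>
  The Taylor coefficients of \<open>(1 - w)\<^bsup>-z\<^esup>\<close>.
\<close>
definition poch :: "'a::field_char_0 \<Rightarrow> nat \<Rightarrow> 'a" where
  "poch z n = pochhammer z n / fact n"

text \<open>
  Away from the poles of the Gamma function this is \<open>poch z n \<sim> n\<^bsup>z - 1\<^esup> / \<Gamma>(z)\<close>, Euler's limit formula; at the poles
  \<open>poch z n\<close> is eventually zero. A fixed shift
  of the index does not matter because \<open>ln (n + p) - ln n\<close> tends to zero.
\<close>
lemma poch_asymp:
  fixes z :: complex
  shows "(\<lambda>n. poch z (n + p) * exp (- (z - 1) * of_real (ln (real n)))) \<longlonglongrightarrow> rGamma z"
proof -
  have base: "(\<lambda>n. poch z n * exp (- (z - 1) * of_real (ln (real n)))) \<longlonglongrightarrow> rGamma z"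
  proof (cases "z \<in> \<int>\<^sub>\<le>\<^sub>0")
    case True
    then obtain k where k: "z = - of_nat k" by (elim nonpos_Ints_cases')
    have "eventually (\<lambda>n. poch z n * exp (- (z - 1) * of_real (ln (real n))) = 0) sequentially"
      using eventually_gt_at_top[of k]
      by eventually_elim (auto simp: k poch_def pochhammer_of_nat_eq_0_iff)
    then show ?thesis using True by (simp add: rGamma_nonpos_Int tendsto_eventually)
  next
    case False
    have "(\<lambda>n. inverse (Gamma_series' z n)) \<longlonglongrightarrow> inverse (Gamma z)"
      using False by (intro tendsto_inverse Gamma_series'_LIMSEQ) (simp add: Gamma_eq_zero_iff)
    moreover have "eventually (\<lambda>n. inverse (Gamma_series' z n) = poch z n * exp (- (z - 1) * of_real (ln (real n)))) sequentially"
      using eventually_gt_at_top[of 0]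
    proof eventually_elim
      case (elim n)
      then have f: "fact n = of_nat n * (fact (n - 1) :: complex)" by (metis fact_reduce)
      have e: "exp (- (z - 1) * of_real (ln (real n))) = of_nat n / exp (z * of_real (ln (real n)))"
        using elim by (simp add: algebra_simps exp_diff exp_of_real)
      show ?case unfolding Gamma_series'_def poch_def e f using elim by (simp add: field_simps)
    qed
    ultimately show ?thesis by (simp add: rGamma_inverse_Gamma Lim_transform_eventually)
  qed
  have "(\<lambda>n. ln (1 + real p * inverse (real n))) \<longlonglongrightarrow> ln (1 + real p * 0)"
    by (intro tendsto_intros lim_inverse_n) auto
  moreover have "eventually (\<lambda>n. ln (1 + real p * inverse (real n)) = ln (real (n + p)) - ln (real n)) sequentially"
    using eventually_gt_at_top[of 0]
  proof eventually_elim
    case (elim n)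
    then have "1 + real p * inverse (real n) = real (n + p) / real n" by (simp add: field_simps)
    then show ?case using elim by (simp only:) (simp add: ln_div)
  qed
  ultimately have ln: "(\<lambda>n. ln (real (n + p)) - ln (real n)) \<longlonglongrightarrow> 0"
    by (simp add: Lim_transform_eventually)
  have "(\<lambda>n. (poch z (n + p) * exp (- (z - 1) * of_real (ln (real (n + p)))))
       * exp ((z - 1) * of_real (ln (real (n + p)) - ln (real n)))) \<longlonglongrightarrow> rGamma z * exp ((z - 1) * of_real 0)"
    by (intro tendsto_intros ln LIMSEQ_ignore_initial_segment[OF base])
  moreover have "(poch z (n + p) * exp (- (z - 1) * of_real (ln (real (n + p)))))
       * exp ((z - 1) * of_real (ln (real (n + p)) - ln (real n))) = poch z (n + p) * exp (- (z - 1) * of_real (ln (real n)))" for n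
    by (simp add: mult.assoc algebra_simps flip: exp_add)
  ultimately show ?thesis by (simp only: of_real_0 mult_zero_right exp_zero mult_1_right)
qed

lemma poch_powser:
  fixes z w :: complex
  assumes "norm w < 1"
  shows "(\<lambda>n. poch z n * w ^ n) sums ((1 - w) powr (- z))"
proof -
  have "(\<lambda>n. ((- z) gchoose n) * (- w) ^ n) sums (1 + (- w)) powr (- z)"
    by (rule gen_binomial_complex) (use assms in simp)
  moreover have "((- z) gchoose n) * (- w) ^ n = poch z n * w ^ n" for n
  proof -
    have "((- z) gchoose n) * (- w) ^ n = ((-1) ^ n * (-1) ^ n) * (poch z n * w ^ n)"
      unfolding gbinomial_pochhammer poch_def power_minus[of w] by (simp add: field_simps)
    also have "(-1) ^ n * (-1) ^ n = (1::complex)" by (simp flip: power_mult_distrib)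
    finally show ?thesis by simp
  qed
  ultimately show ?thesis by simp
qed

lemma poch_powser_norm:
  fixes z w :: complex
  assumes "norm w < 1"
  shows "summable (\<lambda>n. norm (poch z n * w ^ n))"
proof -
  obtain x where x: "norm w < x" "x < 1" using dense[OF assms] by blast
  then have "0 < x" using norm_ge_zero[of w] by linarith
  have "summable (\<lambda>n. poch z n * (of_real x) ^ n)"
    using poch_powser[of "of_real x" z] x \<open>0 < x\<close> by (auto simp: sums_iff)
  then show ?thesis by (rule powser_insidea) (use x \<open>0 < x\<close> in auto)
qed

text \<open>
  Coefficients that are small compared with those of \<open>(1 - x)\<^bsup>-\<sigma>\<^esup>\<close> give a sum that is small compared with
  \<open>(1 - x)\<^bsup>-\<sigma>\<^esup>\<close>: finitely many terms are negligible because \<open>\<sigma> > 0\<close>.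
\<close>
lemma abelian_little_o:
  fixes D :: "nat \<Rightarrow> complex" and \<sigma> :: real
  assumes \<sigma>: "\<sigma> > 0" and D: "(\<lambda>n. norm (D n) / poch \<sigma> n) \<longlonglongrightarrow> 0"
  shows "((\<lambda>x. of_real ((1 - x) powr \<sigma>) * (\<Sum>n. D n * of_real x ^ n)) \<longlongrightarrow> 0) (at_left 1)"
proof (rule tendstoI)
  fix e :: real assume e: "e > 0"
  have pos: "poch \<sigma> n > 0" for n using \<sigma> by (simp add: poch_def pochhammer_pos)
  have pc: "of_real (poch \<sigma> n) = poch (complex_of_real \<sigma>) n" for n
    by (simp add: poch_def pochhammer_of_real)
  have psum: "(\<lambda>n. poch \<sigma> n * x ^ n) sums ((1 - x) powr (- \<sigma>))" if "0 < x" "x < 1" for x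
  proof -
    have "(\<lambda>n. poch (complex_of_real \<sigma>) n * of_real x ^ n) sums ((1 - of_real x) powr (- of_real \<sigma>))"
      by (rule poch_powser) (use that in simp)
    also have "(1 - complex_of_real x) powr (- of_real \<sigma>) = of_real ((1 - x) powr (- \<sigma>))"
      using that powr_of_real[of "1 - x" "- \<sigma>"] by simp
    finally have "(\<lambda>n. complex_of_real (poch \<sigma> n * x ^ n)) sums of_real ((1 - x) powr (- \<sigma>))"
      by (simp add: pc)
    then show ?thesis by (simp only: sums_of_real_iff)
  qed
  have "eventually (\<lambda>n. norm (D n) / poch \<sigma> n < e / 2) sequentially"
    using D e by (intro order_tendstoD) auto
  then obtain N where N: "\<And>n. n \<ge> N \<Longrightarrow> norm (D n) / poch \<sigma> n < e / 2" by (auto simp: eventually_sequentially)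
  define C where "C = (\<Sum>n<N. norm (D n))"
  have bound: "norm (of_real ((1 - x) powr \<sigma>) * (\<Sum>n. D n * of_real x ^ n)) \<le> (1 - x) powr \<sigma> * C + e / 2"
    if x: "0 < x" "x < 1" for x
  proof -
    let ?d = "\<lambda>n. (if n < N then norm (D n) else 0) + e / 2 * (poch \<sigma> n * x ^ n)"
    have le: "norm (D n * of_real x ^ n) \<le> ?d n" for n
    proof (cases "n < N")
      case True
      have "norm (D n) * x ^ n \<le> norm (D n) * 1" using x by (intro mult_left_mono power_le_one) auto
      moreover have "0 \<le> e / 2 * (poch \<sigma> n * x ^ n)" using pos[of n] x e by (intro mult_nonneg_nonneg) auto
      ultimately show ?thesis using True x by (simp add: norm_mult norm_power)
    next
      case False
      then have "norm (D n) \<le> e / 2 * poch \<sigma> n" using N[of n] pos[of n] by (simp add: divide_less_eq less_imp_le)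
      then have "norm (D n) * x ^ n \<le> e / 2 * poch \<sigma> n * x ^ n" using x by (intro mult_right_mono) auto
      then show ?thesis using False x by (simp add: norm_mult norm_power mult.assoc)
    qed
    have s1: "(\<lambda>n. if n < N then norm (D n) else 0) sums C"
      unfolding C_def using sums_If_finite_set[of "{..<N}" "\<lambda>n. norm (D n)"] by simp
    have s: "?d sums (C + e / 2 * ((1 - x) powr (- \<sigma>)))"
      by (intro sums_add s1 sums_mult psum x)
    have sm: "summable (\<lambda>n. norm (D n * of_real x ^ n))"
      by (rule summable_comparison_test'[OF sums_summable[OF s], of 0]) (use le in simp)
    have "norm (\<Sum>n. D n * of_real x ^ n) \<le> (\<Sum>n. norm (D n * of_real x ^ n))" by (rule summable_norm[OF sm])
    also have "\<dots> \<le> (\<Sum>n. ?d n)" by (rule suminf_le[OF le sm sums_summable[OF s]])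
    also have "\<dots> = C + e / 2 * ((1 - x) powr (- \<sigma>))" using s by (simp add: sums_iff)
    finally have "(1 - x) powr \<sigma> * norm (\<Sum>n. D n * of_real x ^ n) \<le> (1 - x) powr \<sigma> * (C + e / 2 * ((1 - x) powr (- \<sigma>)))"
      by (intro mult_left_mono) auto
    also have "\<dots> = (1 - x) powr \<sigma> * C + e / 2 * ((1 - x) powr \<sigma> * (1 - x) powr (- \<sigma>))" by (simp add: algebra_simps)
    also have "(1 - x) powr \<sigma> * (1 - x) powr (- \<sigma>) = 1" using x by (simp flip: powr_add)
    finally show ?thesis by (simp add: norm_mult)
  qed
  have "((\<lambda>x. (1 - x) powr \<sigma>) \<longlongrightarrow> (1 - 1) powr \<sigma>) (at_left 1)"
    using \<sigma> by (intro tendsto_powr' tendsto_intros) (auto simp: eventually_at_left[of 0 1] intro!: disjI2 exI[of _ 0])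
  then have "((\<lambda>x. (1 - x) powr \<sigma> * C + e / 2) \<longlongrightarrow> 0 * C + e / 2) (at_left 1)"
    using \<sigma> by (intro tendsto_intros) auto
  from order_tendstoD(2)[OF this, of e] have "eventually (\<lambda>x. (1 - x) powr \<sigma> * C + e / 2 < e) (at_left 1)"
    using e by simp
  moreover have "eventually (\<lambda>x. x \<in> {0<..<1::real}) (at_left 1)"
    by (rule eventually_at_left_real) simp
  ultimately show "eventually (\<lambda>x. dist (of_real ((1 - x) powr \<sigma>) * (\<Sum>n. D n * of_real x ^ n)) 0 < e) (at_left 1)"
  proof eventually_elim
    case (elim x)
    then show ?case using bound[of x] by simp
  qed
qed

text \<open>
  The coefficients are asymptotic to \<open>\<Lambda> poch (a + b + 1) n\<close> with \<open>\<Lambda> = \<Gamma>(a + b + 1) / (\<Gamma>(a + 1) \<Gamma>(b + 1))\<close>, the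
  reciprocal of \<open>c_const a b\<close>. Since \<open>a + b + 1\<close> may be complex, the error is compared with the positive
  coefficients of exponent \<open>\<sigma> = Re (a + b + 1)\<close>.
\<close>
lemma abelian_poch:
  fixes a b :: complex
  assumes re: "Re a + Re b > -1"
    and a: "a + 1 \<notin> \<int>\<^sub>\<le>\<^sub>0" and b: "b + 1 \<notin> \<int>\<^sub>\<le>\<^sub>0"
  shows "((\<lambda>x. c_const a b * of_real (1 - x) powr (a + b + 1) * (\<Sum>n. poch (a + 1) (n + p) * poch (b + 1) (n + q) * of_real x ^ n)) \<longlongrightarrow> 1) (at_left 1)"
proof -
  define s where "s = a + b + 1"
  define \<sigma> where "\<sigma> = Re s"
  define \<Lambda> where "\<Lambda> = Gamma s * rGamma (a + 1) * rGamma (b + 1)"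
  define A where "A n = poch (a + 1) (n + p) * poch (b + 1) (n + q)" for n
  define D where "D n = A n - \<Lambda> * poch s n" for n
  define w where "w n = exp (- (s - 1) * of_real (ln (real n)))" for n
  have \<sigma>: "\<sigma> > 0" using re by (simp add: \<sigma>_def s_def)
  have s: "s \<notin> \<int>\<^sub>\<le>\<^sub>0" using \<sigma> by (auto simp: \<sigma>_def elim!: nonpos_Ints_cases)
  have \<sigma>': "complex_of_real \<sigma> \<notin> \<int>\<^sub>\<le>\<^sub>0" using \<sigma> by (auto simp: of_real_in_nonpos_Ints_iff elim!: nonpos_Ints_cases)
  have c: "c_const a b * \<Lambda> = 1"
  proof -
    have "Gamma (a + 1) \<noteq> 0" "Gamma (b + 1) \<noteq> 0" "Gamma s \<noteq> 0"
      using a b s unfolding Gamma_eq_zero_iff by auto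
    moreover have "c_const a b = Gamma (a + 1) * Gamma (b + 1) / Gamma s" by (simp add: c_const_def s_def)
    ultimately show ?thesis by (simp add: \<Lambda>_def rGamma_inverse_Gamma field_simps)
  qed
  have Aw: "(\<lambda>n. A n * w n) \<longlonglongrightarrow> rGamma (a + 1) * rGamma (b + 1)"
  proof -
    have "(\<lambda>n. (poch (a + 1) (n + p) * exp (- (a + 1 - 1) * of_real (ln (real n))))
        * (poch (b + 1) (n + q) * exp (- (b + 1 - 1) * of_real (ln (real n))))) \<longlonglongrightarrow> rGamma (a + 1) * rGamma (b + 1)"
      by (intro tendsto_mult poch_asymp)
    moreover have "(poch (a + 1) (n + p) * exp (- (a + 1 - 1) * of_real (ln (real n))))
        * (poch (b + 1) (n + q) * exp (- (b + 1 - 1) * of_real (ln (real n)))) = A n * w n" for n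
    proof -
      have "w n = exp (- (a + 1 - 1) * of_real (ln (real n))) * exp (- (b + 1 - 1) * of_real (ln (real n)))"
        unfolding w_def s_def by (simp add: algebra_simps flip: exp_add)
      then show ?thesis by (simp add: A_def)
    qed
    ultimately show ?thesis by simp
  qed
  have Bw: "(\<lambda>n. poch s n * w n) \<longlonglongrightarrow> rGamma s" unfolding w_def using poch_asymp[of s 0] by simp
  have "(\<lambda>n. A n * w n - \<Lambda> * (poch s n * w n)) \<longlonglongrightarrow> rGamma (a + 1) * rGamma (b + 1) - \<Lambda> * rGamma s"
    by (intro tendsto_intros Aw Bw)
  moreover have "\<Lambda> * rGamma s = rGamma (a + 1) * rGamma (b + 1)"
    using s by (simp add: \<Lambda>_def rGamma_inverse_Gamma Gamma_eq_zero_iff)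
  ultimately have "(\<lambda>n. D n * w n) \<longlonglongrightarrow> 0" by (simp add: D_def algebra_simps)
  then have Dw: "(\<lambda>n. norm (D n * w n)) \<longlonglongrightarrow> 0" by (rule tendsto_norm_zero)
  have nw: "norm (w n) = exp (- (\<sigma> - 1) * ln (real n))" for n
    by (simp add: w_def \<sigma>_def norm_exp_eq_Re)
  have pos: "poch \<sigma> n > 0" for n using \<sigma> by (simp add: poch_def pochhammer_pos)
  have "(\<lambda>n. norm (poch (complex_of_real \<sigma>) n * exp (- (complex_of_real \<sigma> - 1) * of_real (ln (real n))))) \<longlonglongrightarrow> norm (rGamma (complex_of_real \<sigma>))"
    using poch_asymp[of "complex_of_real \<sigma>" 0] by (intro tendsto_norm) simp
  moreover have "norm (poch (complex_of_real \<sigma>) n * exp (- (complex_of_real \<sigma> - 1) * of_real (ln (real n)))) = poch \<sigma> n * norm (w n)" for n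
  proof -
    have "poch (complex_of_real \<sigma>) n = of_real (poch \<sigma> n)" by (simp add: poch_def pochhammer_of_real)
    then have "norm (poch (complex_of_real \<sigma>) n) = poch \<sigma> n" using pos[of n] by (simp del: of_real_divide)
    then show ?thesis by (simp add: norm_mult norm_exp_eq_Re nw)
  qed
  ultimately have Pw: "(\<lambda>n. poch \<sigma> n * norm (w n)) \<longlonglongrightarrow> norm (rGamma (complex_of_real \<sigma>))" by simp
  have "(\<lambda>n. norm (D n * w n) / (poch \<sigma> n * norm (w n))) \<longlonglongrightarrow> 0 / norm (rGamma (complex_of_real \<sigma>))"
    using \<sigma>' by (intro tendsto_divide Dw Pw) (simp add: rGamma_eq_zero_iff)
  moreover have "norm (D n * w n) / (poch \<sigma> n * norm (w n)) = norm (D n) / poch \<sigma> n" for n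
    by (simp add: norm_mult w_def)
  ultimately have "(\<lambda>n. norm (D n) / poch \<sigma> n) \<longlonglongrightarrow> 0" by simp
  from abelian_little_o[OF \<sigma> this]
  have lim: "((\<lambda>x. of_real ((1 - x) powr \<sigma>) * (\<Sum>n. D n * of_real x ^ n)) \<longlongrightarrow> 0) (at_left 1)" .
  have summA: "summable (\<lambda>n. A n * of_real x ^ n)" if x: "0 < x" "x < 1" for x
  proof -
    have "(\<lambda>n. (A n * w n) / (poch s n * w n)) \<longlonglongrightarrow> rGamma (a + 1) * rGamma (b + 1) / rGamma s"
      using s by (intro tendsto_divide Aw Bw) (simp add: rGamma_eq_zero_iff)
    moreover have "(A n * w n) / (poch s n * w n) = A n / poch s n" for n
      by (simp add: w_def)
    ultimately have "Bseq (\<lambda>n. A n / poch s n)" by (intro convergent_imp_Bseq convergentI) simp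
    then obtain K where K: "\<And>n. norm (A n / poch s n) \<le> K" by (auto simp: Bseq_def)
    have "poch s n \<noteq> 0" for n using s by (auto simp: poch_def pochhammer_eq_0_iff)
    then have "norm (A n) \<le> K * norm (poch s n)" for n using K[of n] by (simp add: norm_divide divide_le_eq)
    then have "norm (A n) * x ^ n \<le> K * norm (poch s n) * x ^ n" for n using x by (intro mult_right_mono) auto
    then have le: "norm (A n * of_real x ^ n) \<le> K * norm (poch s n * of_real x ^ n)" for n
      using x by (simp add: norm_mult norm_power mult.assoc)
    have "summable (\<lambda>n. K * norm (poch s n * of_real x ^ n))"
      by (intro summable_mult poch_powser_norm) (use x in simp)
    from summable_comparison_test'[OF this le] show ?thesis .
  qed
  have "((\<lambda>x. of_real (1 - x) powr s * (\<Sum>n. D n * of_real x ^ n)) \<longlongrightarrow> 0) (at_left 1)"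
  proof (rule Lim_null_comparison)
    show "((\<lambda>x. norm (of_real ((1 - x) powr \<sigma>) * (\<Sum>n. D n * of_real x ^ n))) \<longlongrightarrow> 0) (at_left 1)"
      using lim by (rule tendsto_norm_zero)
    have "eventually (\<lambda>x. x \<in> {0<..<1::real}) (at_left 1)" by (rule eventually_at_left_real) simp
    then show "\<forall>\<^sub>F x in at_left 1. norm (of_real (1 - x) powr s * (\<Sum>n. D n * of_real x ^ n)) \<le> norm (of_real ((1 - x) powr \<sigma>) * (\<Sum>n. D n * of_real x ^ n))"
    proof eventually_elim
      case (elim x)
      then show ?case by (simp add: norm_mult norm_powr_real_powr \<sigma>_def del: of_real_diff)
    qed
  qed
  then have "((\<lambda>x. \<Lambda> + of_real (1 - x) powr s * (\<Sum>n. D n * of_real x ^ n)) \<longlongrightarrow> \<Lambda> + 0) (at_left 1)"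
    by (intro tendsto_intros)
  moreover have "eventually (\<lambda>x. \<Lambda> + of_real (1 - x) powr s * (\<Sum>n. D n * of_real x ^ n) = of_real (1 - x) powr s * (\<Sum>n. A n * of_real x ^ n)) (at_left 1)"
  proof -
    have "eventually (\<lambda>x. x \<in> {0<..<1::real}) (at_left 1)" by (rule eventually_at_left_real) simp
    then show ?thesis
    proof eventually_elim
      case (elim x)
      then have x: "0 < x" "x < 1" by auto
      have P: "(\<lambda>n. poch s n * of_real x ^ n) sums ((1 - of_real x) powr (- s))" by (rule poch_powser) (use x in simp)
      have "(\<lambda>n. A n * of_real x ^ n - \<Lambda> * (poch s n * of_real x ^ n)) sums ((\<Sum>n. A n * of_real x ^ n) - \<Lambda> * (1 - of_real x) powr (- s))"
        by (intro sums_diff sums_mult P summable_sums summA x)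
      then have "(\<Sum>n. D n * of_real x ^ n) = (\<Sum>n. A n * of_real x ^ n) - \<Lambda> * (1 - of_real x) powr (- s)"
        by (simp add: D_def sums_iff algebra_simps)
      moreover have "(1 - complex_of_real x) powr s * (1 - of_real x) powr (- s) = 1"
        using x by (simp flip: powr_add)
      ultimately show ?case by (simp add: right_diff_distrib mult.left_commute)
    qed
  qed
  ultimately have "((\<lambda>x. of_real (1 - x) powr s * (\<Sum>n. A n * of_real x ^ n)) \<longlongrightarrow> \<Lambda>) (at_left 1)"
    by (simp add: Lim_transform_eventually)
  then have "((\<lambda>x. c_const a b * (of_real (1 - x) powr s * (\<Sum>n. A n * of_real x ^ n))) \<longlongrightarrow> c_const a b * \<Lambda>) (at_left 1)"
    by (intro tendsto_intros)
  then show ?thesis by (simp add: c A_def s_def mult.assoc)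
qed

section \<open>The Poisson kernel in one variable\<close>

definition kernel_factor :: "complex \<Rightarrow> complex \<Rightarrow> complex \<Rightarrow> complex \<Rightarrow> complex" where
  "kernel_factor a b z w = c_const a b *
     (of_real (1 - (norm z)\<^sup>2) powr (a + b + 1) / ((1 - z * cnj w) powr (a + 1) * (1 - cnj z * w) powr (b + 1)))"

lemma poisson_kernel_eq:
  "poisson_kernel \<alpha> \<beta> z \<zeta> = (\<Prod>j\<in>UNIV. kernel_factor (\<alpha> $ j) (\<beta> $ j) (z $ j) (\<zeta> $ j))"
  by (simp add: poisson_kernel_def kernel_factor_def)

text \<open>
  The one-variable kernel at \<open>z = r e\<^bsup>it\<^esup>\<close>, \<open>\<zeta> = 1\<close>, with the powers merged into one exponential, which makes
  logarithmic differentiation immediate.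
\<close>
definition polar_kernel :: "complex \<Rightarrow> complex \<Rightarrow> real \<Rightarrow> real \<Rightarrow> complex" where
  "polar_kernel a b r t = c_const a b * exp ((a + b + 1) * Ln (1 - of_real r ^ 2)
     - (a + 1) * Ln (1 - of_real r * cis t) - (b + 1) * Ln (1 - of_real r * cis (- t)))"

lemma one_minus_not_nonpos: "norm (v::complex) < 1 \<Longrightarrow> 1 - v \<notin> \<real>\<^sub>\<le>\<^sub>0"
  using abs_Re_le_cmod[of v] by (auto simp: complex_nonpos_Reals_iff)

lemma one_minus_nonzero: "norm (v::complex) < 1 \<Longrightarrow> 1 - v \<noteq> 0"
  by auto

lemma strip_norms:
  fixes r :: real
  assumes "r \<in> {-1<..<1}"
  shows "norm (complex_of_real r ^ 2) < 1" "norm (of_real r * cis t) < 1"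
proof -
  have "\<bar>r\<bar> < 1" using assms by auto
  then have "r\<^sup>2 < 1" by (simp add: abs_square_less_1)
  then show "norm (complex_of_real r ^ 2) < 1" "norm (of_real r * cis t) < 1"
    using \<open>\<bar>r\<bar> < 1\<close> by (simp_all add: norm_power norm_mult)
qed

lemmas strip_nonpos = one_minus_not_nonpos[OF strip_norms(1)] one_minus_not_nonpos[OF strip_norms(2)]
lemmas strip_nonzero = one_minus_nonzero[OF strip_norms(1)] one_minus_nonzero[OF strip_norms(2)]

lemma kernel_factor_polar:
  assumes "0 \<le> r" "r < 1"
  shows "kernel_factor a b (of_real r * cis s) (cis t) = polar_kernel a b r (s - t)"
proof -
  have r: "r \<in> {-1<..<1}" using assms by auto
  have 1: "of_real r * cis s * cnj (cis t) = of_real r * cis (s - t)"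
    by (simp add: cis_cnj mult.assoc cis_mult)
  have 2: "cnj (of_real r * cis s) * cis t = of_real r * cis (- (s - t))"
    by (simp add: cis_cnj mult.assoc cis_mult)
  have 3: "complex_of_real (1 - (norm (of_real r * cis s))\<^sup>2) = 1 - of_real r ^ 2"
    by (simp add: norm_mult)
  show ?thesis
    unfolding kernel_factor_def polar_kernel_def 1 2 3 powr_def using strip_nonzero[OF r]
    by (simp add: exp_diff)
qed

text \<open>
  The algebraic content of \<open>L P = 0\<close>. For \<open>U = z / (1 - z)\<close>, its conjugate \<open>V\<close> and \<open>W = |z|\<^sup>2 / (1 - |z|\<^sup>2)\<close> the
  relation \<open>W (1 + U + V) = U V\<close> holds; \<open>g\<close> and \<open>\<i> h\<close> are the logarithmic derivatives of \<open>P\<close> under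
  \<open>r \<partial>\<^sub>r\<close> and \<open>\<partial>\<^sub>t\<close>.
\<close>
lemma kernel_identity:
  fixes a b U V W :: complex
  defines "s \<equiv> a + b + 1"
  defines "g \<equiv> - 2 * s * W + (a + 1) * U + (b + 1) * V"
    and "h \<equiv> (a + 1) * U - (b + 1) * V"
  assumes W: "W * (1 + U + V) = U * V"
  shows "1 / 4 * (g\<^sup>2 + (- 2 * s * (W * (1 + 2 * W)) + (a + 1) * U\<^sup>2 + (b + 1) * V\<^sup>2) + g
     - h\<^sup>2 - (a + 1) * (U + U\<^sup>2) - (b + 1) * (V + V\<^sup>2))
     + W * (a / 2 * (g + h) + b / 2 * (g - h) - a * b) = 0"
proof -
  have "1 / 4 * (g\<^sup>2 + (- 2 * s * (W * (1 + 2 * W)) + (a + 1) * U\<^sup>2 + (b + 1) * V\<^sup>2) + g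
     - h\<^sup>2 - (a + 1) * (U + U\<^sup>2) - (b + 1) * (V + V\<^sup>2))
     + W * (a / 2 * (g + h) + b / 2 * (g - h) - a * b) = (a + 1) * (b + 1) * (U * V - W * (1 + U + V))"
    unfolding s_def g_def h_def by (simp add: field_simps power2_eq_square)
  then show ?thesis using W by simp
qed

lemma DERIV_Ln_one_minus:
  assumes "(f has_field_derivative f') (at x)" "norm (f x) < 1"
  shows "((\<lambda>x. Ln (1 - f x)) has_field_derivative - (f' / (1 - f x))) (at x)"
  using assms one_minus_not_nonpos[OF assms(2)]
  by (auto intro!: derivative_eq_intros simp: field_simps)

text \<open>
  Differentiating \<open>P = c exp \<Lambda>\<close> twice leaves \<open>P\<close> times a rational function of \<open>r\<close> and \<open>e\<^bsup>it\<^esup>\<close>; the equation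
  then is \<open>kernel_identity\<close>.
\<close>
lemma polar_harmonic_polar_kernel: "polar_harmonic a b (polar_kernel a b)"
proof -
  define A where "A r t = 1 - complex_of_real r * cis t" for r t
  define Y where "Y r = 1 - complex_of_real r ^ 2" for r
  define s where "s = a + b + 1"
  define Gr where "Gr r t = - (s * (2 * of_real r / Y r)) + (a + 1) * (cis t / A r t) + (b + 1) * (cis (- t) / A r (- t))" for r t
  define Grr where "Grr r t = - (s * (2 * (1 + of_real r ^ 2) / Y r ^ 2)) + (a + 1) * (cis t ^ 2 / A r t ^ 2) + (b + 1) * (cis (- t) ^ 2 / A r (- t) ^ 2)" for r t
  define Ht where "Ht r t = \<i> * ((a + 1) * (of_real r * cis t / A r t) - (b + 1) * (of_real r * cis (- t) / A r (- t)))" for r t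
  define Htt where "Htt r t = - ((a + 1) * (of_real r * cis t / A r t ^ 2)) - (b + 1) * (of_real r * cis (- t) / A r (- t) ^ 2)" for r t
  have nz: "A r t \<noteq> 0" "Y r \<noteq> 0" if "r \<in> {-1<..<1}" for r t
    using strip_nonzero[OF that] by (auto simp: A_def Y_def)
  have cY: "continuous_on ({-1<..<1} \<times> UNIV) (\<lambda>x. Y (fst x))"
    and cA: "continuous_on ({-1<..<1} \<times> UNIV) (\<lambda>x. A (fst x) (snd x))"
      "continuous_on ({-1<..<1} \<times> UNIV) (\<lambda>x. A (fst x) (- snd x))"
    unfolding Y_def A_def by (intro continuous_intros)+
  have cF: "continuous_on ({-1<..<1} \<times> UNIV) (\<lambda>x. polar_kernel a b (fst x) (snd x))"
    unfolding polar_kernel_def by (intro continuous_intros) (use strip_nonpos in auto)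
  have cGr: "continuous_on ({-1<..<1} \<times> UNIV) (\<lambda>x. Gr (fst x) (snd x))"
    unfolding Gr_def by (intro continuous_intros cY cA) (use nz in auto)
  have cGrr: "continuous_on ({-1<..<1} \<times> UNIV) (\<lambda>x. Grr (fst x) (snd x))"
    unfolding Grr_def by (intro continuous_intros cY cA) (use nz in auto)
  have cHt: "continuous_on ({-1<..<1} \<times> UNIV) (\<lambda>x. Ht (fst x) (snd x))"
    unfolding Ht_def by (intro continuous_intros cY cA) (use nz in auto)
  have cHtt: "continuous_on ({-1<..<1} \<times> UNIV) (\<lambda>x. Htt (fst x) (snd x))"
    unfolding Htt_def by (intro continuous_intros cY cA) (use nz in auto)
  have dF: "((\<lambda>r. polar_kernel a b r t) has_vector_derivative polar_kernel a b r t * Gr r t) (at r)" if r: "r \<in> {-1<..<1}" for r t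
  proof -
    let ?L = "\<lambda>x. s * Ln (1 - x ^ 2) - (a + 1) * Ln (1 - x * cis t) - (b + 1) * Ln (1 - x * cis (- t))"
    have q: "((\<lambda>x. x ^ 2) has_field_derivative 2 * of_real r) (at (complex_of_real r))"
      by (auto intro!: derivative_eq_intros)
    have l: "((\<lambda>x. x * c) has_field_derivative c) (at (complex_of_real r))" for c
      by (auto intro!: derivative_eq_intros)
    have "(?L has_field_derivative s * - (2 * of_real r / (1 - of_real r ^ 2))
        - (a + 1) * - (cis t / (1 - of_real r * cis t)) - (b + 1) * - (cis (- t) / (1 - of_real r * cis (- t)))) (at (of_real r))"
      by (intro DERIV_diff DERIV_cmult DERIV_Ln_one_minus q l strip_norms[OF r])
    then have "(?L has_field_derivative Gr r t) (at (of_real r))"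
      by (rule DERIV_cong) (simp add: Gr_def A_def Y_def)
    from DERIV_cmult[OF DERIV_chain2[OF DERIV_exp this], of "c_const a b"]
    have "((\<lambda>x. c_const a b * exp (?L x)) has_field_derivative polar_kernel a b r t * Gr r t) (at (of_real r))"
      by (simp add: polar_kernel_def s_def mult.assoc)
    from has_vector_derivative_real_field[OF this] show ?thesis by (simp add: polar_kernel_def s_def)
  qed
  have dGr: "((\<lambda>r. Gr r t) has_vector_derivative Grr r t) (at r)" if r: "r \<in> {-1<..<1}" for r t
  proof -
    note n = strip_nonzero[OF r]
    have d1: "((\<lambda>x. 2 * x / (1 - x ^ 2)) has_field_derivative 2 * (1 + of_real r ^ 2) / (1 - of_real r ^ 2) ^ 2) (at (complex_of_real r))"
      using n(1) by (auto intro!: derivative_eq_intros simp: power2_eq_square)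
    have d2: "((\<lambda>x. c / (1 - x * c)) has_field_derivative c ^ 2 / (1 - of_real r * c) ^ 2) (at (complex_of_real r))"
      if "1 - of_real r * c \<noteq> 0" for c
      using that by (auto intro!: derivative_eq_intros simp: power2_eq_square)
    have "((\<lambda>x. - (s * (2 * x / (1 - x ^ 2))) + (a + 1) * (cis t / (1 - x * cis t)) + (b + 1) * (cis (- t) / (1 - x * cis (- t))))
       has_field_derivative Grr r t) (at (of_real r))"
      unfolding Grr_def Y_def A_def by (intro DERIV_add DERIV_minus DERIV_cmult d1 d2 n)
    from has_vector_derivative_real_field[OF this] show ?thesis by (simp add: Gr_def A_def Y_def)
  qed
  have E: "exp (\<i> * of_real t) = cis t" "exp (- \<i> * of_real t) = cis (- t)" for t
    by (simp_all add: cis_conv_exp)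
  have dFt: "((\<lambda>t. polar_kernel a b r t) has_vector_derivative polar_kernel a b r t * Ht r t) (at t)" if r: "r \<in> {-1<..<1}" for r t
  proof -
    let ?L = "\<lambda>x. s * Ln (1 - of_real r ^ 2) - (a + 1) * Ln (1 - of_real r * exp (\<i> * x)) - (b + 1) * Ln (1 - of_real r * exp (- \<i> * x))"
    have e: "((\<lambda>x. of_real r * exp (c * x)) has_field_derivative of_real r * (c * exp (c * of_real t))) (at (complex_of_real t))" for c
      by (auto intro!: derivative_eq_intros)
    have "(?L has_field_derivative 0 - (a + 1) * - (of_real r * (\<i> * exp (\<i> * of_real t)) / (1 - of_real r * exp (\<i> * of_real t)))
        - (b + 1) * - (of_real r * (- \<i> * exp (- \<i> * of_real t)) / (1 - of_real r * exp (- \<i> * of_real t)))) (at (of_real t))"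
      by (intro DERIV_diff DERIV_const DERIV_cmult DERIV_Ln_one_minus e) (simp_all only: E strip_norms[OF r])
    then have "(?L has_field_derivative Ht r t) (at (of_real t))"
      by (rule DERIV_cong) (simp add: Ht_def A_def E[simplified] algebra_simps)
    from DERIV_cmult[OF DERIV_chain2[OF DERIV_exp this], of "c_const a b"]
    have "((\<lambda>x. c_const a b * exp (?L x)) has_field_derivative polar_kernel a b r t * Ht r t) (at (of_real t))"
      by (simp add: polar_kernel_def s_def mult.assoc E[simplified])
    from has_vector_derivative_real_field[OF this] show ?thesis by (simp add: polar_kernel_def s_def E[simplified])
  qed
  have dHt: "((\<lambda>t. Ht r t) has_vector_derivative Htt r t) (at t)" if r: "r \<in> {-1<..<1}" for r t
  proof -
    note n = strip_nonzero(2)[OF r]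
    have d: "((\<lambda>x. of_real r * exp (c * x) / (1 - of_real r * exp (c * x))) has_field_derivative
        c * (of_real r * exp (c * of_real t) / (1 - of_real r * exp (c * of_real t)) ^ 2)) (at (complex_of_real t))"
      if "1 - of_real r * exp (c * of_real t) \<noteq> 0" for c
      using that by (auto intro!: derivative_eq_intros simp: power2_eq_square) (simp add: field_simps)
    have "((\<lambda>x. \<i> * ((a + 1) * (of_real r * exp (\<i> * x) / (1 - of_real r * exp (\<i> * x)))
          - (b + 1) * (of_real r * exp (- \<i> * x) / (1 - of_real r * exp (- \<i> * x)))))
       has_field_derivative \<i> * ((a + 1) * (\<i> * (of_real r * exp (\<i> * of_real t) / (1 - of_real r * exp (\<i> * of_real t)) ^ 2))
          - (b + 1) * (- \<i> * (of_real r * exp (- \<i> * of_real t) / (1 - of_real r * exp (- \<i> * of_real t)) ^ 2)))) (at (of_real t))"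
      by (intro DERIV_diff DERIV_cmult d) (simp_all only: E n not_False_eq_True)
    moreover have "\<i> * ((a + 1) * (\<i> * (of_real r * exp (\<i> * of_real t) / (1 - of_real r * exp (\<i> * of_real t)) ^ 2))
          - (b + 1) * (- \<i> * (of_real r * exp (- \<i> * of_real t) / (1 - of_real r * exp (- \<i> * of_real t)) ^ 2))) = Htt r t"
    proof -
      have "\<i> * ((a + 1) * (\<i> * u) - (b + 1) * (- \<i> * v)) = - ((a + 1) * u) - (b + 1) * v" for u v
        by (simp add: algebra_simps)
      then show ?thesis unfolding E Htt_def A_def .
    qed
    ultimately have "((\<lambda>x. \<i> * ((a + 1) * (of_real r * exp (\<i> * x) / (1 - of_real r * exp (\<i> * x)))
          - (b + 1) * (of_real r * exp (- \<i> * x) / (1 - of_real r * exp (- \<i> * x)))))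
       has_field_derivative Htt r t) (at (of_real t))" by (simp only:)
    from has_vector_derivative_real_field[OF this] show ?thesis unfolding E by (simp add: Ht_def A_def)
  qed
  have per: "polar_kernel a b r (t + 2 * pi) = polar_kernel a b r t" "Ht r (t + 2 * pi) = Ht r t" for r t
  proof -
    have c: "cis (t + 2 * pi) = cis t" "cis (- (t + 2 * pi)) = cis (- t)"
      by (simp_all add: complex_eq_iff cos_add sin_add cos_diff sin_diff minus_add)
    show "polar_kernel a b r (t + 2 * pi) = polar_kernel a b r t" "Ht r (t + 2 * pi) = Ht r t"
      unfolding polar_kernel_def Ht_def A_def c by simp_all
  qed
  have eq: "(1 - of_real r ^ 2) / 4 * (of_real r ^ 2 * (polar_kernel a b r t * (Gr r t ^ 2 + Grr r t)) + of_real r * (polar_kernel a b r t * Gr r t) + polar_kernel a b r t * (Ht r t ^ 2 + Htt r t))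
          + of_real r ^ 2 * (a / 2 * (of_real r * (polar_kernel a b r t * Gr r t) - \<i> * (polar_kernel a b r t * Ht r t))
             + b / 2 * (of_real r * (polar_kernel a b r t * Gr r t) + \<i> * (polar_kernel a b r t * Ht r t)) - a * b * polar_kernel a b r t) = 0"
    if r: "r \<in> {-1<..<1}" for r t
  proof -
    define x where "x = complex_of_real r"
    define P Q where "P = A r t" and "Q = A r (- t)"
    define e f where "e = cis t" and "f = cis (- t)"
    define U V W where "U = x * e / P" and "V = x * f / Q" and "W = x\<^sup>2 / Y r"
    have ef: "e * f = 1" by (simp add: e_def f_def cis_mult)
    have n: "P \<noteq> 0" "Q \<noteq> 0" "Y r \<noteq> 0" using nz[OF r] by (auto simp: P_def Q_def)
    have P: "P = 1 - x * e" and Q: "Q = 1 - x * f" and Yx: "Y r = 1 - x\<^sup>2"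
      by (auto simp: P_def Q_def A_def Y_def x_def e_def f_def)
    have U1: "1 + U = 1 / P" and V1: "1 + V = 1 / Q" using n by (simp_all add: U_def V_def field_simps P Q)
    have YW: "Y r * W = x\<^sup>2" using n by (simp add: W_def)
    have W1: "1 + W = 1 / Y r" using n by (simp add: W_def field_simps Yx)
    have "1 + U + V = Y r / (P * Q)"
    proof -
      have "1 + U + V = (P * Q + x * e * Q + x * f * P) / (P * Q)" using n by (simp add: U_def V_def field_simps)
      also have "P * Q + x * e * Q + x * f * P = 1 - x\<^sup>2 * (e * f)" unfolding P Q by (simp add: algebra_simps power2_eq_square)
      finally show ?thesis by (simp add: ef Yx)
    qed
    moreover have "U * V = x\<^sup>2 * (e * f) / (P * Q)" by (simp add: U_def V_def power2_eq_square)
    ultimately have WUV: "W * (1 + U + V) = U * V" using n by (simp add: ef W_def)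
    define g where "g = - 2 * s * W + (a + 1) * U + (b + 1) * V"
    define h where "h = (a + 1) * U - (b + 1) * V"
    have xG: "x * Gr r t = g"
      unfolding Gr_def g_def U_def V_def W_def by (simp add: x_def[symmetric] e_def[symmetric] f_def[symmetric] P_def[symmetric] Q_def[symmetric] algebra_simps power2_eq_square)
    have xGrr: "x\<^sup>2 * Grr r t = - 2 * s * (W * (1 + 2 * W)) + (a + 1) * U\<^sup>2 + (b + 1) * V\<^sup>2"
    proof -
      have "1 + 2 * W = (1 + x\<^sup>2) / Y r" using n by (simp add: W_def field_simps Yx)
      then have "W * (1 + 2 * W) = x\<^sup>2 * ((1 + x\<^sup>2) / Y r ^ 2)" by (simp add: W_def power2_eq_square)
      then show ?thesis
        unfolding Grr_def U_def V_def
        by (simp add: x_def[symmetric] e_def[symmetric] f_def[symmetric] P_def[symmetric] Q_def[symmetric] algebra_simps power_divide power_mult_distrib add_divide_distrib diff_divide_distrib)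
    qed
    have H: "Ht r t = \<i> * h"
      unfolding Ht_def h_def U_def V_def by (simp add: x_def[symmetric] e_def[symmetric] f_def[symmetric] P_def[symmetric] Q_def[symmetric])
    have Htt: "Htt r t = - ((a + 1) * (U + U\<^sup>2)) - (b + 1) * (V + V\<^sup>2)"
    proof -
      have "U + U\<^sup>2 = U * (1 + U)" "V + V\<^sup>2 = V * (1 + V)" by (simp_all add: power2_eq_square algebra_simps)
      then have "U + U\<^sup>2 = x * e / P\<^sup>2" "V + V\<^sup>2 = x * f / Q\<^sup>2"
        unfolding U1 V1 by (simp_all add: U_def V_def power2_eq_square)
      then show ?thesis
        unfolding Htt_def by (simp add: x_def[symmetric] e_def[symmetric] f_def[symmetric] P_def[symmetric] Q_def[symmetric])
    qed
    define T where "T = 1 / 4 * (g\<^sup>2 + x\<^sup>2 * Grr r t + g - h\<^sup>2 + Htt r t) + W * (a / 2 * (g + h) + b / 2 * (g - h) - a * b)"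
    have T: "T = 0"
      unfolding T_def xGrr Htt using kernel_identity[OF WUV, of a b, folded s_def, folded g_def h_def]
      by (simp add: algebra_simps)
    have i2: "\<i> * (\<i> * h) = - h" "(\<i> * h)\<^sup>2 = - h\<^sup>2" by (simp_all add: power_mult_distrib)
    have "(1 - x ^ 2) / 4 * (x ^ 2 * (K * (Gr r t ^ 2 + Grr r t)) + x * (K * Gr r t) + K * (Ht r t ^ 2 + Htt r t))
          + x ^ 2 * (a / 2 * (x * (K * Gr r t) - \<i> * (K * Ht r t))
             + b / 2 * (x * (K * Gr r t) + \<i> * (K * Ht r t)) - a * b * K) = K * (Y r * T)" for K
    proof -
      have "(1 - x ^ 2) / 4 * (x ^ 2 * (K * (Gr r t ^ 2 + Grr r t)) + x * (K * Gr r t) + K * (Ht r t ^ 2 + Htt r t))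
          + x ^ 2 * (a / 2 * (x * (K * Gr r t) - \<i> * (K * Ht r t))
             + b / 2 * (x * (K * Gr r t) + \<i> * (K * Ht r t)) - a * b * K)
        = K * (Y r / 4 * ((x * Gr r t)\<^sup>2 + x\<^sup>2 * Grr r t + x * Gr r t + Ht r t ^ 2 + Htt r t)
          + x\<^sup>2 * (a / 2 * (x * Gr r t - \<i> * Ht r t) + b / 2 * (x * Gr r t + \<i> * Ht r t) - a * b))"
        unfolding Yx by (simp add: algebra_simps power_mult_distrib)
      also have "\<dots> = K * (Y r * T)"
        unfolding xG H i2 T_def YW[symmetric] by (simp add: algebra_simps)
      finally show ?thesis .
    qed
    then show ?thesis unfolding T x_def by simp
  qed
  have Frr: "((\<lambda>r. polar_kernel a b r t * Gr r t) has_vector_derivative polar_kernel a b r t * (Gr r t ^ 2 + Grr r t)) (at r)" if r: "r \<in> {-1<..<1}" for r t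
    using has_vector_derivative_mult[OF dF[OF r] dGr[OF r]] by (simp add: power2_eq_square algebra_simps)
  have Ftt: "((\<lambda>t. polar_kernel a b r t * Ht r t) has_vector_derivative polar_kernel a b r t * (Ht r t ^ 2 + Htt r t)) (at t)" if r: "r \<in> {-1<..<1}" for r t
    using has_vector_derivative_mult[OF dFt[OF r] dHt[OF r]] by (simp add: power2_eq_square algebra_simps)
  show ?thesis
    unfolding polar_harmonic_def
  proof (rule exI[of _ "\<lambda>r t. polar_kernel a b r t * Gr r t"], rule exI[of _ "\<lambda>r t. polar_kernel a b r t * (Gr r t ^ 2 + Grr r t)"],
      rule exI[of _ "\<lambda>r t. polar_kernel a b r t * Ht r t"], rule exI[of _ "\<lambda>r t. polar_kernel a b r t * (Ht r t ^ 2 + Htt r t)"],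
      intro conjI ballI allI)
    fix G assume "G \<in> {polar_kernel a b, \<lambda>r t. polar_kernel a b r t * Gr r t, \<lambda>r t. polar_kernel a b r t * (Gr r t ^ 2 + Grr r t),
        \<lambda>r t. polar_kernel a b r t * Ht r t, \<lambda>r t. polar_kernel a b r t * (Ht r t ^ 2 + Htt r t)}"
    then consider "G = polar_kernel a b" | "G = (\<lambda>r t. polar_kernel a b r t * Gr r t)" | "G = (\<lambda>r t. polar_kernel a b r t * (Gr r t ^ 2 + Grr r t))"
      | "G = (\<lambda>r t. polar_kernel a b r t * Ht r t)" | "G = (\<lambda>r t. polar_kernel a b r t * (Ht r t ^ 2 + Htt r t))" by blast
    then show "continuous_on ({-1<..<1} \<times> UNIV) (\<lambda>(r, t). G r t)"
      unfolding split_beta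
      by cases (simp_all only:, (intro continuous_intros cF cGr cGrr cHt cHtt)+)
  qed (use dF Frr dFt Ftt per eq in \<open>auto\<close>)
qed

lemma mode_sums:
  fixes c :: "nat \<Rightarrow> complex" and e :: "nat \<Rightarrow> int"
  assumes c: "summable (\<lambda>n. norm (c n))" and g: "continuous_on UNIV g"
  shows "(\<lambda>n. c n * mode (k + e n) g) sums mode k (\<lambda>t. (\<Sum>n. c n * cis (of_int (e n) * t)) * g t)"
proof -
  define h where "h t = g t * cis (of_int k * t)" for t
  have ch: "continuous_on {0..2 * pi} h"
    unfolding h_def by (intro continuous_intros continuous_on_subset[OF g]) auto
  have "bounded (h ` {0..2 * pi})" by (intro compact_imp_bounded compact_continuous_image ch compact_Icc)
  then obtain B where "\<forall>y\<in>h ` {0..2 * pi}. norm y \<le> B" by (auto simp: bounded_iff)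
  then have B: "norm (h t) \<le> B" if "t \<in> {0..2 * pi}" for t using that by blast
  let ?f = "\<lambda>n t. c n * cis (of_int (e n) * t) * h t"
  have u: "uniform_limit {0..2 * pi} (\<lambda>N t. \<Sum>n<N. ?f n t) (\<lambda>t. \<Sum>n. ?f n t) sequentially"
  proof (rule Weierstrass_m_test)
    show "summable (\<lambda>n. norm (c n) * B)" using c by (rule summable_mult2)
    show "norm (?f n t) \<le> norm (c n) * B" if "t \<in> {0..2 * pi}" for n t
      using B[OF that] by (simp add: norm_mult mult_left_mono)
  qed
  have cf: "continuous_on {0..2 * pi} (\<lambda>t. \<Sum>n<N. ?f n t)" for N
    by (intro continuous_intros ch)
  obtain I J where I: "\<And>N. ((\<lambda>t. \<Sum>n<N. ?f n t) has_integral I N) {0..2 * pi}"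
    and J: "((\<lambda>t. \<Sum>n. ?f n t) has_integral J) {0..2 * pi}" and lim: "I \<longlonglongrightarrow> J"
    by (rule uniform_limit_integral[OF u cf]) auto
  have f_eq: "?f n t = c n * (g t * cis (of_int (k + e n) * t))" for n t
  proof -
    have "cis (of_int (k + e n) * t) = cis (of_int k * t) * cis (of_int (e n) * t)"
      by (simp add: cis_mult distrib_right)
    then show ?thesis by (simp add: h_def mult_ac)
  qed
  have H: "((\<lambda>t. \<Sum>n<N. ?f n t) has_integral (\<Sum>n<N. c n * mode (k + e n) g)) {0..2 * pi}" for N
    unfolding f_eq mode_def
    by (intro has_integral_sum has_integral_mult_right integrable_integral integrable_continuous_interval continuous_intros
        continuous_on_subset[OF g]) auto
  have "I = (\<lambda>N. \<Sum>n<N. c n * mode (k + e n) g)" by (rule ext) (rule has_integral_unique[OF I H])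
  moreover have "J = mode k (\<lambda>t. (\<Sum>n. c n * cis (of_int (e n) * t)) * g t)"
  proof -
    have "(\<Sum>n. ?f n t) = (\<Sum>n. c n * cis (of_int (e n) * t)) * g t * cis (of_int k * t)" for t
    proof -
      have "summable (\<lambda>n. c n * cis (of_int (e n) * t))"
        by (rule summable_norm_cancel) (use c in \<open>simp add: norm_mult\<close>)
      from suminf_mult2[OF this, of "h t"] show ?thesis by (simp add: h_def mult.assoc)
    qed
    then show ?thesis using integral_unique[OF J] by (simp add: mode_def)
  qed
  ultimately show ?thesis using lim by (simp add: sums_def)
qed

lemma mode_const: "mode k (\<lambda>_. 1) = (if k = 0 then 2 * pi else 0)"
proof (cases "k = 0")
  case True
  then show ?thesis by (simp add: mode_def scaleR_conv_of_real)
next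
  case False
  have "mode k (\<lambda>_. 0) = - \<i> * of_int k * mode k (\<lambda>_. 1)"
    by (rule mode_by_parts) auto
  then show ?thesis using False by (simp add: mode_def)
qed

lemma mode_power_series:
  fixes d :: "nat \<Rightarrow> complex"
  assumes "summable (\<lambda>n. norm (d n))"
  shows "mode m (\<lambda>t. \<Sum>l. d l * cis (- of_nat l * t)) = (if 0 \<le> m then 2 * pi * d (nat m) else 0)"
proof -
  have "(\<lambda>l. d l * mode (m + - int l) (\<lambda>_. 1)) sums mode m (\<lambda>t. (\<Sum>l. d l * cis (of_int (- int l) * t)) * 1)"
    by (rule mode_sums[OF assms]) auto
  moreover have "(\<lambda>l. d l * mode (m + - int l) (\<lambda>_. 1)) = (\<lambda>l. if l = nat m then (if 0 \<le> m then 2 * pi * d (nat m) else 0) else 0)"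
    by (auto simp: mode_const fun_eq_iff)
  ultimately have "(\<lambda>l. if l = nat m then (if 0 \<le> m then 2 * pi * d (nat m) else 0) else 0) sums mode m (\<lambda>t. \<Sum>l. d l * cis (- of_nat l * t))"
    by simp
  with sums_single[of "nat m" "\<lambda>_. if 0 \<le> m then 2 * pi * d (nat m) else 0"] show ?thesis
    by (rule sums_unique2[symmetric])
qed

text \<open>
  Multiply the binomial series in \<open>r e\<^bsup>it\<^esup>\<close> and in \<open>r e\<^bsup>-it\<^esup>\<close> and collect one frequency. The shifts \<open>p\<close> and
  \<open>q\<close>, of which at most one is nonzero, treat both signs of \<open>k\<close> together.
\<close>
lemma mode_polar_kernel:
  fixes k :: int
  assumes r: "0 \<le> r" "r < 1"
  defines "p \<equiv> nat (- k)" and "q \<equiv> nat k"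
  shows "mode k (polar_kernel a b r) / (2 * pi) = of_real r ^ (p + q) *
    (c_const a b * of_real (1 - r\<^sup>2) powr (a + b + 1) * (\<Sum>n. poch (a + 1) (n + p) * poch (b + 1) (n + q) * of_real (r\<^sup>2) ^ n))"
proof -
  have r': "r \<in> {-1<..<1}" using r by auto
  define K where "K = c_const a b * of_real (1 - r\<^sup>2) powr (a + b + 1)"
  define c where "c n = poch (a + 1) n * of_real r ^ n" for n
  define d where "d n = poch (b + 1) n * of_real r ^ n" for n
  have nr: "norm (complex_of_real r) < 1" using r by simp
  have c: "summable (\<lambda>n. norm (c n))" and d: "summable (\<lambda>n. norm (d n))"
    unfolding c_def d_def by (rule poch_powser_norm[OF nr])+
  define g where "g t = (1 - of_real r * cis (- t)) powr (- (b + 1))" for t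
  have cg: "continuous_on UNIV g"
    unfolding g_def
  proof (rule continuous_on_powr_complex)
    have "0 \<le> Re (1 - of_real r * cis (- t)) \<or> Im (1 - of_real r * cis (- t)) \<noteq> 0" for t
      using strip_nonpos(2)[OF r', of "- t"] unfolding complex_nonpos_Reals_iff by linarith
    then show "UNIV \<subseteq> {t. 0 \<le> Re (1 - of_real r * cis (- t)) \<or> Im (1 - of_real r * cis (- t)) \<noteq> 0}" by blast
    show "0 < Re (- (b + 1))" if "1 - of_real r * cis (- t) = 0" for t
      using strip_nonzero(2)[OF r', of "- t"] that by blast
  qed (intro continuous_intros)+
  have g: "g = (\<lambda>t. \<Sum>l. d l * cis (- of_nat l * t))"
  proof
    fix t
    have "(\<lambda>n. poch (b + 1) n * (of_real r * cis (- t)) ^ n) sums g t"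
      unfolding g_def by (rule poch_powser) (rule strip_norms(2)[OF r'])
    moreover have "poch (b + 1) n * (of_real r * cis (- t)) ^ n = d n * cis (- of_nat n * t)" for n
      using Complex.DeMoivre[of "- t" n] by (simp add: d_def power_mult_distrib)
    ultimately show "g t = (\<Sum>l. d l * cis (- of_nat l * t))" by (simp add: sums_iff)
  qed
  have A: "(1 - of_real r * cis t) powr (- (a + 1)) = (\<Sum>n. c n * cis (of_int (int n) * t))" for t
  proof -
    have "(\<lambda>n. poch (a + 1) n * (of_real r * cis t) ^ n) sums ((1 - of_real r * cis t) powr (- (a + 1)))"
      by (rule poch_powser) (rule strip_norms(2)[OF r'])
    moreover have "poch (a + 1) n * (of_real r * cis t) ^ n = c n * cis (of_int (int n) * t)" for n
      using Complex.DeMoivre[of t n] by (simp add: c_def power_mult_distrib)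
    ultimately show ?thesis by (simp add: sums_iff)
  qed
  have polar_kernel: "polar_kernel a b r t = K * ((\<Sum>n. c n * cis (of_int (int n) * t)) * g t)" for t
  proof -
    have "complex_of_real (1 - r\<^sup>2) powr (a + b + 1) = exp ((a + b + 1) * Ln (1 - of_real r ^ 2))"
      using strip_nonzero(1)[OF r'] by (simp add: powr_def)
    moreover have "exp (x - y - z) = exp x * (exp (- y) * exp (- z))" for x y z :: complex
      by (simp add: exp_diff exp_minus divide_inverse)
    moreover have "(1 - of_real r * cis u) powr (- d) = exp (- (d * Ln (1 - of_real r * cis u)))" for u d
      using strip_nonzero(2)[OF r', of u] by (simp add: powr_def)
    ultimately show ?thesis
      unfolding A[symmetric] g_def K_def polar_kernel_def by (simp only: mult.assoc)
  qed
  have "(\<lambda>n. c n * mode (k + int n) g) sums mode k (\<lambda>t. (\<Sum>n. c n * cis (of_int (int n) * t)) * g t)"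
    by (rule mode_sums[OF c cg])
  then have s: "(\<lambda>n. c n * (if 0 \<le> k + int n then 2 * pi * d (nat (k + int n)) else 0)) sums mode k (\<lambda>t. (\<Sum>n. c n * cis (of_int (int n) * t)) * g t)"
    unfolding mode_power_series[OF d, folded g] .
  have "(\<lambda>n. c (n + p) * (if 0 \<le> k + int (n + p) then 2 * pi * d (nat (k + int (n + p))) else 0)) sums mode k (\<lambda>t. (\<Sum>n. c n * cis (of_int (int n) * t)) * g t)"
    by (subst sums_zero_iff_shift[where f = "\<lambda>n. c n * (if 0 \<le> k + int n then 2 * pi * d (nat (k + int n)) else 0)"])
       (use s in \<open>auto simp: p_def\<close>)
  moreover have "c (n + p) * (if 0 \<le> k + int (n + p) then 2 * pi * d (nat (k + int (n + p))) else 0)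
      = (2 * pi * of_real r ^ (p + q)) * (poch (a + 1) (n + p) * poch (b + 1) (n + q) * of_real (r\<^sup>2) ^ n)" for n
  proof -
    have E: "k + int (n + p) = int (n + q)" by (simp add: p_def q_def)
    have "(if 0 \<le> k + int (n + p) then 2 * pi * d (nat (k + int (n + p))) else 0) = 2 * pi * d (n + q)" unfolding E nat_int by simp
    moreover have "complex_of_real r ^ (n + p) * of_real r ^ (n + q) = of_real r ^ (p + q) * of_real (r\<^sup>2) ^ n"
    proof -
      have "complex_of_real r ^ n * of_real r ^ n = of_real (r\<^sup>2) ^ n"
        by (simp add: power2_eq_square power_mult_distrib)
      moreover have "complex_of_real r ^ (n + p) * of_real r ^ (n + q) = of_real r ^ (p + q) * (complex_of_real r ^ n * of_real r ^ n)"
        by (simp add: power_add mult_ac)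
      ultimately show ?thesis by (simp only:)
    qed
    ultimately show ?thesis unfolding c_def d_def by (simp add: mult_ac)
  qed
  ultimately have S: "(\<lambda>n. (2 * pi * of_real r ^ (p + q)) * (poch (a + 1) (n + p) * poch (b + 1) (n + q) * of_real (r\<^sup>2) ^ n)) sums mode k (\<lambda>t. (\<Sum>n. c n * cis (of_int (int n) * t)) * g t)"
    by simp
  have mk: "mode k (polar_kernel a b r) = K * mode k (\<lambda>t. (\<Sum>n. c n * cis (of_int (int n) * t)) * g t)"
    unfolding mode_def polar_kernel by (simp add: mult.assoc)
  show ?thesis
  proof (cases "r = 0 \<and> p + q > 0")
    case True
    then have z: "r ^ (p + q) = 0" "complex_of_real r ^ (p + q) = 0" by auto
    have "(\<lambda>n. (2 * pi * of_real r ^ (p + q)) * (poch (a + 1) (n + p) * poch (b + 1) (n + q) * of_real (r\<^sup>2) ^ n)) = (\<lambda>n. 0)"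
      using True by (auto simp: power_0_left fun_eq_iff)
    with S have "(\<lambda>n. 0) sums mode k (\<lambda>t. (\<Sum>n. c n * cis (of_int (int n) * t)) * g t)" by (simp only:)
    then have "mode k (\<lambda>t. (\<Sum>n. c n * cis (of_int (int n) * t)) * g t) = 0"
      by (rule sums_unique2[OF _ sums_zero])
    then show ?thesis unfolding mk z by (simp only: mult_zero_right mult_zero_left div_0)
  next
    case False
    then have nz: "2 * pi * complex_of_real r ^ (p + q) \<noteq> 0" by auto
    from S have "summable (\<lambda>n. poch (a + 1) (n + p) * poch (b + 1) (n + q) * of_real (r\<^sup>2) ^ n)"
      using summable_cmult_iff[of "2 * pi * complex_of_real r ^ (p + q)"] nz by (auto simp: sums_iff)
    then have "mode k (\<lambda>t. (\<Sum>n. c n * cis (of_int (int n) * t)) * g t) = (2 * pi * of_real r ^ (p + q)) * (\<Sum>n. poch (a + 1) (n + p) * poch (b + 1) (n + q) * of_real (r\<^sup>2) ^ n)"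
      using S by (simp only: sums_iff suminf_mult)
    then show ?thesis unfolding mk K_def by simp
  qed
qed

lemma mode_polar_kernel_tendsto:
  assumes re: "Re a + Re b > -1"
    and a: "a + 1 \<notin> \<int>\<^sub>\<le>\<^sub>0" and b: "b + 1 \<notin> \<int>\<^sub>\<le>\<^sub>0"
  shows "((\<lambda>r. mode k (polar_kernel a b r) / (2 * pi)) \<longlongrightarrow> 1) (at_left 1)"
proof -
  define p q where "p = nat (- k)" and "q = nat k"
  have ev: "eventually (\<lambda>x. x \<in> {0<..<1::real}) (at_left 1)" by (rule eventually_at_left_real) simp
  have "filterlim (\<lambda>r::real. r\<^sup>2) (at_left 1) (at_left 1)"
  proof (rule filterlim_at_withinI)
    have "((\<lambda>r::real. r\<^sup>2) \<longlongrightarrow> 1\<^sup>2) (at_left 1)" by (intro tendsto_intros)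
    then show "((\<lambda>r::real. r\<^sup>2) \<longlongrightarrow> 1) (at_left 1)" by simp
    show "eventually (\<lambda>r::real. r\<^sup>2 \<in> {..<1} - {1}) (at_left 1)"
      using ev by eventually_elim (auto simp: abs_square_less_1 abs_square_eq_1)
  qed
  from filterlim_compose[OF abelian_poch[OF re a b, of p q] this]
  have "((\<lambda>r. of_real r ^ (p + q) * (c_const a b * of_real (1 - r\<^sup>2) powr (a + b + 1) * (\<Sum>n. poch (a + 1) (n + p) * poch (b + 1) (n + q) * of_real (r\<^sup>2) ^ n)))
     \<longlongrightarrow> of_real 1 ^ (p + q) * 1) (at_left 1)"
    by (intro tendsto_intros)
  moreover have "eventually (\<lambda>r. of_real r ^ (p + q) * (c_const a b * of_real (1 - r\<^sup>2) powr (a + b + 1) * (\<Sum>n. poch (a + 1) (n + p) * poch (b + 1) (n + q) * of_real (r\<^sup>2) ^ n)) = mode k (polar_kernel a b r) / (2 * pi)) (at_left 1)"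
    using ev
  proof eventually_elim
    case (elim r)
    then show ?case using mode_polar_kernel[of r k a b] by (simp add: p_def q_def)
  qed
  ultimately show ?thesis by (simp add: Lim_transform_eventually)
qed

section \<open>Slices of separately harmonic functions\<close>

text \<open>
  Write \<open>g(p, q) - g(0, q)\<close> as the integral of \<open>gp\<close>, differentiate in \<open>q\<close> under the integral sign and then in
  \<open>p\<close> at the end point.
\<close>
lemma mixed_partials_commute:
  fixes g gp gq a b :: "real \<Rightarrow> real \<Rightarrow> complex"
  assumes \<delta>: "\<delta> > 0"
    and gp: "\<And>p q. p \<in> {-\<delta><..<\<delta>} \<Longrightarrow> q \<in> {-\<delta><..<\<delta>} \<Longrightarrow> ((\<lambda>p. g p q) has_vector_derivative gp p q) (at p)"
    and gq: "\<And>p q. p \<in> {-\<delta><..<\<delta>} \<Longrightarrow> q \<in> {-\<delta><..<\<delta>} \<Longrightarrow> ((\<lambda>q. g p q) has_vector_derivative gq p q) (at q)"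
    and a: "\<And>p q. p \<in> {-\<delta><..<\<delta>} \<Longrightarrow> q \<in> {-\<delta><..<\<delta>} \<Longrightarrow> ((\<lambda>q. gp p q) has_vector_derivative a p q) (at q)"
    and b: "\<And>p q. p \<in> {-\<delta><..<\<delta>} \<Longrightarrow> q \<in> {-\<delta><..<\<delta>} \<Longrightarrow> ((\<lambda>p. gq p q) has_vector_derivative b p q) (at p)"
    and cgp: "continuous_on ({-\<delta><..<\<delta>} \<times> {-\<delta><..<\<delta>}) (\<lambda>(p, q). gp p q)"
    and ca: "continuous_on ({-\<delta><..<\<delta>} \<times> {-\<delta><..<\<delta>}) (\<lambda>(p, q). a p q)"
  shows "a 0 0 = b 0 0"
proof -
  let ?U = "{-\<delta><..<\<delta>}"
  define c where "c = \<delta> / 2"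
  have c: "0 < c" "c < \<delta>" "{0..c} \<subseteq> ?U" using \<delta> by (auto simp: c_def)
  have 0: "0 \<in> ?U" using \<delta> by simp
  have slice: "continuous_on {0..p} (\<lambda>s. h s q)" if h: "continuous_on (?U \<times> ?U) (\<lambda>(p, q). h p q)" and p: "p \<le> c" and q: "q \<in> ?U"
    for h :: "real \<Rightarrow> real \<Rightarrow> complex" and p q
  proof -
    have "continuous_on {0..p} (\<lambda>s. (\<lambda>(p, q). h p q) (s, q))"
      by (rule continuous_on_compose2[OF h, where f = "\<lambda>s. (s, q)"])
         (use p q c in \<open>auto intro: continuous_on_Pair continuous_on_const continuous_on_id\<close>)
    then show ?thesis by simp
  qed
  have eq: "gq p 0 = gq 0 0 + integral {0..p} (\<lambda>s. a s 0)" if p: "p \<in> {0..c}" for p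
  proof -
    have pU: "p \<in> ?U" using p c by auto
    have ftc: "integral {0..p} (\<lambda>s. gp s q) = g p q - g 0 q" if q: "q \<in> ?U" for q
    proof (rule integral_unique, rule fundamental_theorem_of_calculus)
      show "0 \<le> p" using p by simp
      show "((\<lambda>s. g s q) has_vector_derivative gp s q) (at s within {0..p})" if "s \<in> {0..p}" for s
        by (rule has_vector_derivative_at_within, rule gp) (use that p c q in auto)
    qed
    have "((\<lambda>q. integral (cbox 0 p) (\<lambda>s. gp s q)) has_vector_derivative integral (cbox 0 p) (\<lambda>s. a s 0)) (at 0 within ?U)"
    proof (rule leibniz_rule_vector_derivative)
      show "((\<lambda>q. gp s q) has_vector_derivative a s q) (at q within ?U)" if "q \<in> ?U" "s \<in> cbox 0 p" for q s
        by (rule has_vector_derivative_at_within, rule a) (use that p c in auto)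
      show "(\<lambda>s. gp s q) integrable_on cbox 0 p" if "q \<in> ?U" for q
        using slice[OF cgp _ that, of p] p by (auto intro: integrable_continuous_interval)
      have "continuous_on (?U \<times> cbox 0 p) (\<lambda>x. (\<lambda>(p, q). a p q) (snd x, fst x))"
        by (rule continuous_on_compose2[OF ca, where f = "\<lambda>x. (snd x, fst x)"])
           (use p c in \<open>auto intro!: continuous_intros\<close>)
      then show "continuous_on (?U \<times> cbox 0 p) (\<lambda>(q, s). a s q)" by (simp add: split_beta)
    qed (use \<delta> in \<open>auto simp: convex_real_interval\<close>)
    moreover have "at 0 within ?U = at 0" using 0 by (intro at_within_open) auto
    ultimately have d1: "((\<lambda>q. integral {0..p} (\<lambda>s. gp s q)) has_vector_derivative integral {0..p} (\<lambda>s. a s 0)) (at 0)"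
      by simp
    have "((\<lambda>q. g p q - g 0 q) has_vector_derivative integral {0..p} (\<lambda>s. a s 0)) (at 0)"
      by (rule has_vector_derivative_transform_within_open[OF d1, of ?U]) (use 0 ftc in auto)
    moreover have "((\<lambda>q. g p q - g 0 q) has_vector_derivative gq p 0 - gq 0 0) (at 0)"
      by (intro has_vector_derivative_diff gq pU 0)
    ultimately have "gq p 0 - gq 0 0 = integral {0..p} (\<lambda>s. a s 0)" by (rule vector_derivative_unique_at[symmetric])
    then show ?thesis by (simp add: algebra_simps)
  qed
  have "((\<lambda>p. integral {0..p} (\<lambda>s. a s 0)) has_vector_derivative a 0 0) (at 0 within {0..c})"
    by (rule integral_has_vector_derivative[OF slice[OF ca _ 0]]) (use c in auto)
  then have F: "((\<lambda>p. gq 0 0 + integral {0..p} (\<lambda>s. a s 0)) has_vector_derivative a 0 0) (at 0 within {0..c})"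
    using has_vector_derivative_add[OF has_vector_derivative_const] by fastforce
  have "((\<lambda>p. gq p 0) has_vector_derivative a 0 0) (at 0 within {0..c})"
  proof (rule has_vector_derivative_transform[OF _ _ F])
    show "0 \<in> {0..c}" using c by simp
    show "gq p 0 = gq 0 0 + integral {0..p} (\<lambda>s. a s 0)" if "p \<in> {0..c}" for p using that by (rule eq)
  qed
  moreover have "((\<lambda>p. gq p 0) has_vector_derivative b 0 0) (at 0 within {0..c})"
    by (rule has_vector_derivative_at_within) (rule b[OF 0 0])
  ultimately show ?thesis
    using vector_derivative_unique_within_closed_interval[of 0 c 0 "\<lambda>p. gq p 0"] c(1) by auto
qed

lemma has_vector_derivative_compose_frechet:
  assumes g: "(g has_vector_derivative g') (at r)" and v: "v differentiable (at (g r))"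
  shows "((\<lambda>r. v (g r)) has_vector_derivative frechet_derivative v (at (g r)) g') (at r)"
proof -
  have v': "(v has_derivative frechet_derivative v (at (g r))) (at (g r))" using v by (simp add: frechet_derivative_works)
  then have lin: "linear (frechet_derivative v (at (g r)))" by (rule has_derivative_linear)
  show ?thesis
    using diff_chain_at[OF g[unfolded has_vector_derivative_def] v']
    unfolding has_vector_derivative_def by (simp add: comp_def linear_scale[OF lin])
qed

text \<open>
  Needed because \<open>L\<close> contains the composition of the two Wirtinger derivatives in one fixed order.
\<close>
lemma C2_symmetric:
  fixes u :: "'a::real_normed_vector \<Rightarrow> complex"
  assumes u: "C2_on u S" and S: "open S" "x \<in> S"
  shows "frechet_derivative (\<lambda>x. frechet_derivative u (at x) v) (at x) w
    = frechet_derivative (\<lambda>x. frechet_derivative u (at x) w) (at x) v"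
proof -
  define D where "D v = (\<lambda>x. frechet_derivative u (at x) v)" for v
  have du: "u differentiable (at y)" if "y \<in> S" for y using u that by (auto simp: C2_on_def C1_on_def)
  have dD: "D v differentiable (at y)" if "y \<in> S" for y v using u that by (auto simp: C2_on_def C1_on_def D_def)
  have cD: "continuous_on S (D v)" for v using u by (auto simp: C2_on_def C1_on_def D_def)
  have cDD: "continuous_on S (\<lambda>y. frechet_derivative (D v) (at y) w)" for v w using u by (auto simp: C2_on_def C1_on_def D_def)
  let ?P = "\<lambda>p q. x + p *\<^sub>R v + q *\<^sub>R w"
  have "open ((\<lambda>(p, q). ?P p q) -` S)"
    unfolding split_beta by (intro open_vimage S continuous_intros)
  moreover have "(0, 0) \<in> (\<lambda>(p, q). ?P p q) -` S" using S by simp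
  ultimately obtain e where e: "e > 0" "ball (0, 0) e \<subseteq> (\<lambda>(p, q). ?P p q) -` S" by (meson open_contains_ball)
  define \<delta> where "\<delta> = e / 2"
  have \<delta>: "\<delta> > 0" using e by (simp add: \<delta>_def)
  have inS: "?P p q \<in> S" if "p \<in> {-\<delta><..<\<delta>}" "q \<in> {-\<delta><..<\<delta>}" for p q
  proof -
    have "dist (0, 0) (p, q) \<le> \<bar>p\<bar> + \<bar>q\<bar>"
      using norm_Pair_le[of p q] by (subst dist_commute) (simp add: dist_norm)
    also have "\<dots> < e" using that by (auto simp: \<delta>_def)
    finally show ?thesis using e(2) by auto
  qed
  have dp: "((\<lambda>p. ?P p q) has_vector_derivative v) (at p)" and dq: "((\<lambda>q. ?P p q) has_vector_derivative w) (at q)" for p q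
    by (auto intro!: derivative_eq_intros)
  have cP: "continuous_on ({-\<delta><..<\<delta>} \<times> {-\<delta><..<\<delta>}) (\<lambda>(p, q). h (?P p q))" if "continuous_on S h" for h :: "'a \<Rightarrow> complex"
    unfolding split_beta by (rule continuous_on_compose2[OF that]) (use inS in \<open>auto intro!: continuous_intros\<close>)
  have "frechet_derivative (D v) (at (?P 0 0)) w = frechet_derivative (D w) (at (?P 0 0)) v"
  proof (rule mixed_partials_commute[OF \<delta>, where g = "\<lambda>p q. u (?P p q)" and gp = "\<lambda>p q. D v (?P p q)" and gq = "\<lambda>p q. D w (?P p q)"
        and a = "\<lambda>p q. frechet_derivative (D v) (at (?P p q)) w" and b = "\<lambda>p q. frechet_derivative (D w) (at (?P p q)) v"])
    fix p q assume pq: "p \<in> {-\<delta><..<\<delta>}" "q \<in> {-\<delta><..<\<delta>}"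
    show "((\<lambda>p. u (?P p q)) has_vector_derivative D v (?P p q)) (at p)"
      unfolding D_def by (rule has_vector_derivative_compose_frechet[OF dp du[OF inS[OF pq]]])
    show "((\<lambda>q. u (?P p q)) has_vector_derivative D w (?P p q)) (at q)"
      unfolding D_def by (rule has_vector_derivative_compose_frechet[OF dq du[OF inS[OF pq]]])
    show "((\<lambda>q. D v (?P p q)) has_vector_derivative frechet_derivative (D v) (at (?P p q)) w) (at q)"
      by (rule has_vector_derivative_compose_frechet[OF dq dD[OF inS[OF pq]]])
    show "((\<lambda>p. D w (?P p q)) has_vector_derivative frechet_derivative (D w) (at (?P p q)) v) (at p)"
      by (rule has_vector_derivative_compose_frechet[OF dp dD[OF inS[OF pq]]])
  qed (rule cP cD cDD)+
  then show ?thesis by (simp add: D_def)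
qed

definition set_coord :: "complex ^ 'n \<Rightarrow> 'n \<Rightarrow> complex \<Rightarrow> complex ^ 'n" where
  "set_coord z j v = (\<chi> i. if i = j then v else z $ i)"

lemma bounded_linear_axis: "bounded_linear (\<lambda>v::complex. axis j v :: complex ^ 'n)"
  by (intro linear_conv_bounded_linear[THEN iffD1] linearI) (auto simp: vec_eq_iff axis_def)

lemma set_coord_axis: "set_coord z j v = set_coord z j 0 + axis j v"
  by (auto simp: set_coord_def vec_eq_iff axis_def)

lemma open_polydisc: "open (polydisc :: (complex ^ 'n) set)"
proof -
  have "polydisc = (\<Inter>j\<in>UNIV. {z :: complex ^ 'n. norm (z $ j) < 1})" by (auto simp: polydisc_def)
  moreover have "open (\<Inter>j\<in>UNIV. {z :: complex ^ 'n. norm (z $ j) < 1})"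
    by (intro open_INT ballI open_Collect_less continuous_intros) auto
  ultimately show ?thesis by (simp only:)
qed

lemma slice_polar_harmonic:
  fixes u :: "complex ^ 'n \<Rightarrow> complex"
  assumes C2: "C2_on u polydisc" and L: "\<And>z. z \<in> polydisc \<Longrightarrow> L_op a b j u z = 0"
    and z: "\<And>i. i \<noteq> j \<Longrightarrow> norm (z $ i) < 1"
  shows "polar_harmonic a b (\<lambda>r t. u (set_coord z j (of_real r * cis t)))"
proof -
  \<comment> \<open>In coordinates \<open>z\<^sub>j = x + i y\<close>: the indices 1 and 2 stand for \<open>\<partial>\<^sub>x\<close> and \<open>\<partial>\<^sub>y\<close>.\<close>
  define Z where "Z r t = set_coord z j (of_real r * cis t)" for r t
  define D1 where "D1 = (\<lambda>x. frechet_derivative u (at x) (axis j 1))"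
  define D2 where "D2 = (\<lambda>x. frechet_derivative u (at x) (axis j \<i>))"
  define D11 where "D11 = (\<lambda>x. frechet_derivative D1 (at x) (axis j 1))"
  define D12 where "D12 = (\<lambda>x. frechet_derivative D1 (at x) (axis j \<i>))"
  define D22 where "D22 = (\<lambda>x. frechet_derivative D2 (at x) (axis j \<i>))"
  have du: "u differentiable (at y)" if "y \<in> polydisc" for y using C2 that by (auto simp: C2_on_def C1_on_def)
  have d1: "D1 differentiable (at y)" and d2: "D2 differentiable (at y)" if "y \<in> polydisc" for y
    using C2 that by (auto simp: C2_on_def C1_on_def D1_def D2_def)
  have c12: "continuous_on polydisc D1" "continuous_on polydisc D2"
    using C2 by (auto simp: C2_on_def C1_on_def D1_def D2_def)
  have cu: "continuous_on polydisc u"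
    using du differentiable_imp_continuous_within by (auto intro!: continuous_at_imp_continuous_on)
  have c2: "continuous_on polydisc D11" "continuous_on polydisc D12" "continuous_on polydisc D22"
    using C2 by (auto simp: C2_on_def C1_on_def D1_def D2_def D11_def D12_def D22_def)
  have D21: "frechet_derivative D2 (at y) (axis j 1) = D12 y" if "y \<in> polydisc" for y
    unfolding D12_def D1_def D2_def by (rule C2_symmetric[OF C2 open_polydisc that])
  have ZP: "Z r t \<in> polydisc" if "r \<in> {-1<..<1}" for r t
    using that z by (auto simp: Z_def set_coord_def polydisc_def norm_mult)
  have cZ: "continuous_on A (\<lambda>x. Z (fst x) (snd x))" for A
  proof -
    have "continuous_on A (\<lambda>x. axis j (of_real (fst x) * cis (snd x)) :: complex ^ 'n)"
      by (intro bounded_linear.continuous_on[OF bounded_linear_axis] continuous_intros)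
    then show ?thesis unfolding Z_def by (subst set_coord_axis) (intro continuous_intros)
  qed
  have cis: "(cis has_vector_derivative \<i> * cis x) (at x)" for x
    unfolding cis_conv_exp by (auto intro!: derivative_eq_intros has_vector_derivative_real_field)
  have dZr: "((\<lambda>r. Z r t) has_vector_derivative axis j (cis t)) (at r)" for r t
  proof -
    have "((\<lambda>r. of_real r * cis t) has_vector_derivative cis t) (at r)"
      by (auto intro!: derivative_eq_intros has_vector_derivative_real_field)
    from bounded_linear.has_vector_derivative[OF bounded_linear_axis this]
    have "((\<lambda>r. set_coord z j 0 + axis j (of_real r * cis t)) has_vector_derivative 0 + axis j (cis t)) (at r)"
      by (intro has_vector_derivative_add has_vector_derivative_const)
    then show ?thesis unfolding Z_def by (subst set_coord_axis) simp
  qed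
  have dZt: "((\<lambda>t. Z r t) has_vector_derivative axis j (of_real r * (\<i> * cis t))) (at t)" for r t
  proof -
    have "((\<lambda>t. of_real r * cis t) has_vector_derivative of_real r * (\<i> * cis t)) (at t)"
      by (rule has_vector_derivative_mult_right[OF cis])
    from bounded_linear.has_vector_derivative[OF bounded_linear_axis this]
    have "((\<lambda>t. set_coord z j 0 + axis j (of_real r * cis t)) has_vector_derivative 0 + axis j (of_real r * (\<i> * cis t))) (at t)"
      by (intro has_vector_derivative_add has_vector_derivative_const)
    then show ?thesis unfolding Z_def by (subst set_coord_axis) simp
  qed
  have ax: "frechet_derivative v (at y) (axis j w)
      = of_real (Re w) * frechet_derivative v (at y) (axis j 1) + of_real (Im w) * frechet_derivative v (at y) (axis j \<i>)"
    if "v differentiable (at y)" for v :: "complex ^ 'n \<Rightarrow> complex" and y w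
  proof -
    have lin: "linear (frechet_derivative v (at y))"
      using that frechet_derivative_works has_derivative_linear by blast
    have "axis j w = Re w *\<^sub>R axis j 1 + Im w *\<^sub>R axis j \<i>"
      by (auto simp: vec_eq_iff axis_def complex_eq_iff)
    then have "frechet_derivative v (at y) (axis j w)
        = Re w *\<^sub>R frechet_derivative v (at y) (axis j 1) + Im w *\<^sub>R frechet_derivative v (at y) (axis j \<i>)"
      by (simp only: linear_add[OF lin] linear_scale[OF lin])
    then show ?thesis by (simp add: scaleR_conv_of_real)
  qed
  let ?c = "\<lambda>t. complex_of_real (cos t)" and ?s = "\<lambda>t. complex_of_real (sin t)"
  have dr: "((\<lambda>r. v (Z r t)) has_vector_derivative
      ?c t * frechet_derivative v (at (Z r t)) (axis j 1) + ?s t * frechet_derivative v (at (Z r t)) (axis j \<i>)) (at r)"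
    if "v differentiable (at (Z r t))" for v r t
    using has_vector_derivative_compose_frechet[OF dZr that] ax[OF that, of "cis t"] by (simp only: cis.sel)
  have dt: "((\<lambda>t. v (Z r t)) has_vector_derivative
      of_real r * (- ?s t * frechet_derivative v (at (Z r t)) (axis j 1) + ?c t * frechet_derivative v (at (Z r t)) (axis j \<i>))) (at t)"
    if "v differentiable (at (Z r t))" for v r t
    
  proof -
    have "frechet_derivative v (at (Z r t)) (axis j (of_real r * (\<i> * cis t)))
       = of_real r * (- ?s t * frechet_derivative v (at (Z r t)) (axis j 1) + ?c t * frechet_derivative v (at (Z r t)) (axis j \<i>))"
      by (subst ax[OF that]) (simp add: algebra_simps)
    then show ?thesis using has_vector_derivative_compose_frechet[OF dZt that] by simp
  qed
  have dc: "(?c has_vector_derivative - ?s t) (at t)" and ds: "(?s has_vector_derivative ?c t) (at t)" for t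
  proof -
    have "(?c has_vector_derivative of_real (- sin t)) (at t)" "(?s has_vector_derivative of_real (cos t)) (at t)"
      by (intro has_vector_derivative_of_real, auto intro!: derivative_eq_intros simp flip: has_real_derivative_iff_has_vector_derivative)+
    then show "(?c has_vector_derivative - ?s t) (at t)" "(?s has_vector_derivative ?c t) (at t)" by simp_all
  qed
  define Fr where "Fr r t = ?c t * D1 (Z r t) + ?s t * D2 (Z r t)" for r t
  define Frr where "Frr r t = ?c t * (?c t * D11 (Z r t) + ?s t * D12 (Z r t)) + ?s t * (?c t * D12 (Z r t) + ?s t * D22 (Z r t))" for r t
  define Ft where "Ft r t = of_real r * (- ?s t * D1 (Z r t) + ?c t * D2 (Z r t))" for r t
  define Ftt where "Ftt r t = of_real r * ((- ?s t * (of_real r * (- ?s t * D11 (Z r t) + ?c t * D12 (Z r t))) + (- ?c t) * D1 (Z r t))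
      + (?c t * (of_real r * (- ?s t * D12 (Z r t) + ?c t * D22 (Z r t))) + (- ?s t) * D2 (Z r t)))" for r t
  show ?thesis
    unfolding polar_harmonic_def Z_def[symmetric]
  proof (rule exI[of _ Fr], rule exI[of _ Frr], rule exI[of _ Ft], rule exI[of _ Ftt], intro conjI ballI allI)
    fix G assume "G \<in> {\<lambda>r t. u (Z r t), Fr, Frr, Ft, Ftt}"
    then consider "G = (\<lambda>r t. u (Z r t))" | "G = Fr" | "G = Frr" | "G = Ft" | "G = Ftt" by blast
    moreover have k: "continuous_on ({-1<..<1} \<times> UNIV) (\<lambda>x. h (Z (fst x) (snd x)))" if "continuous_on polydisc h" for h :: "complex ^ 'n \<Rightarrow> complex"
      by (rule continuous_on_compose2[OF that cZ]) (use ZP in auto)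
    ultimately show "continuous_on ({-1<..<1} \<times> UNIV) (\<lambda>(r, t). G r t)"
      unfolding split_beta
      by cases (simp_all only: Fr_def Frr_def Ft_def Ftt_def, (intro continuous_intros k cu c12 c2)+)
  next
    fix r t :: real assume r: "r \<in> {-1<..<1}"
    note P = ZP[OF r, of t]
    show "((\<lambda>r. u (Z r t)) has_vector_derivative Fr r t) (at r)"
      using dr[OF du[OF P]] by (simp add: Fr_def D1_def D2_def)
    have 1: "((\<lambda>r. D1 (Z r t)) has_vector_derivative ?c t * D11 (Z r t) + ?s t * D12 (Z r t)) (at r)"
      using dr[OF d1[OF P]] by (simp add: D11_def D12_def)
    have 2: "((\<lambda>r. D2 (Z r t)) has_vector_derivative ?c t * D12 (Z r t) + ?s t * D22 (Z r t)) (at r)"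
      using dr[OF d2[OF P]] by (simp add: D21[OF P] D22_def)
    show "((\<lambda>r. Fr r t) has_vector_derivative Frr r t) (at r)"
      unfolding Fr_def Frr_def by (intro has_vector_derivative_add has_vector_derivative_mult_right 1 2)
    show "((\<lambda>t. u (Z r t)) has_vector_derivative Ft r t) (at t)"
      using dt[OF du[OF P]] by (simp add: Ft_def D1_def D2_def)
    have 3: "((\<lambda>t. D1 (Z r t)) has_vector_derivative of_real r * (- ?s t * D11 (Z r t) + ?c t * D12 (Z r t))) (at t)"
      using dt[OF d1[OF P]] by (simp add: D11_def D12_def)
    have 4: "((\<lambda>t. D2 (Z r t)) has_vector_derivative of_real r * (- ?s t * D12 (Z r t) + ?c t * D22 (Z r t))) (at t)"
      using dt[OF d2[OF P]] by (simp add: D21[OF P] D22_def)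
    show "((\<lambda>t. Ft r t) has_vector_derivative Ftt r t) (at t)"
      unfolding Ft_def Ftt_def
      by (intro has_vector_derivative_mult_right has_vector_derivative_add has_vector_derivative_mult 3 4 dc ds has_vector_derivative_minus)
    have ZT: "Z r (t + 2 * pi) = Z r t" by (simp add: Z_def complex_eq_iff cis.ctr)
    then show "u (Z r (t + 2 * pi)) = u (Z r t)" by simp
    show "Ft r (t + 2 * pi) = Ft r t" unfolding Ft_def ZT by simp
    define x where "x = complex_of_real r"
    define c s where "c = ?c t" and "s = ?s t"
    have cs: "c * c + s * s = 1" unfolding c_def s_def
      by (metis of_real_1 of_real_add of_real_mult power2_eq_square sin_cos_squared_add2)
    define e1 e2 e11 e12 e22 where "e1 = D1 (Z r t)" and "e2 = D2 (Z r t)" and "e11 = D11 (Z r t)" and "e12 = D12 (Z r t)" and "e22 = D22 (Z r t)"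
    have dzb: "dzbar j u = (\<lambda>y. (D1 y + \<i> * D2 y) / 2)" by (simp add: dzbar_def D1_def D2_def fun_eq_iff)
    have "((\<lambda>y. (D1 y + \<i> * D2 y) / 2) has_derivative
        (\<lambda>h. (frechet_derivative D1 (at (Z r t)) h + \<i> * frechet_derivative D2 (at (Z r t)) h) / 2)) (at (Z r t))"
      using d1[OF P] d2[OF P] unfolding frechet_derivative_works
      by (intro bounded_linear.has_derivative[OF bounded_linear_divide] has_derivative_add has_derivative_mult_right)
    then have fd: "frechet_derivative (dzbar j u) (at (Z r t)) = (\<lambda>h. (frechet_derivative D1 (at (Z r t)) h + \<i> * frechet_derivative D2 (at (Z r t)) h) / 2)"
      unfolding dzb by (rule frechet_derivative_at[symmetric])
    have dzz: "dz j (dzbar j u) (Z r t) = (e11 + e22) / 4"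
    proof -
      have "dz j (dzbar j u) (Z r t) = ((e11 + \<i> * e12) / 2 - \<i> * ((e12 + \<i> * e22) / 2)) / 2"
        unfolding dz_def fd by (simp add: D21[OF P] e11_def e12_def e22_def D11_def D12_def D22_def)
      also have "\<dots> = (e11 + e22) / 4" by (simp add: field_simps)
      finally show ?thesis .
    qed
    have Zj: "Z r t $ j = x * (c + \<i> * s)" by (simp add: Z_def set_coord_def x_def c_def s_def complex_eq_iff)
    have nZ: "complex_of_real (1 - (norm (Z r t $ j))\<^sup>2) = 1 - x ^ 2"
      by (simp add: Z_def set_coord_def norm_mult x_def)
    have cZj: "cnj (Z r t $ j) = x * (c - \<i> * s)" unfolding Zj by (simp add: x_def c_def s_def)
    have dz1: "dz j u (Z r t) = (e1 - \<i> * e2) / 2" and dzb1: "dzbar j u (Z r t) = (e1 + \<i> * e2) / 2"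
      by (simp_all add: dz_def dzbar_def e1_def e2_def D1_def D2_def)
    have Lz: "(1 - x ^ 2) * ((e11 + e22) / 4) + a * (x * (c + \<i> * s)) * ((e1 - \<i> * e2) / 2)
        + b * (x * (c - \<i> * s)) * ((e1 + \<i> * e2) / 2) - a * b * u (Z r t) = 0"
      using L[OF P] unfolding L_op_def nZ dzz cZj unfolding Zj dz1 dzb1 .
    have Frr': "Frr r t = c * (c * e11 + s * e12) + s * (c * e12 + s * e22)"
      and Fr': "Fr r t = c * e1 + s * e2" and Ft': "Ft r t = x * (- s * e1 + c * e2)"
      and Ftt': "Ftt r t = x * ((- s * (x * (- s * e11 + c * e12)) + (- c) * e1) + (c * (x * (- s * e12 + c * e22)) + (- s) * e2))"
      by (simp_all add: Frr_def Fr_def Ft_def Ftt_def x_def c_def s_def e1_def e2_def e11_def e12_def e22_def)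
    have R: "x ^ 2 * Frr r t + x * Fr r t + Ftt r t = x ^ 2 * (e11 + e22)"
    proof -
      have "x ^ 2 * Frr r t + x * Fr r t + Ftt r t = x ^ 2 * ((c * c + s * s) * (e11 + e22))"
        unfolding Frr' Fr' Ftt' by (simp add: algebra_simps power2_eq_square)
      then show ?thesis by (simp add: cs)
    qed
    have A: "x * Fr r t - \<i> * Ft r t = x * (c + \<i> * s) * (e1 - \<i> * e2)"
      and B: "x * Fr r t + \<i> * Ft r t = x * (c - \<i> * s) * (e1 + \<i> * e2)"
      unfolding Fr' Ft' by (simp_all add: algebra_simps)
    have "(1 - x ^ 2) / 4 * (x ^ 2 * Frr r t + x * Fr r t + Ftt r t)
          + x ^ 2 * (a / 2 * (x * Fr r t - \<i> * Ft r t) + b / 2 * (x * Fr r t + \<i> * Ft r t) - a * b * u (Z r t))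
       = x ^ 2 * ((1 - x ^ 2) * ((e11 + e22) / 4) + a * (x * (c + \<i> * s)) * ((e1 - \<i> * e2) / 2)
        + b * (x * (c - \<i> * s)) * ((e1 + \<i> * e2) / 2) - a * b * u (Z r t))"
      unfolding R A B by (simp add: algebra_simps add_divide_distrib diff_divide_distrib)
    also have "\<dots> = 0" unfolding Lz by simp
    finally show "(1 - (complex_of_real r)\<^sup>2) / 4 * ((complex_of_real r)\<^sup>2 * Frr r t + complex_of_real r * Fr r t + Ftt r t) +
        (complex_of_real r)\<^sup>2 * (a / 2 * (complex_of_real r * Fr r t - \<i> * Ft r t) + b / 2 * (complex_of_real r * Fr r t + \<i> * Ft r t) - a * b * u (Z r t)) = 0"
      unfolding x_def .
  qed
qed

section \<open>Fourier coefficients on the tori of the polydisc\<close>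

definition dilate :: "('n \<Rightarrow> real) \<Rightarrow> complex ^ 'n \<Rightarrow> complex ^ 'n::finite" where
  "dilate \<rho> \<zeta> = (\<chi> j. of_real (\<rho> j) * \<zeta> $ j)"

text \<open>
  Radius vectors of the tori \<open>{\<rho>\<zeta>}\<close> that fill the polydisc; the radii of different coordinates are varied
  independently.
\<close>
definition radii :: "('n \<Rightarrow> real) set" where
  "radii = {\<rho>. \<forall>j. 0 \<le> \<rho> j \<and> \<rho> j < 1}"

text \<open>
  Pairs with the character \<open>\<zeta>\<^sup>m\<close> itself, so this is the Fourier coefficient with index \<open>-m\<close>; all \<open>m\<close> occur,
  and the sign convention matches \<open>mode\<close>.
\<close>
definition fcoef :: "(complex ^ 'n \<Rightarrow> complex) \<Rightarrow> ('n::finite \<Rightarrow> int) \<Rightarrow> complex" where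
  "fcoef f m = (LINT \<zeta>|torus_measure. f \<zeta> * chr m \<zeta>)"

text \<open>
  The function \<open>\<Phi>\<^sub>k\<close> of the introduction: the Fourier coefficient, with the index convention of \<open>mode\<close>, of the
  one-variable kernel on the circle of radius \<open>r\<close>.
\<close>
definition radial_factor :: "complex \<Rightarrow> complex \<Rightarrow> int \<Rightarrow> real \<Rightarrow> complex" where
  "radial_factor a b k r = mode k (polar_kernel a b r) / (2 * pi)"

lemma dilate_polydisc: "\<rho> \<in> radii \<Longrightarrow> \<zeta> \<in> torus \<Longrightarrow> dilate \<rho> \<zeta> \<in> polydisc"
  by (auto simp: dilate_def polydisc_def radii_def torus_def norm_mult)

lemma continuous_on_dilate: "continuous_on S (dilate \<rho>)"
  unfolding dilate_def by (intro continuous_intros)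

lemma C2_on_continuous: "C2_on u S \<Longrightarrow> continuous_on S u"
  unfolding C2_on_def C1_on_def
  by (intro continuous_at_imp_continuous_on ballI) (auto intro: differentiable_imp_continuous_within)

lemma continuous_dilate:
  assumes u: "continuous_on polydisc u" and \<rho>: "\<rho> \<in> radii"
  shows "continuous_on torus (\<lambda>\<zeta>. u (dilate \<rho> \<zeta>))"
  by (rule continuous_on_compose2[OF u continuous_on_dilate]) (use \<rho> dilate_polydisc in auto)

lemma integral_angle_mode:
  assumes "continuous_on UNIV g"
  shows "(LINT t|angle. g t * cis (of_int k * t)) = mode k g / (2 * pi)"
  unfolding mode_def by (intro integral_angle(2) continuous_intros assms)

text \<open>
  Integrate over the \<open>j\<close>-th angle first. The inner integral is the mode of a slice of \<open>u\<close>, hence proportional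
  in \<open>\<rho>\<^sub>j\<close> to the corresponding mode of the kernel.
\<close>
lemma fcoef_exchange:
  fixes u :: "complex ^ 'n \<Rightarrow> complex"
  assumes C2: "C2_on u polydisc" and L: "\<And>z. z \<in> polydisc \<Longrightarrow> L_op a b j u z = 0"
    and \<rho>: "\<rho> \<in> radii" and s: "0 \<le> s" "s < 1"
  shows "fcoef (\<lambda>\<zeta>. u (dilate \<rho> \<zeta>)) m * radial_factor a b (m j) s
    = fcoef (\<lambda>\<zeta>. u (dilate (\<rho>(j := s)) \<zeta>)) m * radial_factor a b (m j) (\<rho> j)"
proof -
  define z where "z x = dilate \<rho> (etorus x)" for x
  define w where "w x = (\<Prod>i\<in>UNIV - {j}. cis (x i) powi m i)" for x
  define F where "F x r t = u (set_coord (z x) j (of_real r * cis t))" for x r t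
  have cu: "continuous_on polydisc u" by (rule C2_on_continuous[OF C2])
  have zi: "norm (z x $ i) < 1" for x i
    using dilate_polydisc[OF \<rho> etorus_torus] by (auto simp: z_def polydisc_def)
  have formula: "fcoef (\<lambda>\<zeta>. u (dilate (\<rho>(j := r)) \<zeta>)) m
      = (LINT x|PiM (UNIV - {j}) (\<lambda>_. angle). w x * (mode (m j) (F x r) / (2 * pi)))"
    if r: "0 \<le> r" "r < 1" for r
  proof -
    have \<rho>': "\<rho>(j := r) \<in> radii" using \<rho> r by (auto simp: radii_def)
    have c: "continuous_on torus (\<lambda>\<zeta>. u (dilate (\<rho>(j := r)) \<zeta>) * chr m \<zeta>)"
      by (intro continuous_on_mult continuous_dilate[OF cu \<rho>'] continuous_on_chr)
    have d: "dilate (\<rho>(j := r)) (etorus (x(j := t))) = set_coord (z x) j (of_real r * cis t)" for x t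
      by (auto simp: dilate_def set_coord_def z_def vec_eq_iff)
    have ch: "chr m (etorus (x(j := t))) = w x * cis (of_int (m j) * t)" for x t
    proof -
      have "chr m (etorus (x(j := t))) = cis t powi m j * (\<Prod>i\<in>UNIV - {j}. cis ((x(j := t)) i) powi m i)"
        unfolding chr_def by (subst prod.remove[of _ j]) auto
      also have "(\<Prod>i\<in>UNIV - {j}. cis ((x(j := t)) i) powi m i) = w x"
        unfolding w_def by (intro prod.cong) auto
      also have "cis t powi m j * w x = w x * cis (of_int (m j) * t)" by (simp add: cis_power_int mult.commute)
      finally show ?thesis .
    qed
    have cF: "continuous_on UNIV (F x r)" for x
      unfolding F_def
    proof (rule continuous_on_compose2[OF cu])
      have "continuous_on UNIV (\<lambda>t. \<chi> i. if i = j then of_real r * cis t else z x $ i)"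
      proof (rule continuous_on_vec_lambda)
        show "continuous_on UNIV (\<lambda>t. if i = j then of_real r * cis t else z x $ i)" for i
          by (cases "i = j") (auto intro!: continuous_intros)
      qed
      then show "continuous_on UNIV (\<lambda>t. set_coord (z x) j (of_real r * cis t))" by (simp add: set_coord_def)
      show "(\<lambda>t. set_coord (z x) j (of_real r * cis t)) ` UNIV \<subseteq> polydisc"
        using zi r by (auto simp: polydisc_def set_coord_def norm_mult)
    qed
    have "(LINT t|angle. u (dilate (\<rho>(j := r)) (etorus (x(j := t)))) * chr m (etorus (x(j := t))))
        = w x * (mode (m j) (F x r) / (2 * pi))" for x
    proof -
      have "(LINT t|angle. u (dilate (\<rho>(j := r)) (etorus (x(j := t)))) * chr m (etorus (x(j := t))))
        = (LINT t|angle. w x * (F x r t * cis (of_int (m j) * t)))"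
        unfolding d ch F_def by (simp add: mult_ac)
      also have "\<dots> = w x * (mode (m j) (F x r) / (2 * pi))"
        unfolding integral_mult_right_zero integral_angle_mode[OF cF] ..
      finally show ?thesis .
    qed
    then show ?thesis unfolding fcoef_def torus_integral_coordinate[OF c, of j] by simp
  qed
  have pr: "mode (m j) (F x (\<rho> j)) * mode (m j) (polar_kernel a b s) = mode (m j) (F x s) * mode (m j) (polar_kernel a b (\<rho> j))" for x
  proof (rule polar_harmonic_modes_proportional[OF _ polar_harmonic_polar_kernel])
    have "polar_harmonic a b (\<lambda>r t. u (set_coord (z x) j (of_real r * cis t)))"
      by (rule slice_polar_harmonic[OF C2 L]) (use zi in auto)
    then show "polar_harmonic a b (F x)" by (simp add: F_def[abs_def])
  qed (use \<rho> s in \<open>auto simp: radii_def\<close>)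
  have r: "0 \<le> \<rho> j" "\<rho> j < 1" using \<rho> by (auto simp: radii_def)
  have "fcoef (\<lambda>\<zeta>. u (dilate \<rho> \<zeta>)) m * radial_factor a b (m j) s
    = (LINT x|PiM (UNIV - {j}) (\<lambda>_. angle). w x * (mode (m j) (F x (\<rho> j)) / (2 * pi)) * radial_factor a b (m j) s)"
    using formula[OF r] by simp
  also have "\<dots> = (LINT x|PiM (UNIV - {j}) (\<lambda>_. angle). w x * (mode (m j) (F x s) / (2 * pi)) * radial_factor a b (m j) (\<rho> j))"
  proof (rule Bochner_Integration.integral_cong)
    show "w x * (mode (m j) (F x (\<rho> j)) / (2 * pi)) * radial_factor a b (m j) s = w x * (mode (m j) (F x s) / (2 * pi)) * radial_factor a b (m j) (\<rho> j)" for x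
      using pr[of x] by (simp add: radial_factor_def)
  qed simp
  also have "\<dots> = fcoef (\<lambda>\<zeta>. u (dilate (\<rho>(j := s)) \<zeta>)) m * radial_factor a b (m j) (\<rho> j)"
    using formula[OF s] by simp
  finally show ?thesis .
qed

text \<open>
  Exchange the radii of \<open>\<rho>\<close> for those of \<open>\<rho>'\<close> one coordinate at a time. Stated without division, as the
  radial factors may have zeros.
\<close>
lemma fcoef_product:
  fixes u :: "complex ^ 'n \<Rightarrow> complex"
  assumes u: "separately_harmonic \<alpha> \<beta> u" and \<rho>: "\<rho> \<in> radii" and \<rho>': "\<rho>' \<in> radii"
  shows "fcoef (\<lambda>\<zeta>. u (dilate \<rho> \<zeta>)) m * (\<Prod>j\<in>UNIV. radial_factor (\<alpha> $ j) (\<beta> $ j) (m j) (\<rho>' j))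
    = fcoef (\<lambda>\<zeta>. u (dilate \<rho>' \<zeta>)) m * (\<Prod>j\<in>UNIV. radial_factor (\<alpha> $ j) (\<beta> $ j) (m j) (\<rho> j))"
proof -
  let ?\<phi> = "\<lambda>j. radial_factor (\<alpha> $ j) (\<beta> $ j) (m j)"
  define mix where "mix S = (\<lambda>i. if i \<in> S then \<rho>' i else \<rho> i)" for S
  have C2: "C2_on u polydisc" and L: "\<And>j z. z \<in> polydisc \<Longrightarrow> L_op (\<alpha> $ j) (\<beta> $ j) j u z = 0"
    using u by (auto simp: separately_harmonic_def)
  have mix: "mix S \<in> radii" for S using \<rho> \<rho>' by (auto simp: mix_def radii_def)
  have "fcoef (\<lambda>\<zeta>. u (dilate \<rho> \<zeta>)) m * (\<Prod>j\<in>S. ?\<phi> j (\<rho>' j)) = fcoef (\<lambda>\<zeta>. u (dilate (mix S) \<zeta>)) m * (\<Prod>j\<in>S. ?\<phi> j (\<rho> j))"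
    if "finite S" for S
    using that
  proof induction
    case empty
    show ?case by (simp add: mix_def)
  next
    case (insert i S)
    have i: "(mix S)(i := \<rho>' i) = mix (insert i S)" "mix S i = \<rho> i" using insert.hyps by (auto simp: mix_def fun_eq_iff)
    have r: "0 \<le> \<rho>' i" "\<rho>' i < 1" using \<rho>' by (auto simp: radii_def)
    have ex: "fcoef (\<lambda>\<zeta>. u (dilate (mix S) \<zeta>)) m * ?\<phi> i (\<rho>' i) = fcoef (\<lambda>\<zeta>. u (dilate (mix (insert i S)) \<zeta>)) m * ?\<phi> i (\<rho> i)"
      using fcoef_exchange[where j = i and m = m, OF C2 L mix[of S] r] unfolding i .
    have "fcoef (\<lambda>\<zeta>. u (dilate \<rho> \<zeta>)) m * (\<Prod>j\<in>insert i S. ?\<phi> j (\<rho>' j))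
      = (fcoef (\<lambda>\<zeta>. u (dilate \<rho> \<zeta>)) m * (\<Prod>j\<in>S. ?\<phi> j (\<rho>' j))) * ?\<phi> i (\<rho>' i)"
      using insert.hyps by (simp add: mult_ac)
    also have "\<dots> = (fcoef (\<lambda>\<zeta>. u (dilate (mix S) \<zeta>)) m * ?\<phi> i (\<rho>' i)) * (\<Prod>j\<in>S. ?\<phi> j (\<rho> j))"
      unfolding insert.IH by (simp add: mult_ac)
    also have "\<dots> = fcoef (\<lambda>\<zeta>. u (dilate (mix (insert i S)) \<zeta>)) m * (\<Prod>j\<in>insert i S. ?\<phi> j (\<rho> j))"
      unfolding ex using insert.hyps by (simp add: mult_ac)
    finally show ?case .
  qed
  from this[of UNIV] show ?thesis by (simp add: mix_def)
qed

lemma mode_shift: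
  fixes g :: "real \<Rightarrow> complex"
  assumes g: "continuous_on UNIV g" and per: "\<And>t. g (t + 2 * pi) = g t" and \<tau>: "0 \<le> \<tau>" "\<tau> \<le> 2 * pi"
  shows "mode k (\<lambda>t. g (t - \<tau>)) = cis (of_int k * \<tau>) * mode k g"
proof -
  define h where "h t = g t * cis (of_int k * t)" for t
  have ch: "continuous_on S h" for S
    unfolding h_def by (intro continuous_intros continuous_on_subset[OF g]) auto
  have hp: "h (t + 2 * pi) = h t" for t
  proof -
    have "cis (of_int k * (t + 2 * pi)) = cis (of_int k * t) * cis (of_int k * (2 * pi))"
      by (simp add: cis_mult distrib_left)
    also have "cis (of_int k * (2 * pi)) = 1"
      using cis_multiple_2pi[of "of_int k"] by (simp add: mult.commute mult.left_commute)
    finally show ?thesis by (simp add: h_def per)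
  qed
  have io: "h integrable_on {a..b}" for a b by (intro integrable_continuous_interval ch)
  have "integral {0..2 * pi} (\<lambda>t. h (t - \<tau>)) = integral {- \<tau>..2 * pi - \<tau>} h"
    using integral_shift_real_ivl[of "- \<tau>" "- \<tau>" "2 * pi - \<tau>" h] by simp
  also have "\<dots> = integral {- \<tau>..0} h + integral {0..2 * pi - \<tau>} h"
    using \<tau> by (intro Henstock_Kurzweil_Integration.integral_combine[symmetric] io) auto
  also have "integral {- \<tau>..0} h = integral {2 * pi - \<tau>..2 * pi} h"
    using integral_shift_real_ivl[of "2 * pi - \<tau>" "2 * pi" "2 * pi" h] by (simp add: hp)
  also have "integral {2 * pi - \<tau>..2 * pi} h + integral {0..2 * pi - \<tau>} h = integral {0..2 * pi} h"
    using \<tau> Henstock_Kurzweil_Integration.integral_combine[of 0 "2 * pi - \<tau>" "2 * pi" h] io by (simp add: add.commute)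
  finally have I: "integral {0..2 * pi} (\<lambda>t. h (t - \<tau>)) = integral {0..2 * pi} h" .
  have "g (t - \<tau>) * cis (of_int k * t) = cis (of_int k * \<tau>) * h (t - \<tau>)" for t
  proof -
    have "cis (of_int k * t) = cis (of_int k * \<tau>) * cis (of_int k * (t - \<tau>))"
      by (simp add: cis_mult right_diff_distrib)
    then show ?thesis by (simp add: h_def)
  qed
  then have "mode k (\<lambda>t. g (t - \<tau>)) = cis (of_int k * \<tau>) * integral {0..2 * pi} (\<lambda>t. h (t - \<tau>))"
    by (simp add: mode_def)
  then show ?thesis unfolding I by (simp add: mode_def h_def[abs_def])
qed

lemma continuous_on_kernel_factor:
  fixes f g :: "'a::topological_space \<Rightarrow> complex"
  assumes "continuous_on S f" "continuous_on S g"
    and f: "\<And>x. x \<in> S \<Longrightarrow> norm (f x) < 1" and g: "\<And>x. x \<in> S \<Longrightarrow> norm (g x) = 1"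
  shows "continuous_on S (\<lambda>x. kernel_factor a b (f x) (g x))"
proof -
  have p: "continuous_on S (\<lambda>x. (1 - h x) powr c)" if "continuous_on S h" "\<And>x. x \<in> S \<Longrightarrow> norm (h x) < 1" for h :: "'a \<Rightarrow> complex" and c
  proof (rule continuous_on_powr_complex)
    have "0 \<le> Re (1 - h x)" if "x \<in> S" for x
      using abs_Re_le_cmod[of "h x"] \<open>\<And>x. x \<in> S \<Longrightarrow> norm (h x) < 1\<close>[OF that] by simp
    then show "S \<subseteq> {x. 0 \<le> Re (1 - h x) \<or> Im (1 - h x) \<noteq> 0}" by auto
    show "0 < Re c" if "x \<in> S" "1 - h x = 0" for x
      using that(2) \<open>\<And>x. x \<in> S \<Longrightarrow> norm (h x) < 1\<close>[OF that(1)] by auto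
  qed (intro continuous_intros that)+
  have n1: "norm (of_real ((norm (f x))\<^sup>2) :: complex) < 1" if "x \<in> S" for x
    using f[OF that] by (simp add: norm_power abs_square_less_1)
  have n2: "norm (f x * cnj (g x)) < 1" "norm (cnj (f x) * g x) < 1" if "x \<in> S" for x
    using f[OF that] g[OF that] by (simp_all add: norm_mult)
  have "continuous_on S (\<lambda>x. c_const a b * ((1 - of_real ((norm (f x))\<^sup>2)) powr (a + b + 1) /
      ((1 - f x * cnj (g x)) powr (a + 1) * (1 - cnj (f x) * g x) powr (b + 1))))"
  proof (intro continuous_on_mult continuous_on_divide continuous_on_const p n1 n2)
    show "\<forall>x\<in>S. (1 - f x * cnj (g x)) powr (a + 1) * (1 - cnj (f x) * g x) powr (b + 1) \<noteq> 0"
      using one_minus_nonzero n2 by (auto simp: powr_def)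
  qed (auto intro!: continuous_intros assms)
  then show ?thesis by (simp add: kernel_factor_def)
qed

lemma polar_kernel_periodic: "polar_kernel a b r (t + 2 * pi) = polar_kernel a b r t"
proof -
  have c: "cis (t + 2 * pi) = cis t" "cis (- (t + 2 * pi)) = cis (- t)"
    by (simp_all add: complex_eq_iff cos_add sin_add cos_diff sin_diff minus_add)
  show ?thesis unfolding polar_kernel_def c by simp
qed

text \<open>
  The kernel depends on the difference of the two angles only, so translation in the angle turns the coefficient
  at \<open>w = 1\<close> into that at \<open>w\<close>.
\<close>
lemma coef_kernel_factor:
  assumes r: "0 \<le> r" "r < 1" and w: "norm w = 1"
  shows "(LINT t|angle. kernel_factor a b (of_real r * cis t) w * cis t powi k) = w powi k * radial_factor a b k r"
proof -
  define \<tau> where "\<tau> = Arg2pi w"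
  have \<tau>: "cis \<tau> = w" "0 \<le> \<tau>" "\<tau> \<le> 2 * pi"
    using cis_Arg2pi[OF w] Arg2pi_ge_0[of w] Arg2pi_lt_2pi[of w] by (auto simp: \<tau>_def)
  have eq: "kernel_factor a b (of_real r * cis t) w = polar_kernel a b r (t - \<tau>)" for t
    using kernel_factor_polar[OF r, of a b t \<tau>] by (simp add: \<tau>)
  have c: "continuous_on UNIV (\<lambda>t. kernel_factor a b (of_real r * cis t) 1)"
    using r by (intro continuous_on_kernel_factor continuous_intros) (auto simp: norm_mult)
  moreover have "kernel_factor a b (of_real r * cis t) 1 = polar_kernel a b r t" for t
    using kernel_factor_polar[OF r, of a b t 0] by simp
  ultimately have ck: "continuous_on UNIV (polar_kernel a b r)" by simp
  have ck': "continuous_on UNIV (\<lambda>t. polar_kernel a b r (t - \<tau>))"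
    by (intro continuous_on_compose2[OF ck] continuous_intros) auto
  have "(LINT t|angle. kernel_factor a b (of_real r * cis t) w * cis t powi k) = (LINT t|angle. polar_kernel a b r (t - \<tau>) * cis (of_int k * t))"
    by (simp add: eq cis_power_int)
  also have "\<dots> = mode k (\<lambda>t. polar_kernel a b r (t - \<tau>)) / (2 * pi)" by (rule integral_angle_mode[OF ck'])
  also have "\<dots> = cis (of_int k * \<tau>) * radial_factor a b k r"
    unfolding mode_shift[OF ck polar_kernel_periodic \<tau>(2,3)] by (simp add: radial_factor_def)
  also have "cis (of_int k * \<tau>) = w powi k" unfolding \<tau>(1)[symmetric] by (simp add: cis_power_int)
  finally show ?thesis .
qed

lemma continuous_poisson_kernel:
  fixes \<alpha> \<beta> :: "complex ^ 'n"
  assumes \<rho>: "\<rho> \<in> radii"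
  shows "continuous_on (torus \<times> torus) (\<lambda>x. poisson_kernel \<alpha> \<beta> (dilate \<rho> (fst x)) (snd x))"
proof -
  have "continuous_on (torus \<times> torus) (\<lambda>x. kernel_factor (\<alpha> $ j) (\<beta> $ j) (dilate \<rho> (fst x) $ j) (snd x $ j))" for j
  proof (rule continuous_on_kernel_factor)
    show "continuous_on (torus \<times> torus) (\<lambda>x. dilate \<rho> (fst x) $ j)"
      unfolding dilate_def by (simp) (intro continuous_intros)
    show "continuous_on (torus \<times> torus) (\<lambda>x. snd x $ j)" by (intro continuous_intros)
    fix x :: "(complex ^ 'n) \<times> (complex ^ 'n)" assume x: "x \<in> torus \<times> torus"
    show "norm (dilate \<rho> (fst x) $ j) < 1" using dilate_polydisc[OF \<rho>, of "fst x"] x by (auto simp: polydisc_def)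
    show "norm (snd x $ j) = 1" using x by (auto simp: torus_def)
  qed
  then show ?thesis unfolding poisson_kernel_eq by (intro continuous_on_prod)
qed

lemma poisson_kernel_bound:
  fixes \<alpha> \<beta> :: "complex ^ 'n"
  assumes \<rho>: "\<rho> \<in> radii"
  obtains B where "\<And>\<zeta> \<eta>. \<zeta> \<in> torus \<Longrightarrow> \<eta> \<in> torus \<Longrightarrow> norm (poisson_kernel \<alpha> \<beta> (dilate \<rho> \<zeta>) \<eta>) \<le> B"
proof -
  have "bounded ((\<lambda>x. poisson_kernel \<alpha> \<beta> (dilate \<rho> (fst x)) (snd x)) ` (torus \<times> torus))"
    by (intro compact_imp_bounded compact_continuous_image continuous_poisson_kernel \<rho> compact_Times compact_torus)
  then obtain B where "\<forall>y \<in> (\<lambda>x. poisson_kernel \<alpha> \<beta> (dilate \<rho> (fst x)) (snd x)) ` (torus \<times> torus). norm y \<le> B"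
    by (auto simp: bounded_iff)
  then show ?thesis by (intro that[of B]) force
qed

lemma continuous_poisson_kernel_slices:
  assumes \<rho>: "\<rho> \<in> radii"
  shows "\<eta> \<in> torus \<Longrightarrow> continuous_on torus (\<lambda>\<zeta>. poisson_kernel \<alpha> \<beta> (dilate \<rho> \<zeta>) \<eta>)"
    and "\<zeta> \<in> torus \<Longrightarrow> continuous_on torus (\<lambda>\<eta>. poisson_kernel \<alpha> \<beta> (dilate \<rho> \<zeta>) \<eta>)"
proof -
  assume "\<eta> \<in> torus"
  then have "continuous_on torus (\<lambda>\<zeta>. poisson_kernel \<alpha> \<beta> (dilate \<rho> (fst (\<zeta>, \<eta>))) (snd (\<zeta>, \<eta>)))"
    by (intro continuous_on_compose2[OF continuous_poisson_kernel[OF \<rho>, of \<alpha> \<beta>]] continuous_intros) auto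
  then show "continuous_on torus (\<lambda>\<zeta>. poisson_kernel \<alpha> \<beta> (dilate \<rho> \<zeta>) \<eta>)" by simp
next
  assume "\<zeta> \<in> torus"
  then have "continuous_on torus (\<lambda>\<eta>. poisson_kernel \<alpha> \<beta> (dilate \<rho> (fst (\<zeta>, \<eta>))) (snd (\<zeta>, \<eta>)))"
    by (intro continuous_on_compose2[OF continuous_poisson_kernel[OF \<rho>, of \<alpha> \<beta>]] continuous_intros) auto
  then show "continuous_on torus (\<lambda>\<eta>. poisson_kernel \<alpha> \<beta> (dilate \<rho> \<zeta>) \<eta>)" by simp
qed

lemma continuous_poisson_integral:
  assumes \<psi>: "integrable torus_measure \<psi>" and \<rho>: "\<rho> \<in> radii"
  shows "continuous_on torus (\<lambda>\<zeta>. poisson_integral \<alpha> \<beta> \<psi> (dilate \<rho> \<zeta>))"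
proof -
  obtain B where B: "\<And>\<zeta> \<eta>. \<zeta> \<in> torus \<Longrightarrow> \<eta> \<in> torus \<Longrightarrow> norm (poisson_kernel \<alpha> \<beta> (dilate \<rho> \<zeta>) \<eta>) \<le> B"
    using poisson_kernel_bound[OF \<rho>] by blast
  show ?thesis
    unfolding continuous_on_sequentially comp_def poisson_integral_def
  proof (intro allI ballI impI, elim conjE)
    fix X and \<zeta> :: "complex ^ 'a" assume \<zeta>: "\<zeta> \<in> torus" and X: "\<forall>n. X n \<in> torus" "X \<longlonglongrightarrow> \<zeta>"
    have K: "integrable torus_measure (\<lambda>\<eta>. poisson_kernel \<alpha> \<beta> (dilate \<rho> \<xi>) \<eta> * \<psi> \<eta>)" if "\<xi> \<in> torus" for \<xi>
      using torus_continuous_integrable_mult[OF continuous_poisson_kernel_slices(2)[OF \<rho> that] \<psi>] by (simp add: mult.commute)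
    show "(\<lambda>n. LINT \<eta>|torus_measure. poisson_kernel \<alpha> \<beta> (dilate \<rho> (X n)) \<eta> * \<psi> \<eta>) \<longlonglongrightarrow> (LINT \<eta>|torus_measure. poisson_kernel \<alpha> \<beta> (dilate \<rho> \<zeta>) \<eta> * \<psi> \<eta>)"
    proof (rule integral_dominated_convergence[where w = "\<lambda>\<eta>. B * norm (\<psi> \<eta>)"])
      show "(\<lambda>\<eta>. poisson_kernel \<alpha> \<beta> (dilate \<rho> \<zeta>) \<eta> * \<psi> \<eta>) \<in> borel_measurable torus_measure"
        using K[OF \<zeta>] by (rule borel_measurable_integrable)
      show "(\<lambda>\<eta>. poisson_kernel \<alpha> \<beta> (dilate \<rho> (X n)) \<eta> * \<psi> \<eta>) \<in> borel_measurable torus_measure" for n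
        using K[OF X(1)[rule_format]] by (rule borel_measurable_integrable)
      show "integrable torus_measure (\<lambda>\<eta>. B * norm (\<psi> \<eta>))" using \<psi> by simp
      show "AE \<eta> in torus_measure. norm (poisson_kernel \<alpha> \<beta> (dilate \<rho> (X n)) \<eta> * \<psi> \<eta>) \<le> B * norm (\<psi> \<eta>)" for n
        by (rule AE_I2) (use B X(1) in \<open>auto simp: norm_mult intro!: mult_right_mono\<close>)
      show "AE \<eta> in torus_measure. (\<lambda>n. poisson_kernel \<alpha> \<beta> (dilate \<rho> (X n)) \<eta> * \<psi> \<eta>) \<longlonglongrightarrow> poisson_kernel \<alpha> \<beta> (dilate \<rho> \<zeta>) \<eta> * \<psi> \<eta>"
      proof (rule AE_I2)
        fix \<eta> :: "complex ^ 'a" assume "\<eta> \<in> space torus_measure"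
        then have "continuous_on torus (\<lambda>\<zeta>. poisson_kernel \<alpha> \<beta> (dilate \<rho> \<zeta>) \<eta>)"
          using continuous_poisson_kernel_slices(1)[OF \<rho>] by simp
        then have "(\<lambda>n. poisson_kernel \<alpha> \<beta> (dilate \<rho> (X n)) \<eta>) \<longlonglongrightarrow> poisson_kernel \<alpha> \<beta> (dilate \<rho> \<zeta>) \<eta>"
          using \<zeta> X unfolding continuous_on_sequentially comp_def by blast
        then show "(\<lambda>n. poisson_kernel \<alpha> \<beta> (dilate \<rho> (X n)) \<eta> * \<psi> \<eta>) \<longlonglongrightarrow> poisson_kernel \<alpha> \<beta> (dilate \<rho> \<zeta>) \<eta> * \<psi> \<eta>"
          by (rule tendsto_mult_right)
      qed
    qed
  qed
qed

text \<open>
  Fubini's theorem; the kernel and the character are products over the coordinates.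
\<close>
lemma fcoef_poisson_integral:
  fixes \<alpha> \<beta> :: "complex ^ 'n"
  assumes \<psi>: "integrable torus_measure \<psi>" and \<rho>: "\<rho> \<in> radii"
  shows "fcoef (\<lambda>\<zeta>. poisson_integral \<alpha> \<beta> \<psi> (dilate \<rho> \<zeta>)) m
    = fcoef \<psi> m * (\<Prod>j\<in>UNIV. radial_factor (\<alpha> $ j) (\<beta> $ j) (m j) (\<rho> j))"
proof -
  let ?T = "torus_measure :: (complex ^ 'n) measure"
  let ?K = "\<lambda>\<zeta> \<eta>. poisson_kernel \<alpha> \<beta> (dilate \<rho> \<zeta>) \<eta>"
  obtain B where B: "\<And>\<zeta> \<eta>. \<zeta> \<in> torus \<Longrightarrow> \<eta> \<in> torus \<Longrightarrow> norm (?K \<zeta> \<eta>) \<le> B"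
    using poisson_kernel_bound[OF \<rho>] by blast
  interpret TT: pair_sigma_finite ?T ?T by unfold_locales
  have Km: "(\<lambda>x. ?K (fst x) (snd x)) \<in> borel_measurable (?T \<Otimes>\<^sub>M ?T)"
  proof -
    have id: "(\<lambda>x. x) \<in> ?T \<rightarrow>\<^sub>M borel"
    proof -
      have "(\<lambda>x. x) \<in> restrict_space borel torus \<rightarrow>\<^sub>M (borel :: (complex ^ 'n) measure)"
        by (rule measurable_restrict_space1) simp
      then show ?thesis using measurable_cong_sets[OF sets_torus_measure refl] by blast
    qed
    have "(\<lambda>x. (fst x, snd x)) \<in> ?T \<Otimes>\<^sub>M ?T \<rightarrow>\<^sub>M borel \<Otimes>\<^sub>M borel"
      by (intro measurable_Pair measurable_compose[OF measurable_fst id] measurable_compose[OF measurable_snd id])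
    then have "(\<lambda>x. x) \<in> ?T \<Otimes>\<^sub>M ?T \<rightarrow>\<^sub>M borel" by (simp add: borel_prod)
    then have "(\<lambda>x. x) \<in> ?T \<Otimes>\<^sub>M ?T \<rightarrow>\<^sub>M restrict_space borel (torus \<times> torus)"
      by (intro measurable_restrict_space2) (auto simp: space_pair_measure)
    from measurable_compose[OF this borel_measurable_continuous_on_restrict[OF continuous_poisson_kernel[OF \<rho>, of \<alpha> \<beta>]]]
    show ?thesis .
  qed
  have cm: "chr m \<in> borel_measurable ?T" by (rule torus_continuous_measurable[OF continuous_on_chr])
  have \<psi>m: "\<psi> \<in> borel_measurable ?T" using \<psi> by simp
  have int: "integrable (?T \<Otimes>\<^sub>M ?T) (\<lambda>(\<zeta>, \<eta>). ?K \<zeta> \<eta> * \<psi> \<eta> * chr m \<zeta>)"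
  proof (rule Bochner_Integration.integrable_bound)
    show "integrable (?T \<Otimes>\<^sub>M ?T) (\<lambda>x. B * norm (\<psi> (snd x)))"
    proof (rule TT.Fubini_integrable)
      show "(\<lambda>x. B * norm (\<psi> (snd x))) \<in> borel_measurable (?T \<Otimes>\<^sub>M ?T)"
        using \<psi>m by measurable
    qed (use \<psi> in auto)
    show "(\<lambda>(\<zeta>, \<eta>). ?K \<zeta> \<eta> * \<psi> \<eta> * chr m \<zeta>) \<in> borel_measurable (?T \<Otimes>\<^sub>M ?T)"
      unfolding split_beta
      by (intro borel_measurable_times Km measurable_compose[OF measurable_snd \<psi>m] measurable_compose[OF measurable_fst cm])
    show "AE x in ?T \<Otimes>\<^sub>M ?T. norm (case x of (\<zeta>, \<eta>) \<Rightarrow> ?K \<zeta> \<eta> * \<psi> \<eta> * chr m \<zeta>) \<le> norm (B * norm (\<psi> (snd x)))"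
    proof (rule AE_I2)
      fix x assume "x \<in> space (?T \<Otimes>\<^sub>M ?T)"
      then have x: "fst x \<in> torus" "snd x \<in> torus" by (auto simp: space_pair_measure)
      then have "norm (?K (fst x) (snd x)) * norm (\<psi> (snd x)) \<le> B * norm (\<psi> (snd x))" by (intro mult_right_mono B) auto
      also have "\<dots> \<le> norm (B * norm (\<psi> (snd x)))" by simp
      finally show "norm (case x of (\<zeta>, \<eta>) \<Rightarrow> ?K \<zeta> \<eta> * \<psi> \<eta> * chr m \<zeta>) \<le> norm (B * norm (\<psi> (snd x)))"
        using x by (simp add: split_beta norm_mult norm_chr)
    qed
  qed
  have "fcoef (\<lambda>\<zeta>. poisson_integral \<alpha> \<beta> \<psi> (dilate \<rho> \<zeta>)) m = (LINT \<zeta>|?T. LINT \<eta>|?T. ?K \<zeta> \<eta> * \<psi> \<eta> * chr m \<zeta>)"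
    by (simp add: fcoef_def poisson_integral_def)
  also have "\<dots> = (LINT \<eta>|?T. LINT \<zeta>|?T. ?K \<zeta> \<eta> * \<psi> \<eta> * chr m \<zeta>)"
    by (rule TT.Fubini_integral[symmetric, OF int])
  also have "\<dots> = (LINT \<eta>|?T. \<psi> \<eta> * chr m \<eta> * (\<Prod>j\<in>UNIV. radial_factor (\<alpha> $ j) (\<beta> $ j) (m j) (\<rho> j)))"
  proof (rule Bochner_Integration.integral_cong[OF refl])
    fix \<eta> :: "complex ^ 'n" assume "\<eta> \<in> space ?T"
    then have \<eta>: "\<eta> \<in> torus" by simp
    then have \<eta>j: "norm (\<eta> $ j) = 1" for j by (simp add: torus_def)
    have r: "0 \<le> \<rho> j" "\<rho> j < 1" for j using \<rho> by (auto simp: radii_def)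
    have "(LINT \<zeta>|?T. ?K \<zeta> \<eta> * \<psi> \<eta> * chr m \<zeta>) = \<psi> \<eta> * (LINT \<zeta>|?T. ?K \<zeta> \<eta> * chr m \<zeta>)"
      by (subst integral_mult_right_zero[symmetric]) (simp add: mult_ac)
    also have "(LINT \<zeta>|?T. ?K \<zeta> \<eta> * chr m \<zeta>) = (LINT \<zeta>|?T. (\<Prod>j\<in>UNIV. kernel_factor (\<alpha> $ j) (\<beta> $ j) (of_real (\<rho> j) * \<zeta> $ j) (\<eta> $ j) * (\<zeta> $ j) powi m j))"
      by (simp add: poisson_kernel_eq chr_def dilate_def prod.distrib)
    also have "\<dots> = (\<Prod>j\<in>UNIV. LINT t|angle. kernel_factor (\<alpha> $ j) (\<beta> $ j) (of_real (\<rho> j) * cis t) (\<eta> $ j) * cis t powi m j)"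
      by (rule torus_integral_prod(1))
         (use r \<eta>j in \<open>auto intro!: continuous_on_mult continuous_on_kernel_factor continuous_intros simp: norm_mult\<close>)
    also have "\<dots> = (\<Prod>j\<in>UNIV. (\<eta> $ j) powi m j * radial_factor (\<alpha> $ j) (\<beta> $ j) (m j) (\<rho> j))"
      unfolding coef_kernel_factor[OF r \<eta>j] ..
    also have "\<dots> = chr m \<eta> * (\<Prod>j\<in>UNIV. radial_factor (\<alpha> $ j) (\<beta> $ j) (m j) (\<rho> j))" by (simp add: prod.distrib chr_def)
    finally show "(LINT \<zeta>|?T. ?K \<zeta> \<eta> * \<psi> \<eta> * chr m \<zeta>) = \<psi> \<eta> * chr m \<eta> * (\<Prod>j\<in>UNIV. radial_factor (\<alpha> $ j) (\<beta> $ j) (m j) (\<rho> j))"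
      by (simp add: mult.assoc)
  qed
  also have "\<dots> = fcoef \<psi> m * (\<Prod>j\<in>UNIV. radial_factor (\<alpha> $ j) (\<beta> $ j) (m j) (\<rho> j))" by (simp add: fcoef_def)
  finally show ?thesis .
qed

section \<open>Bounded families in Lebesgue spaces\<close>

lemma powr_midpoint:
  fixes x y q :: real
  assumes q: "q \<ge> 1" and x: "x \<ge> 0" and y: "y \<ge> 0"
  shows "((x + y) / 2) powr q \<le> (x powr q + y powr q) / 2"
proof -
  have half: "(v / 2) powr q \<le> v powr q / 2" if "v \<ge> 0" for v
  proof -
    have "(1 / 2 :: real) powr q \<le> (1 / 2) powr 1" using q by (intro powr_mono') auto
    then have "v powr q * (1 / 2) powr q \<le> v powr q * (1 / 2)" by (intro mult_left_mono) auto
    then show ?thesis using that powr_mult[of v "1 / 2" q] by simp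
  qed
  show ?thesis
  proof (cases "x = 0 \<or> y = 0")
    case True
    then show ?thesis using half[OF x] half[OF y] q by auto
  next
    case False
    then have "x \<in> {0<..}" "y \<in> {0<..}" using x y by auto
    from convex_onD[OF powr_convex[OF q], of "1 / 2", OF _ _ this]
    show ?thesis by (simp add: add_divide_distrib)
  qed
qed

lemma Lp_space_integrable:
  fixes f :: "complex ^ 'n \<Rightarrow> complex"
  assumes p: "1 < p" and f: "f \<in> Lp_space torus_measure p"
  shows "integrable torus_measure f"
proof (cases "p = \<infinity>")
  case True
  have fm: "f \<in> borel_measurable torus_measure" using f by (simp add: Lp_space_def)
  have lt: "esssup torus_measure (\<lambda>x. ennreal (norm (f x))) < \<infinity>"
    using f True by (simp add: Lp_space_def Lp_norm_def)
  then obtain M where M: "esssup torus_measure (\<lambda>x. ennreal (norm (f x))) = ennreal M" "M \<ge> 0"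
    by (cases "esssup torus_measure (\<lambda>x. ennreal (norm (f x)))") auto
  have "AE x in torus_measure. norm (f x) \<le> M"
    using esssup_AE[of "\<lambda>x. ennreal (norm (f x))" torus_measure] unfolding M(1)
    by eventually_elim (use M(2) in simp)
  then show ?thesis by (rule torus.integrable_const_bound[OF _ fm])
next
  case False
  define q where "q = enn2real p"
  have q: "q > 1" using p False unfolding q_def
    by (metis ennreal_enn2real_if ennreal_less_iff enn2real_nonneg ennreal_1 infinity_ennreal_def zero_le_one)
  have fm: "f \<in> borel_measurable torus_measure" using f by (simp add: Lp_space_def)
  have "(\<integral>\<^sup>+ x. ennreal (norm (f x) powr q) \<partial>torus_measure) \<noteq> \<infinity>"
    using f False by (auto simp: Lp_space_def Lp_norm_def Let_def q_def split: if_splits)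
  then have "integrable torus_measure (\<lambda>x. norm (f x) powr q)"
    using fm by (intro integrableI_nonneg) (auto simp: top.not_eq_extremum)
  then have i: "integrable torus_measure (\<lambda>x. 1 + norm (f x) powr q)" by simp
  show ?thesis
    by (rule Bochner_Integration.integrable_bound[OF i fm])
       (use le_one_plus_powr q in \<open>auto intro!: AE_I2 simp: less_imp_le\<close>)
qed

text \<open>
  The properties of the ball of \<open>L\<^sup>p\<close> that carries the family: it is closed under midpoints, bounded in some \<open>L\<^sup>q\<close> with
  \<open>1 < q < \<infinity>\<close> (\<open>q = 2\<close> if \<open>p = \<infinity>\<close>), and limits almost everywhere of its members stay in \<open>L\<^sup>p\<close>. This lets the
  finite and the infinite exponent be treated alike.
\<close>
lemma Lp_ball:
  fixes F :: "'i \<Rightarrow> complex ^ 'n \<Rightarrow> complex"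
  assumes p: "1 < p" and F: "\<And>i. i \<in> I \<Longrightarrow> F i \<in> borel_measurable torus_measure"
    and bdd: "(SUP i\<in>I. Lp_norm torus_measure p (F i)) < \<infinity>"
  obtains V :: "(complex ^ 'n \<Rightarrow> complex) set" and q B :: real where
    "1 < q" "\<And>g. g \<in> V \<Longrightarrow> g \<in> borel_measurable torus_measure"
    "\<And>g. g \<in> V \<Longrightarrow> integrable torus_measure (\<lambda>x. norm (g x) powr q)"
    "\<And>g. g \<in> V \<Longrightarrow> (LINT x|torus_measure. norm (g x) powr q) \<le> B"
    "\<And>f g. f \<in> V \<Longrightarrow> g \<in> V \<Longrightarrow> (\<lambda>x. (f x + g x) / 2) \<in> V"
    "\<And>i. i \<in> I \<Longrightarrow> F i \<in> V"
    "\<And>g \<psi>. (\<And>n::nat. g n \<in> V) \<Longrightarrow> \<psi> \<in> borel_measurable torus_measure \<Longrightarrow>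
        (AE x in torus_measure. (\<lambda>n. g n x) \<longlonglongrightarrow> \<psi> x) \<Longrightarrow> \<psi> \<in> Lp_space torus_measure p"
proof -
  let ?T = "torus_measure :: (complex ^ 'n) measure"
  obtain M where M: "(SUP i\<in>I. Lp_norm ?T p (F i)) = ennreal M" "M \<ge> 0"
    using bdd by (cases "SUP i\<in>I. Lp_norm ?T p (F i)") auto
  have FM: "Lp_norm ?T p (F i) \<le> ennreal M" if "i \<in> I" for i
    unfolding M(1)[symmetric] using that by (rule SUP_upper)
  show ?thesis
  proof (cases "p = \<infinity>")
    case True
    define V :: "(complex ^ 'n \<Rightarrow> complex) set" where "V = {g \<in> borel_measurable ?T. AE x in ?T. norm (g x) \<le> M}"
    have pw: "AE x in ?T. norm (norm (g x) powr 2) \<le> M powr 2" if "g \<in> V" for g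
    proof -
      have "AE x in ?T. norm (g x) \<le> M" using that by (simp add: V_def)
      then show ?thesis by eventually_elim (use M(2) in \<open>auto intro!: power_mono\<close>)
    qed
    have int: "integrable ?T (\<lambda>x. norm (g x) powr 2)" if "g \<in> V" for g
      by (rule torus.integrable_const_bound[OF pw[OF that]]) (use that in \<open>auto simp: V_def\<close>)
    show ?thesis
    proof (rule that[of 2 V "M powr 2"])
      show "(LINT x|?T. norm (g x) powr 2) \<le> M powr 2" if "g \<in> V" for g
      proof -
        have "(LINT x|?T. norm (g x) powr 2) \<le> (LINT x|?T. M powr 2)"
          by (rule integral_mono_AE[OF int[OF that]]) (use pw[OF that] in auto)
        then show ?thesis by (simp add: torus.prob_space[simplified] del: powr_numeral)
      qed
      show "(\<lambda>x. (f x + g x) / 2) \<in> V" if "f \<in> V" "g \<in> V" for f g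
      proof -
        have "AE x in ?T. norm (f x) \<le> M" "AE x in ?T. norm (g x) \<le> M" using that by (auto simp: V_def)
        then have "AE x in ?T. norm ((f x + g x) / 2) \<le> M"
        proof eventually_elim
          case (elim x)
          then show ?case using norm_triangle_ineq[of "f x" "g x"] by (simp add: norm_divide)
        qed
        then show ?thesis using that by (auto simp: V_def)
      qed
      show "F i \<in> V" if "i \<in> I" for i
      proof -
        have le: "esssup ?T (\<lambda>x. ennreal (norm (F i x))) \<le> ennreal M" using FM[OF that] True by (simp add: Lp_norm_def)
        have "AE x in ?T. ennreal (norm (F i x)) \<le> esssup ?T (\<lambda>x. ennreal (norm (F i x)))" by (rule esssup_AE)
        then have "AE x in ?T. norm (F i x) \<le> M"
        proof eventually_elim
          case (elim x)
          from order_trans[OF elim le] show ?case using M(2) by simp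
        qed
        then show ?thesis using F[OF that] by (simp add: V_def)
      qed
      show "\<psi> \<in> Lp_space ?T p" if g: "\<And>n::nat. g n \<in> V" and \<psi>: "\<psi> \<in> borel_measurable ?T"
        and lim: "AE x in ?T. (\<lambda>n. g n x) \<longlonglongrightarrow> \<psi> x" for g \<psi>
      proof -
        have "AE x in ?T. \<forall>n. norm (g n x) \<le> M" using g by (simp add: AE_all_countable V_def)
        with lim have "AE x in ?T. ennreal (norm (\<psi> x)) \<le> ennreal M"
        proof eventually_elim
          case (elim x)
          then have "norm (\<psi> x) \<le> M" by (intro Lim_bounded[OF tendsto_norm[OF elim(1)]]) auto
          then show ?case by (rule ennreal_leI)
        qed
        then have "esssup ?T (\<lambda>x. ennreal (norm (\<psi> x))) \<le> ennreal M" using \<psi> by (intro esssup_I) auto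
        then show ?thesis using \<psi> True by (simp add: Lp_space_def Lp_norm_def le_less_trans)
      qed
    qed (use int in \<open>auto simp: V_def\<close>)
  next
    case False
    define q where "q = enn2real p"
    have q: "q > 1" using p False unfolding q_def
      by (metis ennreal_enn2real_if ennreal_less_iff enn2real_nonneg ennreal_1 infinity_ennreal_def zero_le_one)
    define V :: "(complex ^ 'n \<Rightarrow> complex) set" where "V = {g \<in> borel_measurable ?T. integrable ?T (\<lambda>x. norm (g x) powr q) \<and> (LINT x|?T. norm (g x) powr q) \<le> M powr q}"
    show ?thesis
    proof (rule that[of q V "M powr q"])
      show "1 < q" by (rule q)
      show "(\<lambda>x. (f x + g x) / 2) \<in> V" if f: "f \<in> V" and g: "g \<in> V" for f g
      proof -
        have le: "norm ((f x + g x) / 2) powr q \<le> (norm (f x) powr q + norm (g x) powr q) / 2" for x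
        proof -
          have "norm ((f x + g x) / 2) powr q \<le> ((norm (f x) + norm (g x)) / 2) powr q"
            using norm_triangle_ineq[of "f x" "g x"] q by (intro powr_mono2) (auto simp: norm_divide)
          also have "\<dots> \<le> (norm (f x) powr q + norm (g x) powr q) / 2" using q by (intro powr_midpoint) auto
          finally show ?thesis .
        qed
        have ib: "integrable ?T (\<lambda>x. (norm (f x) powr q + norm (g x) powr q) / 2)" using f g by (auto simp: V_def)
        have m: "(\<lambda>x. (f x + g x) / 2) \<in> borel_measurable ?T" using f g by (auto simp: V_def)
        have i: "integrable ?T (\<lambda>x. norm ((f x + g x) / 2) powr q)"
        proof (rule Bochner_Integration.integrable_bound[OF ib])
          show "(\<lambda>x. norm ((f x + g x) / 2) powr q) \<in> borel_measurable ?T" using m by measurable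
        qed (use le in \<open>auto intro!: AE_I2\<close>)
        have "(LINT x|?T. norm ((f x + g x) / 2) powr q) \<le> (LINT x|?T. (norm (f x) powr q + norm (g x) powr q) / 2)"
          by (intro integral_mono i ib le)
        also have "\<dots> \<le> M powr q" using f g by (auto simp: V_def)
        finally show ?thesis using i m by (simp add: V_def)
      qed
      show "F i \<in> V" if "i \<in> I" for i
      proof -
        let ?I = "\<integral>\<^sup>+ x. ennreal (norm (F i x) powr q) \<partial>?T"
        have ne: "?I \<noteq> \<infinity>" and le: "ennreal (enn2real ?I powr (1 / q)) \<le> ennreal M"
          using FM[OF that] False by (auto simp: Lp_norm_def Let_def q_def top_unique split: if_splits)
        have int: "integrable ?T (\<lambda>x. norm (F i x) powr q)"
          using F[OF that] ne by (intro integrableI_nonneg) (auto simp: top.not_eq_extremum)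
        have "enn2real ?I powr (1 / q) \<le> M" using le M(2) by (simp add: ennreal_le_iff)
        then have "(enn2real ?I powr (1 / q)) powr q \<le> M powr q" using q by (intro powr_mono2) auto
        then have "enn2real ?I \<le> M powr q" using q by (simp add: powr_powr)
        moreover have "(LINT x|?T. norm (F i x) powr q) = enn2real ?I"
          using F[OF that] by (intro integral_eq_nn_integral) auto
        ultimately show ?thesis using int F[OF that] by (simp add: V_def)
      qed
      show "\<psi> \<in> Lp_space ?T p" if g: "\<And>n::nat. g n \<in> V" and \<psi>: "\<psi> \<in> borel_measurable ?T"
        and lim: "AE x in ?T. (\<lambda>n. g n x) \<longlonglongrightarrow> \<psi> x" for g \<psi>
      proof -
        have gm: "g n \<in> borel_measurable ?T" for n using g by (simp add: V_def)
        have "(\<integral>\<^sup>+ x. ennreal (norm (\<psi> x) powr q) \<partial>?T) = (\<integral>\<^sup>+ x. liminf (\<lambda>n. ennreal (norm (g n x) powr q)) \<partial>?T)"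
        proof (rule nn_integral_cong_AE)
          show "AE x in ?T. ennreal (norm (\<psi> x) powr q) = liminf (\<lambda>n. ennreal (norm (g n x) powr q))"
            using lim
          proof eventually_elim
            case (elim x)
            have "(\<lambda>n. ennreal (norm (g n x) powr q)) \<longlonglongrightarrow> ennreal (norm (\<psi> x) powr q)"
              using q by (intro tendsto_ennrealI tendsto_powr' tendsto_norm elim tendsto_const) auto
            then show ?case by (intro lim_imp_Liminf[symmetric]) auto
          qed
        qed
        also have "\<dots> \<le> liminf (\<lambda>n. \<integral>\<^sup>+ x. ennreal (norm (g n x) powr q) \<partial>?T)"
          using gm by (intro nn_integral_liminf) auto
        also have "\<dots> \<le> ennreal (M powr q)"
        proof (rule order_trans[OF Liminf_le_Limsup])
          have "(\<integral>\<^sup>+ x. ennreal (norm (g n x) powr q) \<partial>?T) \<le> ennreal (M powr q)" for n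
          proof -
            have "(\<integral>\<^sup>+ x. ennreal (norm (g n x) powr q) \<partial>?T) = ennreal (LINT x|?T. norm (g n x) powr q)"
              using g[of n] by (intro nn_integral_eq_integral) (auto simp: V_def)
            also have "\<dots> \<le> ennreal (M powr q)" using g[of n] by (intro ennreal_leI) (simp add: V_def)
            finally show ?thesis .
          qed
          then show "limsup (\<lambda>n. \<integral>\<^sup>+ x. ennreal (norm (g n x) powr q) \<partial>?T) \<le> ennreal (M powr q)"
            by (intro Limsup_bounded always_eventually allI)
        qed auto
        finally have "(\<integral>\<^sup>+ x. ennreal (norm (\<psi> x) powr q) \<partial>?T) \<noteq> \<infinity>" by (auto simp: top_unique)
        then show ?thesis using \<psi> False by (simp add: Lp_space_def Lp_norm_def Let_def q_def)
      qed
    qed (auto simp: V_def)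
  qed
qed


text \<open>
  \<open>S n\<close> consists of the members of the ball whose Fourier coefficients up to the \<open>n\<close>-th, in an enumeration of the
  countably many frequencies, are \<open>1 / (n + 1)\<close>-close to the prescribed limits. It is closed under midpoints because the
  coefficients are linear, and nonempty because it contains \<open>U r\<close> for \<open>r\<close> near \<open>1\<close>.
\<close>
lemma fcoef_limit:
  fixes V :: "(complex ^ 'n \<Rightarrow> complex) set" and U :: "real \<Rightarrow> complex ^ 'n \<Rightarrow> complex" and q B :: real
  assumes q: "1 < q" and meas: "\<And>g. g \<in> V \<Longrightarrow> g \<in> borel_measurable torus_measure"
    and int: "\<And>g. g \<in> V \<Longrightarrow> integrable torus_measure (\<lambda>x. norm (g x) powr q)"
    and bd: "\<And>g. g \<in> V \<Longrightarrow> (LINT x|torus_measure. norm (g x) powr q) \<le> B"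
    and mid: "\<And>f g. f \<in> V \<Longrightarrow> g \<in> V \<Longrightarrow> (\<lambda>x. (f x + g x) / 2) \<in> V"
    and U: "\<And>r. r \<in> {0..<1} \<Longrightarrow> U r \<in> V"
    and lim: "\<And>m. ((\<lambda>r. fcoef (U r) m) \<longlongrightarrow> C m) (at_left 1)"
  obtains g \<psi> where "\<And>n::nat. g n \<in> V" "integrable torus_measure \<psi>"
    "AE x in torus_measure. (\<lambda>n. g n x) \<longlonglongrightarrow> \<psi> x" "\<And>m. fcoef \<psi> m = C m"
proof -
  let ?T = "torus_measure :: (complex ^ 'n) measure"
  have ig: "integrable ?T g" if "g \<in> V" for g
  proof -
    have i: "integrable ?T (\<lambda>x. 1 + norm (g x) powr q)" using int[OF that] by simp
    show ?thesis
      by (rule Bochner_Integration.integrable_bound[OF i meas[OF that]])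
         (use le_one_plus_powr q in \<open>auto intro!: AE_I2 simp: less_imp_le\<close>)
  qed
  have igc: "integrable ?T (\<lambda>\<zeta>. g \<zeta> * chr m \<zeta>)" if "integrable ?T g" for g m
    by (rule torus_continuous_integrable_mult[OF continuous_on_chr that])
  define fr where "fr i = (from_nat i :: 'n \<Rightarrow> int)" for i
  define S where "S n = {g \<in> V. \<forall>i\<le>n. norm (fcoef g (fr i) - C (fr i)) \<le> 1 / (real n + 1)}" for n
  have ne: "S n \<noteq> {}" for n
  proof -
    have "eventually (\<lambda>r. \<forall>i\<in>{..n}. dist (fcoef (U r) (fr i)) (C (fr i)) < 1 / (real n + 1)) (at_left 1)"
      by (intro eventually_ball_finite ballI tendstoD lim) auto
    moreover have "eventually (\<lambda>r. r \<in> {0<..<1::real}) (at_left 1)" by (rule eventually_at_left_real) simp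
    ultimately have "eventually (\<lambda>r. U r \<in> S n) (at_left 1)"
    proof eventually_elim
      case (elim r)
      then have "norm (fcoef (U r) (fr i) - C (fr i)) \<le> 1 / (real n + 1)" if "i \<le> n" for i
        using that by (auto simp: dist_norm intro: less_imp_le)
      then show ?case using U[of r] elim by (auto simp: S_def)
    qed
    then obtain r where "U r \<in> S n" using eventually_happens'[OF trivial_limit_at_left_real] by blast
    then show ?thesis by auto
  qed
  have dec: "decseq S"
  proof (rule decseq_SucI)
    fix n
    have le: "1 / (real (Suc n) + 1) \<le> 1 / (real n + 1)" by (intro divide_left_mono) auto
    show "S (Suc n) \<subseteq> S n"
    proof
      fix g assume g: "g \<in> S (Suc n)"
      then have "norm (fcoef g (fr i) - C (fr i)) \<le> 1 / (real n + 1)" if "i \<le> n" for i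
        using that by (intro order_trans[OF _ le]) (simp add: S_def)
      then show "g \<in> S n" using g by (simp add: S_def)
    qed
  qed
  have midS: "(\<lambda>x. (f x + g x) / 2) \<in> S n" if f: "f \<in> S n" and g: "g \<in> S n" for f g n
  proof -
    have fV: "f \<in> V" and gV: "g \<in> V" using f g by (auto simp: S_def)
    have "norm (fcoef (\<lambda>x. (f x + g x) / 2) (fr i) - C (fr i)) \<le> 1 / (real n + 1)" if "i \<le> n" for i
    proof -
      have "fcoef (\<lambda>x. (f x + g x) / 2) (fr i) = (LINT \<zeta>|?T. (f \<zeta> * chr (fr i) \<zeta> + g \<zeta> * chr (fr i) \<zeta>) / 2)"
        unfolding fcoef_def by (intro Bochner_Integration.integral_cong) (auto simp: field_simps)
      also have "\<dots> = (fcoef f (fr i) + fcoef g (fr i)) / 2"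
        using igc[OF ig[OF fV]] igc[OF ig[OF gV]] by (simp add: fcoef_def)
      finally have eq: "fcoef (\<lambda>x. (f x + g x) / 2) (fr i) - C (fr i) = ((fcoef f (fr i) - C (fr i)) + (fcoef g (fr i) - C (fr i))) / 2"
        by (simp add: field_simps)
      have "norm (fcoef (\<lambda>x. (f x + g x) / 2) (fr i) - C (fr i)) \<le> (norm (fcoef f (fr i) - C (fr i)) + norm (fcoef g (fr i) - C (fr i))) / 2"
        using norm_triangle_ineq[of "fcoef f (fr i) - C (fr i)" "fcoef g (fr i) - C (fr i)"]
        unfolding eq norm_divide by simp
      moreover have "norm (fcoef f (fr i) - C (fr i)) \<le> 1 / (real n + 1)" "norm (fcoef g (fr i) - C (fr i)) \<le> 1 / (real n + 1)"
        using f g that by (auto simp: S_def)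
      moreover have "x \<le> d" if "x \<le> (a + b) / 2" "a \<le> d" "b \<le> d" for x a b d :: real
        using that by (simp add: field_simps)
      ultimately show ?thesis by blast
    qed
    then show ?thesis using mid[OF fV gV] by (simp add: S_def)
  qed
  have SV: "g \<in> V" if "g \<in> S n" for g n using that by (simp add: S_def)
  obtain g \<psi> where g: "\<And>n. g n \<in> S n" and \<psi>: "integrable ?T \<psi>" and ae: "AE x in ?T. (\<lambda>n. g n x) \<longlonglongrightarrow> \<psi> x"
    and L1: "(\<lambda>n. LINT x|?T. norm (g n x - \<psi> x)) \<longlonglongrightarrow> 0"
  proof (rule prob_space.midpoint_convex_L1_limit[OF torus.prob_space_axioms q meas[OF SV] int[OF SV] bd[OF SV] ne dec midS])
    fix g \<psi>
    assume "\<And>n. g n \<in> S n" "integrable ?T \<psi>" "AE x in ?T. (\<lambda>n. g n x) \<longlonglongrightarrow> \<psi> x"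
      "(\<lambda>n. LINT x|?T. norm (g n x - \<psi> x)) \<longlonglongrightarrow> 0"
    then show thesis by (rule that)
  qed
  have "fcoef \<psi> m = C m" for m
  proof -
    have "(\<lambda>n. fcoef (g n) m - fcoef \<psi> m) \<longlonglongrightarrow> 0"
    proof (rule Lim_null_comparison[OF _ L1], rule always_eventually, rule allI)
      fix n
      have "fcoef (g n) m - fcoef \<psi> m = (LINT \<zeta>|?T. g n \<zeta> * chr m \<zeta> - \<psi> \<zeta> * chr m \<zeta>)"
        using igc[OF ig[OF SV[OF g[of n]]]] igc[OF \<psi>] by (simp add: fcoef_def)
      also have "norm \<dots> \<le> (LINT \<zeta>|?T. norm (g n \<zeta> - \<psi> \<zeta>))"
      proof (rule Bochner_Integration.integral_norm_bound_integral)
        show "integrable ?T (\<lambda>\<zeta>. g n \<zeta> * chr m \<zeta> - \<psi> \<zeta> * chr m \<zeta>)"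
          using igc[OF ig[OF SV[OF g[of n]]]] igc[OF \<psi>] by simp
        show "integrable ?T (\<lambda>\<zeta>. norm (g n \<zeta> - \<psi> \<zeta>))" using ig[OF SV[OF g[of n]]] \<psi> by simp
        show "norm (g n \<zeta> * chr m \<zeta> - \<psi> \<zeta> * chr m \<zeta>) \<le> norm (g n \<zeta> - \<psi> \<zeta>)" if "\<zeta> \<in> space ?T" for \<zeta>
        proof -
          have "g n \<zeta> * chr m \<zeta> - \<psi> \<zeta> * chr m \<zeta> = (g n \<zeta> - \<psi> \<zeta>) * chr m \<zeta>" by (simp add: left_diff_distrib)
          then show ?thesis using that by (simp only: norm_mult) (simp add: norm_chr)
        qed
      qed
      finally show "norm (fcoef (g n) m - fcoef \<psi> m) \<le> (LINT \<zeta>|?T. norm (g n \<zeta> - \<psi> \<zeta>))" .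
    qed
    then have l1: "(\<lambda>n. fcoef (g n) m) \<longlonglongrightarrow> fcoef \<psi> m" by (simp add: LIM_zero_iff)
    define i where "i = to_nat m"
    have m: "m = fr i" by (simp add: fr_def i_def)
    have z: "(\<lambda>n. 1 / (real n + 1)) \<longlonglongrightarrow> 0"
      using LIMSEQ_inverse_real_of_nat by (simp add: inverse_eq_divide add.commute)
    have "(\<lambda>n. fcoef (g n) m - C m) \<longlonglongrightarrow> 0"
    proof (rule Lim_null_comparison[OF _ z])
      show "eventually (\<lambda>n. norm (fcoef (g n) m - C m) \<le> 1 / (real n + 1)) sequentially"
        using eventually_ge_at_top[of i]
        by eventually_elim (use g in \<open>auto simp: S_def m\<close>)
    qed
    then have l2: "(\<lambda>n. fcoef (g n) m) \<longlonglongrightarrow> C m" by (simp add: LIM_zero_iff)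
    show ?thesis by (rule LIMSEQ_unique[OF l1 l2])
  qed
  then show ?thesis using that[OF SV[OF g] \<psi> ae] by blast
qed

section \<open>The representation theorem\<close>

lemma continuous_fcoef_unique:
  fixes f g :: "complex ^ 'n \<Rightarrow> complex"
  assumes f: "continuous_on torus f" and g: "continuous_on torus g" and eq: "\<And>m. fcoef f m = fcoef g m"
    and \<zeta>: "\<zeta> \<in> torus"
  shows "f \<zeta> = g \<zeta>"
proof -
  have c: "continuous_on torus (\<lambda>\<zeta>. f \<zeta> - g \<zeta>)" by (intro continuous_intros f g)
  have "AE \<zeta> in torus_measure. f \<zeta> - g \<zeta> = 0"
  proof (rule torus_fourier_unique[OF torus_continuous_integrable[OF c]])
    fix m
    have "(LINT \<zeta>|torus_measure. f \<zeta> * chr m \<zeta> - g \<zeta> * chr m \<zeta>) = fcoef f m - fcoef g m"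
      unfolding fcoef_def
      by (intro Bochner_Integration.integral_diff torus_continuous_integrable continuous_on_mult f g continuous_on_chr)
    then show "(LINT \<zeta>|torus_measure. (f \<zeta> - g \<zeta>) * chr m \<zeta>) = 0" by (simp add: eq left_diff_distrib)
  qed
  from torus_continuous_AE_zero[OF c this \<zeta>] show ?thesis by simp
qed

text \<open>
  At a zero coordinate the radius is \<open>0\<close> and any unimodular value serves as \<open>\<zeta>\<^sub>j\<close>.
\<close>
lemma polydisc_dilate:
  fixes z :: "complex ^ 'n"
  assumes "z \<in> polydisc"
  obtains \<rho> \<zeta> where "\<rho> \<in> radii" "\<zeta> \<in> torus" "z = dilate \<rho> \<zeta>"
proof
  show "(\<lambda>j. norm (z $ j)) \<in> radii" using assms by (simp add: radii_def polydisc_def)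
  show "(\<chi> j. if z $ j = 0 then 1 else sgn (z $ j)) \<in> torus" by (simp add: torus_def norm_sgn)
  show "z = dilate (\<lambda>j. norm (z $ j)) (\<chi> j. if z $ j = 0 then 1 else sgn (z $ j))"
    by (simp add: dilate_def vec_eq_iff sgn_eq)
qed

theorem theorem3p17:
  fixes \<alpha> \<beta> :: "complex ^ 'n" and p :: ennreal and u :: "complex ^ 'n \<Rightarrow> complex"
  assumes re: "\<And>j. Re (\<alpha> $ j) + Re (\<beta> $ j) > -1"
    and \<alpha>: "\<And>j (k::nat). k \<ge> 1 \<Longrightarrow> \<alpha> $ j \<noteq> - of_nat k"
    and \<beta>: "\<And>j (k::nat). k \<ge> 1 \<Longrightarrow> \<beta> $ j \<noteq> - of_nat k"
    and p: "1 < p"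
    and harm: "separately_harmonic \<alpha> \<beta> u"
    and bdd: "(SUP r\<in>{0..<1::real}. Lp_norm torus_measure p (\<lambda>\<zeta>. u (r *\<^sub>R \<zeta>))) < \<infinity>"
  shows "\<exists>\<psi>\<in>Lp_space torus_measure p.
           (\<forall>z\<in>polydisc. u z = poisson_integral \<alpha> \<beta> \<psi> z) \<and>
           (\<forall>\<phi>\<in>Lp_space torus_measure p.
              (\<forall>z\<in>polydisc. u z = poisson_integral \<alpha> \<beta> \<phi> z) \<longrightarrow>
              (AE \<zeta> in torus_measure. \<phi> \<zeta> = \<psi> \<zeta>))"
proof -
  define \<Phi> where "\<Phi> m \<rho> = (\<Prod>j\<in>UNIV. radial_factor (\<alpha> $ j) (\<beta> $ j) (m j) (\<rho> j))" for m :: "'n \<Rightarrow> int" and \<rho>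
  have cu: "continuous_on polydisc u" using harm by (simp add: separately_harmonic_def C2_on_continuous)
  have const: "(\<lambda>_. r) \<in> radii" if "r \<in> {0..<1}" for r :: real using that by (simp add: radii_def)
  have scale: "r *\<^sub>R \<zeta> = dilate (\<lambda>_. r) \<zeta>" for r and \<zeta> :: "complex ^ 'n"
    unfolding dilate_def vec_eq_iff by (simp only: vector_scaleR_component vec_lambda_beta) (simp add: scaleR_conv_of_real)
  have nonpos: "x + 1 \<notin> \<int>\<^sub>\<le>\<^sub>0" if "\<And>k::nat. k \<ge> 1 \<Longrightarrow> x \<noteq> - of_nat k" for x :: complex
  proof
    assume "x + 1 \<in> \<int>\<^sub>\<le>\<^sub>0"
    then obtain n where "x + 1 = - of_nat n" by (elim nonpos_Ints_cases')
    then have "x = - of_nat (Suc n)" by (simp add: algebra_simps eq_neg_iff_add_eq_0)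
    with that[of "Suc n"] show False by simp
  qed
  have \<Phi>_lim: "((\<lambda>r. \<Phi> m (\<lambda>_. r)) \<longlongrightarrow> 1) (at_left 1)" for m
  proof -
    have "((\<lambda>r. \<Phi> m (\<lambda>_. r)) \<longlongrightarrow> (\<Prod>j\<in>(UNIV::'n set). 1)) (at_left 1)"
      unfolding \<Phi>_def radial_factor_def
      by (intro tendsto_prod mode_polar_kernel_tendsto re nonpos \<alpha> \<beta>)
    then show ?thesis by simp
  qed
  have \<Phi>_nz: "\<exists>r\<in>{0..<1}. \<Phi> m (\<lambda>_. r) \<noteq> 0" for m
  proof -
    have "eventually (\<lambda>r. \<Phi> m (\<lambda>_. r) \<noteq> 0) (at_left 1)"
      by (rule tendsto_imp_eventually_ne[OF \<Phi>_lim]) simp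
    moreover have "eventually (\<lambda>r. r \<in> {0<..<1::real}) (at_left 1)" by (rule eventually_at_left_real) simp
    ultimately have "eventually (\<lambda>r. r \<in> {0..<1} \<and> \<Phi> m (\<lambda>_. r) \<noteq> 0) (at_left 1)" by eventually_elim auto
    from eventually_happens'[OF trivial_limit_at_left_real this] show ?thesis by blast
  qed
  \<comment> \<open>A radius where the product of the radial factors does not vanish; it depends on \<open>m\<close>.\<close>
  then obtain R where R: "\<And>m. R m \<in> {0..<1}" "\<And>m. \<Phi> m (\<lambda>_. R m) \<noteq> 0" by metis
  define C where "C m = fcoef (\<lambda>\<zeta>. u (dilate (\<lambda>_. R m) \<zeta>)) m / \<Phi> m (\<lambda>_. R m)" for m
  have coef: "fcoef (\<lambda>\<zeta>. u (dilate \<rho> \<zeta>)) m = C m * \<Phi> m \<rho>" if "\<rho> \<in> radii" for \<rho> m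
    using fcoef_product[OF harm that const[OF R(1)[of m]], of m] R(2)[of m]
    unfolding C_def \<Phi>_def by (simp add: field_simps)
  have meas: "(\<lambda>\<zeta>. u (r *\<^sub>R \<zeta>)) \<in> borel_measurable torus_measure" if "r \<in> {0..<1}" for r
    unfolding scale by (intro torus_continuous_measurable continuous_dilate cu const that)
  have lim: "((\<lambda>r. fcoef (\<lambda>\<zeta>. u (r *\<^sub>R \<zeta>)) m) \<longlongrightarrow> C m) (at_left 1)" for m
  proof -
    have "((\<lambda>r. C m * \<Phi> m (\<lambda>_. r)) \<longlongrightarrow> C m * 1) (at_left 1)" by (intro tendsto_intros \<Phi>_lim)
    moreover have "eventually (\<lambda>r. r \<in> {0<..<1::real}) (at_left 1)" by (rule eventually_at_left_real) simp
    then have "eventually (\<lambda>r. C m * \<Phi> m (\<lambda>_. r) = fcoef (\<lambda>\<zeta>. u (r *\<^sub>R \<zeta>)) m) (at_left 1)"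
      by eventually_elim (simp add: scale coef const)
    ultimately show ?thesis by (simp add: Lim_transform_eventually)
  qed
  obtain V q B where V: "1 < q" "\<And>g. g \<in> V \<Longrightarrow> g \<in> borel_measurable torus_measure"
    "\<And>g. g \<in> V \<Longrightarrow> integrable torus_measure (\<lambda>x. norm (g x) powr q)"
    "\<And>g. g \<in> V \<Longrightarrow> (LINT x|torus_measure. norm (g x) powr q) \<le> B"
    "\<And>f g. f \<in> V \<Longrightarrow> g \<in> V \<Longrightarrow> (\<lambda>x. (f x + g x) / 2) \<in> V"
    "\<And>r. r \<in> {0..<1::real} \<Longrightarrow> (\<lambda>\<zeta>. u (r *\<^sub>R \<zeta>)) \<in> V"
    and VL: "\<And>g \<psi>. (\<And>n::nat. g n \<in> V) \<Longrightarrow> \<psi> \<in> borel_measurable torus_measure \<Longrightarrow>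
        (AE x in torus_measure. (\<lambda>n. g n x) \<longlonglongrightarrow> \<psi> x) \<Longrightarrow> \<psi> \<in> Lp_space torus_measure p"
    by (rule Lp_ball[OF p meas bdd]) (assumption, blast)
  obtain g \<psi> where g: "\<And>n::nat. g n \<in> V" and \<psi>: "integrable torus_measure \<psi>"
    and ae: "AE x in torus_measure. (\<lambda>n. g n x) \<longlonglongrightarrow> \<psi> x" and \<psi>C: "\<And>m. fcoef \<psi> m = C m"
    using fcoef_limit[OF V lim] by blast
  have \<psi>L: "\<psi> \<in> Lp_space torus_measure p" using \<psi> by (intro VL[OF g _ ae]) simp
  have rep: "u z = poisson_integral \<alpha> \<beta> \<psi> z" if z: "z \<in> polydisc" for z
  proof -
    obtain \<rho> \<zeta> where \<rho>: "\<rho> \<in> radii" and \<zeta>: "\<zeta> \<in> torus" and z: "z = dilate \<rho> \<zeta>" using polydisc_dilate[OF z] by blast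
    show ?thesis
      unfolding z
    proof (rule continuous_fcoef_unique[OF continuous_dilate[OF cu \<rho>] continuous_poisson_integral[OF \<psi> \<rho>] _ \<zeta>])
      show "fcoef (\<lambda>\<zeta>. u (dilate \<rho> \<zeta>)) m = fcoef (\<lambda>\<zeta>. poisson_integral \<alpha> \<beta> \<psi> (dilate \<rho> \<zeta>)) m" for m
        unfolding coef[OF \<rho>] fcoef_poisson_integral[OF \<psi> \<rho>] \<psi>C \<Phi>_def ..
    qed
  qed
  have uniq: "AE \<zeta> in torus_measure. f \<zeta> = \<psi> \<zeta>"
    if f: "f \<in> Lp_space torus_measure p" and fu: "\<forall>z\<in>polydisc. u z = poisson_integral \<alpha> \<beta> f z" for f
  proof -
    have fi: "integrable torus_measure f" by (rule Lp_space_integrable[OF p f])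
    have fC: "fcoef f m = C m" for m
    proof -
      let ?\<rho> = "\<lambda>_. R m"
      have "fcoef f m * \<Phi> m ?\<rho> = fcoef (\<lambda>\<zeta>. poisson_integral \<alpha> \<beta> f (dilate ?\<rho> \<zeta>)) m"
        unfolding fcoef_poisson_integral[OF fi const[OF R(1)]] \<Phi>_def ..
      also have "\<dots> = fcoef (\<lambda>\<zeta>. u (dilate ?\<rho> \<zeta>)) m"
        unfolding fcoef_def
      proof (rule Bochner_Integration.integral_cong[OF refl])
        fix \<zeta> :: "complex ^ 'n" assume "\<zeta> \<in> space torus_measure"
        then have "dilate ?\<rho> \<zeta> \<in> polydisc" using dilate_polydisc[OF const[OF R(1)]] by simp
        then show "poisson_integral \<alpha> \<beta> f (dilate ?\<rho> \<zeta>) * chr m \<zeta> = u (dilate ?\<rho> \<zeta>) * chr m \<zeta>"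
          using fu by simp
      qed
      also have "\<dots> = C m * \<Phi> m ?\<rho>" by (rule coef[OF const[OF R(1)]])
      finally show ?thesis using R(2) by simp
    qed
    have "AE \<zeta> in torus_measure. f \<zeta> - \<psi> \<zeta> = 0"
    proof (rule torus_fourier_unique)
      show "integrable torus_measure (\<lambda>\<zeta>. f \<zeta> - \<psi> \<zeta>)" using fi \<psi> by simp
      fix m
      have "(LINT \<zeta>|torus_measure. f \<zeta> * chr m \<zeta> - \<psi> \<zeta> * chr m \<zeta>) = fcoef f m - fcoef \<psi> m"
        unfolding fcoef_def
        by (intro Bochner_Integration.integral_diff torus_continuous_integrable_mult continuous_on_chr fi \<psi>)
      then show "(LINT \<zeta>|torus_measure. (f \<zeta> - \<psi> \<zeta>) * chr m \<zeta>) = 0" by (simp add: fC \<psi>C left_diff_distrib)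
    qed
    then show ?thesis by eventually_elim simp
  qed
  show ?thesis using \<psi>L rep uniq by blast
qed

end
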